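(* Given a set $\mathcal{D}$ of $n$ disks in the plane and $\epsilon>0$, one can compute in $O(n+1/\epsilon^3)$ time two congruent disks $C_1,C_2$ of common radius $r$ with $\bigcup_{D\in\mathcal{D}}D\subseteq C_1\cup C_2$ and $r\le(1+\epsilon)r^*$, where $r^*$ is the smallest radius $\rho$ such that there exist two disks of radius $\rho$ whose union contains $\bigcup_{D\in\mathcal{D}}D$.
   Context: Disks are closed disks in the plane given by center and radius; computations are in the real-RAM model (with the floor function available). The paper assumes throughout that no disk of $\mathcal{D}$ contains another disk of $\mathcal{D}$. *)

theory Defs
  imports "HOL-Analysis.Analysis"
begin

type_synonym point = "real \<times> real"   (* Euclidean plane: the product metric is the L2 metric *)
type_synonym disk_rep = "point \<times> real"

definition disk :: "disk_rep \<Rightarrow> point set" where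
  "disk d = cball (fst d) (snd d)"

definition union_disks :: "disk_rep list \<Rightarrow> point set" where
  "union_disks ds = (\<Union>d\<in>set ds. disk d)"

definition two_center_radius :: "disk_rep list \<Rightarrow> real" where
  "two_center_radius ds =
     Inf {\<rho>. \<rho> \<ge> 0 \<and> (\<exists>c1 c2. union_disks ds \<subseteq> cball c1 \<rho> \<union> cball c2 \<rho>)}"

text \<open>Memory is an infinite array of reals indexed by naturals; every instruction
  costs one step. Indirect addressing uses the floor of a cell's content.\<close>

datatype instr =
    Const nat real
  | Add nat nat nat
  | Sub nat nat nat
  | Mul nat nat nat
  | Div nat nat nat
  | Sqrt nat nat
  | Floor nat nat
  | LoadI nat nat
  | StoreI nat nat
  | JLe nat nat nat

type_synonym config = "nat \<times> (nat \<Rightarrow> real)"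

fun exec_instr :: "instr \<Rightarrow> config \<Rightarrow> config" where
  "exec_instr (Const i c) (pc, m) = (Suc pc, m(i := c))"
| "exec_instr (Add i j k) (pc, m) = (Suc pc, m(i := m j + m k))"
| "exec_instr (Sub i j k) (pc, m) = (Suc pc, m(i := m j - m k))"
| "exec_instr (Mul i j k) (pc, m) = (Suc pc, m(i := m j * m k))"
| "exec_instr (Div i j k) (pc, m) = (Suc pc, m(i := m j / m k))"
| "exec_instr (Sqrt i j) (pc, m) = (Suc pc, m(i := sqrt (m j)))"
| "exec_instr (Floor i j) (pc, m) = (Suc pc, m(i := of_int \<lfloor>m j\<rfloor>))"
| "exec_instr (LoadI i j) (pc, m) = (Suc pc, m(i := m (nat \<lfloor>m j\<rfloor>)))"
| "exec_instr (StoreI i j) (pc, m) = (Suc pc, m(nat \<lfloor>m i\<rfloor> := m j))"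
| "exec_instr (JLe i j l) (pc, m) = (if m i \<le> m j then l else Suc pc, m)"

definition step :: "instr list \<Rightarrow> config \<Rightarrow> config" where
  "step P s = (if fst s < length P then exec_instr (P ! fst s) s else s)"

definition run :: "instr list \<Rightarrow> nat \<Rightarrow> config \<Rightarrow> config" where
  "run P k s = (step P ^^ k) s"

definition halted :: "instr list \<Rightarrow> config \<Rightarrow> bool" where
  "halted P s \<longleftrightarrow> fst s \<ge> length P"

definition init_config :: "disk_rep list \<Rightarrow> real \<Rightarrow> config" where
  "init_config ds eps =
     (0, \<lambda>a. if a = 0 then real (length ds)
             else if a = 1 then eps
             else if a \<ge> 2 \<and> a < 2 + 3 * length ds then
               (let k = (a - 2) div 3; r = (a - 2) mod 3; d = ds ! k in
                 if r = 0 then fst (fst d) else if r = 1 then snd (fst d) else snd d)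
             else 0)"

text \<open>Output encoding: C1 = cball (m 0, m 1) (m 4), C2 = cball (m 2, m 3) (m 4).\<close>

end

theory Submission
  imports Defs
begin

text \<open>
  Let \<open>r\<close> be the optimal radius. The centre \<open>p1\<close> of one disk, the centre \<open>p2\<close> farthest from it, and the largest
  value \<open>q\<close> of (distance to the nearer of \<open>p1\<close>, \<open>p2\<close>) + (radius) satisfy \<open>r \<le> q \<le> 3 r\<close>. If \<open>p1\<close> and \<open>p2\<close> are more
  than \<open>8 q\<close> apart, no disk of a good solution touches both clusters, so the second cluster may be translated
  towards the first until the distance is \<open>8 q\<close>. With \<open>N\<close> of order \<open>1 / eps\<close> and unit length \<open>q / N\<close>,
  everything then lives in a square grid of side \<open>20 N\<close>, and an additive error of a constant number of units
  is affordable.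

  Disk centres are rounded to grid points, keeping the largest radius for each. A ray argument shows that two
  disks covering the boundary of a disk cover the disk, so it suffices to cover boundary points in \<open>O(N)\<close>
  directions, again rounded to grid points: \<open>O(N\<^sup>3)\<close> work for \<open>O(N\<^sup>2)\<close> sample points.

  Two disks of equal radius are separated by the bisector of their centres. After rotating one centre about the
  other by an angle of order \<open>1 / N\<close>, the bisector is perpendicular to one of \<open>O(N)\<close> fixed directions. For a
  direction and a radius, the samples are sorted into \<open>O(N)\<close> strips perpendicular to the direction, keeping the
  two extreme samples of each; for each of \<open>O(N)\<close> abscissae of a centre one scan determines how long an initial
  (final) segment of strips fits into a disk. This test costs \<open>O(N\<^sup>2)\<close>. Only \<open>O(N)\<close> tests are made: a
  successful test decreases the radius by one unit, a failed one moves on to the next direction.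
\<close>

section \<open>A structured language on the machine\<close>

text \<open>The bound forbids the obvious search: N directions times N radii times a test of cost
  N^2 gives N^4. So the radius is never raised and a failed direction never revisited. This loses
  nothing, because the direction close to the line of centres of a good pair passes at every radius
  above a fixed threshold; its single failure already bounds the current radius. The test stays at
  N^2 because only the abscissa of a centre is enumerated. A disk meets a line across its strips in
  an interval of ordinates, so two extreme samples represent a strip, and the admissible ordinates
  of a centre form one interval that is updated strip by strip. In units of q / N the errors add up
  to 293: 4 for samples against disks, 275 allowed for turning the line of centres and rounding to
  strips, 1 because the tested radius is one below the current one, and 13 for the way back from
  samples to disks. Since q is at most three times the optimum and 3 * 293 < 1000, any N > 1000 /
  eps suffices.\<close>

datatype bop = OAdd | OSub | OMul | ODiv
datatype uop = OSqrt | OFloor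
datatype exp = Var nat | Cst real | Bin bop exp exp | Uny uop exp | Heap exp

abbreviation "Root \<equiv> Uny OSqrt"
abbreviation "Flr \<equiv> Uny OFloor"

datatype com = Asg nat exp | Sto exp exp | Seq com com | Ite exp exp com com | For nat nat com

type_synonym state = "(nat \<Rightarrow> real) \<times> (nat \<Rightarrow> real)"

text \<open>The absolute value keeps heap accesses away from the registers without any side condition.\<close>
definition addr :: "real \<Rightarrow> nat" where "addr v = nat \<lfloor>\<bar>v\<bar>\<rfloor>"

fun ev :: "exp \<Rightarrow> state \<Rightarrow> real" where
  "ev (Var i) st = fst st i"
| "ev (Cst c) st = c"
| "ev (Bin OAdd a b) st = ev a st + ev b st"
| "ev (Bin OSub a b) st = ev a st - ev b st"
| "ev (Bin OMul a b) st = ev a st * ev b st"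
| "ev (Bin ODiv a b) st = ev a st / ev b st"
| "ev (Root a) st = sqrt (ev a st)"
| "ev (Flr a) st = of_int \<lfloor>ev a st\<rfloor>"
| "ev (Heap a) st = snd st (addr (ev a st))"

definition next_iter :: "nat \<Rightarrow> state \<Rightarrow> state" where
  "next_iter i st = ((fst st)(i := fst st i + 1), snd st)"

primrec exec :: "com \<Rightarrow> state \<Rightarrow> state" where
  "exec (Asg x e) st = ((fst st)(x := ev e st), snd st)"
| "exec (Sto a e) st = (fst st, (snd st)(addr (ev a st) := ev e st))"
| "exec (Seq c d) st = exec d (exec c st)"
| "exec (Ite a b c d) st = (if ev a st \<le> ev b st then exec c st else exec d st)"
| "exec (For i b c) st =
    ((\<lambda>st. next_iter i (exec c st)) ^^ nat \<lceil>fst st b\<rceil>) ((fst st)(i := 0), snd st)"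

text \<open>Cells below \<open>tmp\<close> hold the variables, those from \<open>tmp\<close> up to \<open>heap0\<close> are the evaluation stack, and heap
  address \<open>a\<close> is cell \<open>heap0 + a\<close>.\<close>
definition tmp :: nat where "tmp = 64"
definition heap0 :: nat where "heap0 = 80"

primrec bin_instr :: "bop \<Rightarrow> nat \<Rightarrow> nat \<Rightarrow> nat \<Rightarrow> instr" where
  "bin_instr OAdd = Add"
| "bin_instr OSub = Sub"
| "bin_instr OMul = Mul"
| "bin_instr ODiv = Div"

primrec un_instr :: "uop \<Rightarrow> nat \<Rightarrow> nat \<Rightarrow> instr" where
  "un_instr OSqrt = Sqrt"
| "un_instr OFloor = Floor"

text \<open>The value ends up in cell \<open>t\<close>, and only cells from \<open>t\<close> upwards
  are destroyed. Adding zero replaces a move instruction. For \<open>Heap\<close>, squaring and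
  taking the root yields the absolute value; the truncation is left to \<open>LoadI\<close>.\<close>

fun compe :: "nat \<Rightarrow> exp \<Rightarrow> instr list" where
  "compe t (Var i) = [Const t 0, Add t i t]"
| "compe t (Cst c) = [Const t c]"
| "compe t (Bin f a b) = compe t a @ compe (Suc t) b @ [bin_instr f t t (Suc t)]"
| "compe t (Uny f a) = compe t a @ [un_instr f t t]"
| "compe t (Heap a) = compe t a @
     [Mul t t t, Sqrt t t, Const (Suc t) (real heap0), Add t t (Suc t), LoadI t t]"

text \<open>Jump targets are absolute, so the address \<open>pc\<close> at which the code will stand
  is carried along. \<open>JLe 0 0\<close> is an unconditional jump.\<close>

primrec compc :: "nat \<Rightarrow> com \<Rightarrow> instr list" where
  "compc pc (Asg x e) = compe tmp e @ [Const (Suc tmp) 0, Add x tmp (Suc tmp)]"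
| "compc pc (Sto a e) = compe tmp a @ compe (Suc tmp) e @
     [Mul tmp tmp tmp, Sqrt tmp tmp, Const (Suc (Suc tmp)) (real heap0),
      Add tmp tmp (Suc (Suc tmp)), StoreI tmp (Suc tmp)]"
| "compc pc (Seq c d) = (let C = compc pc c in C @ compc (pc + length C) d)"
| "compc pc (Ite a b c d) =
     (let T = compe tmp a @ compe (Suc tmp) b;
          D = compc (pc + length T + 1) d;
          C = compc (pc + length T + length D + 2) c
      in T @ [JLe tmp (Suc tmp) (pc + length T + length D + 2)] @ D @
         [JLe 0 0 (pc + length T + length D + length C + 2)] @ C)"
| "compc pc (For i b c) =
     (let C = compc (pc + 2) c
      in [Const i 0, JLe b i (pc + length C + 5)] @ C @
         [Const tmp 1, Add i i tmp, JLe 0 0 (pc + 1)])"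

fun depth :: "exp \<Rightarrow> nat" where
  "depth (Bin f a b) = max (depth a) (Suc (depth b))"
| "depth (Uny f a) = depth a"
| "depth (Heap a) = max 2 (depth a)"
| "depth _ = 1"

fun evars :: "exp \<Rightarrow> nat set" where
  "evars (Var i) = {i}"
| "evars (Cst c) = {}"
| "evars (Bin f a b) = evars a \<union> evars b"
| "evars (Uny f a) = evars a"
| "evars (Heap a) = evars a"

text \<open>Evaluation starts at \<open>tmp\<close> or \<open>tmp + 1\<close>, and
  \<open>tmp + 1 + 12 \<le> heap0\<close>, so the stack never reaches the heap.\<close>

definition wfe :: "exp \<Rightarrow> bool" where
  "wfe e \<longleftrightarrow> (\<forall>i\<in>evars e. i < tmp) \<and> depth e \<le> 12"

primrec writes :: "com \<Rightarrow> nat set" where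
  "writes (Asg x e) = {x}"
| "writes (Sto a e) = {}"
| "writes (Seq c d) = writes c \<union> writes d"
| "writes (Ite a b c d) = writes c \<union> writes d"
| "writes (For i b c) = insert i (writes c)"

primrec wfc :: "com \<Rightarrow> bool" where
  "wfc (Asg x e) \<longleftrightarrow> x < tmp \<and> wfe e"
| "wfc (Sto a e) \<longleftrightarrow> wfe a \<and> wfe e"
| "wfc (Seq c d) \<longleftrightarrow> wfc c \<and> wfc d"
| "wfc (Ite a b c d) \<longleftrightarrow> wfe a \<and> wfe b \<and> wfc c \<and> wfc d"
| "wfc (For i b c) \<longleftrightarrow> i < tmp \<and> b < tmp \<and> i \<noteq> b \<and> i \<notin> writes c \<and> b \<notin> writes c \<and> wfc c"

text \<open>The exact number of machine steps. A round of a loop pays for the test, two instructions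
  of increment and the jump back; the 2 outside the sum are the initialisation and the final
  test.\<close>

primrec cost :: "com \<Rightarrow> state \<Rightarrow> nat" where
  "cost (Asg x e) st = length (compe tmp e) + 2"
| "cost (Sto a e) st = length (compe tmp a) + length (compe (Suc tmp) e) + 5"
| "cost (Seq c d) st = cost c st + cost d (exec c st)"
| "cost (Ite a b c d) st = length (compe tmp a) + length (compe (Suc tmp) b) +
     (if ev a st \<le> ev b st then 1 + cost c st else 2 + cost d st)"
| "cost (For i b c) st = 2 + (\<Sum>k<nat \<lceil>fst st b\<rceil>.
     4 + cost c (((\<lambda>st. next_iter i (exec c st)) ^^ k) ((fst st)(i := 0), snd st)))"

lemma addr_of_nat [simp]: "addr (real n) = n"
  by (simp add: addr_def)

lemma exec_frame: "x \<notin> writes c \<Longrightarrow> fst (exec c st) x = fst st x"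
proof (induction c arbitrary: st)
  case (For i b c)
  have "fst (((\<lambda>st. next_iter i (exec c st)) ^^ k) s0) x = fst s0 x" for k s0
    using For by (induction k) (auto simp: next_iter_def)
  then show ?case using For.prems by simp
qed auto

section \<open>Correctness of the compiled code\<close>

definition code_at :: "instr list \<Rightarrow> nat \<Rightarrow> instr list \<Rightarrow> bool" where
  "code_at P pc xs \<longleftrightarrow> (\<forall>k<length xs. pc + k < length P \<and> P ! (pc + k) = xs ! k)"

lemma code_at_append [simp]:
  "code_at P pc (xs @ ys) \<longleftrightarrow> code_at P pc xs \<and> code_at P (pc + length xs) ys"
proof -
  have *: "(\<forall>k<a + b. Q k) \<longleftrightarrow> (\<forall>k<a. Q k) \<and> (\<forall>k<b. Q (a + k))" for a b :: nat and Q
    by (metis add_less_cancel_left le_add_diff_inverse linorder_not_less trans_less_add1)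
  show ?thesis by (simp add: code_at_def * nth_append add.assoc)
qed

lemma code_at_Cons [simp]:
  "code_at P pc (x # xs) \<longleftrightarrow> pc < length P \<and> P ! pc = x \<and> code_at P (Suc pc) xs"
  by (auto simp: code_at_def less_Suc_eq_0_disj nth_Cons split: nat.split)

lemma code_at_Nil [simp]: "code_at P pc []"
  by (simp add: code_at_def)

lemma run_0 [simp]: "run P 0 st = st" by (simp add: run_def)

lemma run_add: "run P (a + b) st = run P b (run P a st)"
  by (simp add: run_def funpow_add add.commute[of a])

lemma run_Suc [simp]: "run P (Suc k) st = step P (run P k st)"
  by (simp add: run_def)

lemma step_at: "pc < length P \<Longrightarrow> step P (pc, m) = exec_instr (P ! pc) (pc, m)"
  by (simp add: step_def)

lemma nat_floor_shift: "nat (\<lfloor>\<bar>v\<bar>\<rfloor> + int k) = k + addr v"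
  by (simp add: addr_def nat_add_distrib)

definition mem_rep :: "(nat \<Rightarrow> real) \<Rightarrow> state \<Rightarrow> bool" where
  "mem_rep m st \<longleftrightarrow> (\<forall>i<tmp. m i = fst st i) \<and> (\<forall>a. m (heap0 + a) = snd st a)"

text \<open>The clause about cells below \<open>t\<close> carries the induction: the left operand
  rests in cell \<open>t\<close> while the right one is computed from \<open>Suc t\<close>
  on.\<close>

lemma compe_correct:
  assumes "code_at P pc (compe t e)" "\<forall>i\<in>evars e. i < tmp" "tmp \<le> t" "t + depth e \<le> heap0"
    and "mem_rep m st"
  shows "\<exists>m'. run P (length (compe t e)) (pc, m) = (pc + length (compe t e), m') \<and>
    m' t = ev e st \<and> mem_rep m' st \<and> (\<forall>i<t. m' i = m i)"
  using assms
proof (induction e arbitrary: t pc m)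
  case (Var i)
  then show ?case by (auto simp: step_at mem_rep_def)
next
  case (Cst c)
  then show ?case by (auto simp: step_at mem_rep_def)
next
  case (Bin f a b)
  obtain m1 where m1: "run P (length (compe t a)) (pc, m) = (pc + length (compe t a), m1)"
     "m1 t = ev a st" "mem_rep m1 st" "\<forall>i<t. m1 i = m i"
    using Bin.IH(1)[of pc t m] Bin.prems by (auto simp: max_def split: if_splits)
  obtain m2 where m2: "run P (length (compe (Suc t) b)) (pc + length (compe t a), m1)
       = (pc + length (compe t a) + length (compe (Suc t) b), m2)"
     "m2 (Suc t) = ev b st" "mem_rep m2 st" "\<forall>i<Suc t. m2 i = m1 i"
    using Bin.IH(2)[of "pc + length (compe t a)" "Suc t" m1] Bin.prems m1 by (auto simp: max_def split: if_splits)
  show ?case using m1 m2 Bin.prems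
    by (cases f) (auto simp: run_add step_at add.assoc mem_rep_def)
next
  case (Uny f a)
  obtain m1 where m1: "run P (length (compe t a)) (pc, m) = (pc + length (compe t a), m1)"
     "m1 t = ev a st" "mem_rep m1 st" "\<forall>i<t. m1 i = m i"
    using Uny.IH[of pc t m] Uny.prems by auto
  have "0 < depth a" by (induction a) auto
  with m1 show ?case using Uny.prems
    by (cases f) (auto simp: run_add step_at add.assoc mem_rep_def)
next
  case (Heap a)
  obtain m1 where m1: "run P (length (compe t a)) (pc, m) = (pc + length (compe t a), m1)"
     "m1 t = ev a st" "mem_rep m1 st" "\<forall>i<t. m1 i = m i"
    using Heap.IH[of pc t m] Heap.prems by (auto simp: max_def split: if_splits)
  let ?l = "length (compe t a)"
  define v where "v = ev a st"
  have code: "pc + ?l + 4 < length P" "P ! (pc + ?l) = Mul t t t" "P ! (pc + ?l + 1) = Sqrt t t"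
    "P ! (pc + ?l + 2) = Const (Suc t) (real heap0)" "P ! (pc + ?l + 3) = Add t t (Suc t)"
    "P ! (pc + ?l + 4) = LoadI t t"
    using Heap.prems(1) by (simp_all add: eval_nat_numeral)
  define m2 where "m2 = m1(t := \<bar>v\<bar> + real heap0, Suc t := real heap0)"
  have "run P 4 (pc + ?l, m1) = (pc + ?l + 4, m2)"
    using code m1(2) by (simp add: eval_nat_numeral step_at m2_def v_def fun_upd_twist)
  then have "run P (?l + 5) (pc, m) = (pc + ?l + 5, m2(t := m2 (heap0 + addr v)))"
    using code m1(1) by (simp add: run_add[of P ?l 5] eval_nat_numeral step_at m2_def nat_floor_shift)
  moreover have t2: "t + 2 \<le> heap0" using Heap.prems(4) by simp
  then have h2: "m2 (heap0 + x) = m1 (heap0 + x)" for x by (simp add: m2_def)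
  have "m2 (heap0 + addr v) = ev (Heap a) st" using m1(3) by (simp add: h2 mem_rep_def v_def)
  moreover have "mem_rep (m2(t := w)) st" "\<forall>i<t. (m2(t := w)) i = m i" for w
    using m1 t2 Heap.prems(3) h2 by (auto simp: mem_rep_def m2_def)
  moreover have "length (compe t (Heap a)) = ?l + 5" by simp
  ultimately show ?case by (metis add.assoc fun_upd_same)
qed

lemma length_compe: "length (compe t e) = length (compe t' e)"
  by (induction e arbitrary: t t') (auto, metis)

lemma wfe_compe_correct:
  assumes "code_at P pc (compe t e)" "wfe e" "tmp \<le> t" "t \<le> tmp + 1" "mem_rep m st"
  shows "\<exists>m'. run P (length (compe t e)) (pc, m) = (pc + length (compe t e), m') \<and>
    m' t = ev e st \<and> mem_rep m' st \<and> (\<forall>i<t. m' i = m i)"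
  using compe_correct[of P pc t e m st] assms by (auto simp: wfe_def tmp_def heap0_def)

lemma mem_rep_tmp: "mem_rep m st \<Longrightarrow> tmp \<le> t \<Longrightarrow> t < heap0 \<Longrightarrow> mem_rep (m(t := v)) st"
  by (auto simp: mem_rep_def)

lemma mem_rep_var: "mem_rep m st \<Longrightarrow> x < tmp \<Longrightarrow> mem_rep (m(x := v)) ((fst st)(x := v), snd st)"
  by (auto simp: mem_rep_def tmp_def heap0_def)

lemma mem_rep_heap: "mem_rep m st \<Longrightarrow> mem_rep (m(heap0 + a := v)) (fst st, (snd st)(a := v))"
  by (auto simp: mem_rep_def tmp_def heap0_def)

lemma compc_correct:
  assumes "code_at P pc (compc pc c)" "wfc c" "mem_rep m st"
  shows "\<exists>m'. run P (cost c st) (pc, m) = (pc + length (compc pc c), m') \<and> mem_rep m' (exec c st)"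
  using assms
proof (induction c arbitrary: pc m st)
  case (Asg x e)
  obtain m1 where m1: "run P (length (compe tmp e)) (pc, m) = (pc + length (compe tmp e), m1)"
     "m1 tmp = ev e st" "mem_rep m1 st"
    using wfe_compe_correct[of P pc tmp e m st] Asg.prems by auto
  then have "run P (cost (Asg x e) st) (pc, m)
      = (pc + length (compc pc (Asg x e)), m1(Suc tmp := 0, x := ev e st))"
    using Asg.prems by (simp add: step_at)
  moreover have "mem_rep (m1(Suc tmp := 0, x := ev e st)) (exec (Asg x e) st)"
    using Asg.prems m1 by (auto intro!: mem_rep_var mem_rep_tmp simp: tmp_def heap0_def)
  ultimately show ?case by blast
next
  case (Sto a e)
  let ?l = "length (compe tmp a)" and ?k = "length (compe (Suc tmp) e)"
  obtain m1 where m1: "run P ?l (pc, m) = (pc + ?l, m1)" "m1 tmp = ev a st" "mem_rep m1 st"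
    using wfe_compe_correct[of P pc tmp a m st] Sto.prems by auto
  obtain m2 where m2: "run P ?k (pc + ?l, m1) = (pc + ?l + ?k, m2)"
     "m2 (Suc tmp) = ev e st" "mem_rep m2 st" "m2 tmp = m1 tmp"
    using wfe_compe_correct[of P "pc + ?l" "Suc tmp" e m1 st] Sto.prems m1 by auto
  define v where "v = ev a st"
  have code: "pc + ?l + ?k + 4 < length P" "P ! (pc + ?l + ?k) = Mul tmp tmp tmp"
    "P ! (pc + ?l + ?k + 1) = Sqrt tmp tmp"
    "P ! (pc + ?l + ?k + 2) = Const (Suc (Suc tmp)) (real heap0)"
    "P ! (pc + ?l + ?k + 3) = Add tmp tmp (Suc (Suc tmp))"
    "P ! (pc + ?l + ?k + 4) = StoreI tmp (Suc tmp)"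
    using Sto.prems(1) by (simp_all add: eval_nat_numeral add.assoc)
  define m3 where "m3 = m2(tmp := \<bar>v\<bar> + real heap0, Suc (Suc tmp) := real heap0)"
  have "run P 4 (pc + ?l + ?k, m2) = (pc + ?l + ?k + 4, m3)"
    using code m1(2) m2(4) by (simp add: eval_nat_numeral step_at m3_def v_def fun_upd_twist)
  then have "run P 5 (pc + ?l + ?k, m2) = (pc + ?l + ?k + 5, m3(heap0 + addr v := ev e st))"
    using code m2(2) by (simp add: eval_nat_numeral step_at m3_def nat_floor_shift)
  then have "run P (cost (Sto a e) st) (pc, m)
      = (pc + ?l + ?k + 5, m3(heap0 + addr v := ev e st))"
    using m1(1) m2(1) run_add[of P "?l + ?k" 5 "(pc, m)"] run_add[of P ?l ?k "(pc, m)"]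
    by (simp add: add.assoc del: run_Suc)
  moreover have "mem_rep m3 st" unfolding m3_def using m2(3)
    by (intro mem_rep_tmp) (auto simp: tmp_def heap0_def)
  moreover have "pc + length (compc pc (Sto a e)) = pc + ?l + ?k + 5" by simp
  moreover have "exec (Sto a e) st = (fst st, (snd st)(addr v := ev e st))" by (simp add: v_def)
  ultimately show ?case using mem_rep_heap[of m3 st "addr v" "ev e st"] by metis
next
  case (Seq c d)
  obtain m1 where m1: "run P (cost c st) (pc, m) = (pc + length (compc pc c), m1)"
    "mem_rep m1 (exec c st)"
    using Seq.IH(1)[of pc m st] Seq.prems by (auto simp: Let_def)
  then show ?case
    using Seq.IH(2)[of "pc + length (compc pc c)" m1 "exec c st"] Seq.prems
    by (auto simp: Let_def run_add add.assoc)
next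
  case (Ite a b c d)
  let ?l = "length (compe tmp a)" and ?k = "length (compe (Suc tmp) b)"
  define pd where "pd = pc + (?l + ?k) + 1"
  define ld where "ld = length (compc pd d)"
  define pc' where "pc' = pc + (?l + ?k) + ld + 2"
  define lc where "lc = length (compc pc' c)"
  have code: "code_at P pc (compe tmp a)" "code_at P (pc + ?l) (compe (Suc tmp) b)"
    "pc + ?l + ?k < length P" "P ! (pc + ?l + ?k) = JLe tmp (Suc tmp) pc'"
    "code_at P pd (compc pd d)" "pd + ld < length P"
    "P ! (pd + ld) = JLe 0 0 (pc' + lc)" "code_at P pc' (compc pc' c)"
    using Ite.prems(1) by (auto simp: Let_def pd_def ld_def pc'_def lc_def algebra_simps)
  have len: "pc + length (compc pc (Ite a b c d)) = pc' + lc"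
    by (simp add: Let_def pd_def ld_def pc'_def lc_def algebra_simps)
  obtain m1 where m1: "run P ?l (pc, m) = (pc + ?l, m1)" "m1 tmp = ev a st" "mem_rep m1 st"
    using wfe_compe_correct[of P pc tmp a m st] Ite.prems code by auto
  obtain m2 where m2: "run P ?k (pc + ?l, m1) = (pc + ?l + ?k, m2)"
     "m2 (Suc tmp) = ev b st" "mem_rep m2 st" "m2 tmp = m1 tmp"
    using wfe_compe_correct[of P "pc + ?l" "Suc tmp" b m1 st] Ite.prems m1 code by auto
  have r1: "run P (?l + ?k) (pc, m) = (pc + ?l + ?k, m2)" using m1 m2 by (simp add: run_add)
  show ?case
  proof (cases "ev a st \<le> ev b st")
    case True
    have "run P (?l + ?k + 1) (pc, m) = (pc', m2)"
      using r1 code m1 m2 True by (simp add: step_at)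
    moreover obtain m3 where "run P (cost c st) (pc', m2) = (pc' + lc, m3)" "mem_rep m3 (exec c st)"
      using Ite.IH(1)[of pc' m2 st] code m2 Ite.prems by (auto simp: lc_def)
    ultimately have "run P (?l + ?k + 1 + cost c st) (pc, m) = (pc' + lc, m3)"
      by (simp only: run_add)
    then show ?thesis using True \<open>mem_rep m3 (exec c st)\<close> unfolding len
      by (auto simp: add.assoc)
  next
    case False
    have "run P (?l + ?k + 1) (pc, m) = (pd, m2)"
      using r1 code m1 m2 False by (simp add: step_at pd_def)
    moreover obtain m3 where "run P (cost d st) (pd, m2) = (pd + ld, m3)" "mem_rep m3 (exec d st)"
      using Ite.IH(2)[of pd m2 st] code m2 Ite.prems by (auto simp: ld_def)
    ultimately have "run P (?l + ?k + 1 + cost d st) (pc, m) = (pd + ld, m3)"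
      by (simp only: run_add)
    then have "run P (?l + ?k + 2 + cost d st) (pc, m) = (pc' + lc, m3)"
      using code by (simp add: step_at)
    then show ?thesis using False \<open>mem_rep m3 (exec d st)\<close> unfolding len
      by (auto simp: add.assoc)
  qed
next
  case (For i b c)
  define lc where "lc = length (compc (pc + 2) c)"
  have code: "pc + 1 < length P" "P ! pc = Const i 0" "P ! (pc + 1) = JLe b i (pc + lc + 5)"
    "code_at P (pc + 2) (compc (pc + 2) c)" "pc + lc + 4 < length P"
    "P ! (pc + lc + 2) = Const tmp 1" "P ! (pc + lc + 3) = Add i i tmp"
    "P ! (pc + lc + 4) = JLe 0 0 (pc + 1)"
    using For.prems(1) by (auto simp: Let_def lc_def eval_nat_numeral)
  have len: "pc + length (compc pc (For i b c)) = pc + lc + 5"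
    by (simp add: Let_def lc_def)
  have wf: "i < tmp" "b < tmp" "i \<noteq> b" "i \<notin> writes c" "b \<notin> writes c" "wfc c"
    using For.prems(2) by auto
  define g where "g = (\<lambda>st. next_iter i (exec c st))"
  define s0 where "s0 = ((fst st)(i := 0), snd st)"
  define n where "n = nat \<lceil>fst st b\<rceil>"
  have si: "fst ((g ^^ k) s0) i = real k" and sb: "fst ((g ^^ k) s0) b = fst st b" for k
    using wf by (induction k) (auto simp: g_def next_iter_def s0_def exec_frame)
  \<comment> \<open>The machine is observed at the loop head, before the test; the 1 accounts for
    \<open>Const i 0\<close>.\<close>
  have iter: "\<exists>m'. run P (1 + (\<Sum>k<j. 4 + cost c ((g ^^ k) s0))) (pc, m) = (pc + 1, m')
      \<and> mem_rep m' ((g ^^ j) s0)" if "j \<le> n" for j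
    using that
  proof (induction j)
    case 0
    then show ?case using code For.prems(3) wf by (auto simp: step_at s0_def intro!: mem_rep_var)
  next
    case (Suc j)
    then obtain m1 where m1: "run P (1 + (\<Sum>k<j. 4 + cost c ((g ^^ k) s0))) (pc, m) = (pc + 1, m1)"
      "mem_rep m1 ((g ^^ j) s0)" by auto
    have "real j < fst st b" using Suc.prems by (simp add: n_def) linarith
    then have "m1 i < m1 b" using m1(2) wf si[of j] sb[of j] by (auto simp: mem_rep_def)
    then have "run P 1 (pc + 1, m1) = (pc + 2, m1)" using code by (simp add: step_at)
    moreover obtain m2 where m2: "run P (cost c ((g ^^ j) s0)) (pc + 2, m1) = (pc + 2 + lc, m2)"
      "mem_rep m2 (exec c ((g ^^ j) s0))"
      using For.IH[of "pc + 2" m1 "(g ^^ j) s0"] code wf m1 by (auto simp: lc_def)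
    moreover have "run P 3 (pc + 2 + lc, m2) = (pc + 1, m2(tmp := 1, i := m2 i + 1))"
      using code wf by (simp add: eval_nat_numeral step_at add.commute[of 2])
    ultimately have "run P (1 + (\<Sum>k<j. 4 + cost c ((g ^^ k) s0)) + (1 + (cost c ((g ^^ j) s0) + 3))) (pc, m)
        = (pc + 1, m2(tmp := 1, i := m2 i + 1))"
      using m1(1) by (simp only: run_add)
    moreover have "mem_rep (m2(tmp := 1, i := m2 i + 1)) ((g ^^ Suc j) s0)"
    proof -
      have "m2 i = fst (exec c ((g ^^ j) s0)) i" using m2(2) wf by (simp add: mem_rep_def)
      then show ?thesis using m2(2) wf
        by (auto simp: g_def next_iter_def tmp_def heap0_def intro!: mem_rep_var mem_rep_tmp)
    qed
    ultimately show ?case by (auto simp: algebra_simps)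
  qed
  then obtain m1 where m1: "run P (1 + (\<Sum>k<n. 4 + cost c ((g ^^ k) s0))) (pc, m) = (pc + 1, m1)"
    "mem_rep m1 ((g ^^ n) s0)" by blast
  have "fst st b \<le> real n" by (simp add: n_def) linarith
  then have "m1 b \<le> m1 i" using m1(2) wf si[of n] sb[of n] by (auto simp: mem_rep_def)
  then have "run P 1 (pc + 1, m1) = (pc + lc + 5, m1)" using code by (simp add: step_at)
  then have "run P (1 + (\<Sum>k<n. 4 + cost c ((g ^^ k) s0)) + 1) (pc, m) = (pc + lc + 5, m1)"
    using m1(1) by (simp only: run_add)
  moreover have "cost (For i b c) st = 1 + (\<Sum>k<n. 4 + cost c ((g ^^ k) s0)) + 1"
    by (simp add: n_def g_def s0_def)
  moreover have "exec (For i b c) st = (g ^^ n) s0" by (simp add: n_def g_def s0_def)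
  ultimately show ?case using m1(2) unfolding len by metis
qed

section \<open>Static bounds on the running time\<close>

primrec loop_bounds :: "com \<Rightarrow> nat set" where
  "loop_bounds (Asg x e) = {}"
| "loop_bounds (Sto a e) = {}"
| "loop_bounds (Seq c d) = loop_bounds c \<union> loop_bounds d"
| "loop_bounds (Ite a b c d) = loop_bounds c \<union> loop_bounds d"
| "loop_bounds (For i b c) = insert b (loop_bounds c)"

text \<open>Here \<open>\<beta> b\<close> is an a priori bound for the loop limit \<open>b\<close>,
  and both branches of a conditional are charged. Compiling at stack position 0 is harmless, as the
  length of the code does not depend on the position.\<close>

primrec cost_bound :: "(nat \<Rightarrow> nat) \<Rightarrow> com \<Rightarrow> nat" where
  "cost_bound \<beta> (Asg x e) = length (compe 0 e) + 2"
| "cost_bound \<beta> (Sto a e) = length (compe 0 a) + length (compe 0 e) + 5"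
| "cost_bound \<beta> (Seq c d) = cost_bound \<beta> c + cost_bound \<beta> d"
| "cost_bound \<beta> (Ite a b c d) = length (compe 0 a) + length (compe 0 b) + 2 + cost_bound \<beta> c + cost_bound \<beta> d"
| "cost_bound \<beta> (For i b c) = 2 + \<beta> b * (4 + cost_bound \<beta> c)"

text \<open>No loop limit is assigned inside the command, so its initial value is still its value
  whenever the loop is entered. A program that computes its own limits has to be cut behind those
  assignments.\<close>

lemma cost_le_cost_bound:
  assumes "writes c \<inter> loop_bounds c = {}" "\<And>b. b \<in> loop_bounds c \<Longrightarrow> fst st b \<le> real (\<beta> b)"
  shows "cost c st \<le> cost_bound \<beta> c"
  using assms
proof (induction c arbitrary: st)
  case (Seq c d)
  have "cost c st \<le> cost_bound \<beta> c" using Seq.prems by (intro Seq.IH(1)) auto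
  moreover have "cost d (exec c st) \<le> cost_bound \<beta> d"
  proof (rule Seq.IH(2))
    fix b assume b: "b \<in> loop_bounds d"
    then have "b \<notin> writes c" using Seq.prems(1) by auto
    then show "fst (exec c st) b \<le> real (\<beta> b)" using Seq.prems(2) b by (simp add: exec_frame)
  qed (use Seq.prems in auto)
  ultimately show ?case by simp
next
  case (Ite a b c d)
  have "cost c st \<le> cost_bound \<beta> c" "cost d st \<le> cost_bound \<beta> d"
    using Ite.prems by (auto intro!: Ite.IH)
  then show ?case using length_compe[of tmp a 0] length_compe[of "Suc tmp" b 0] by auto
next
  case (For i b c)
  define g where "g = (\<lambda>st. next_iter i (exec c st))"
  define s0 where "s0 = ((fst st)(i := 0), snd st)"
  have fr: "fst ((g ^^ k) s0) x = fst st x" if "x \<notin> insert i (writes c)" for k x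
    using that by (induction k) (auto simp: g_def next_iter_def s0_def exec_frame)
  have "cost c ((g ^^ k) s0) \<le> cost_bound \<beta> c" for k
  proof (rule For.IH)
    fix x assume x: "x \<in> loop_bounds c"
    then have "x \<notin> insert i (writes c)" using For.prems(1) by auto
    then show "fst ((g ^^ k) s0) x \<le> real (\<beta> x)" using For.prems(2) x fr by simp
  qed (use For.prems in auto)
  then have "(\<Sum>k<nat \<lceil>fst st b\<rceil>. 4 + cost c ((g ^^ k) s0)) \<le> (\<Sum>k<nat \<lceil>fst st b\<rceil>. 4 + cost_bound \<beta> c)"
    by (intro sum_mono) auto
  also have "\<dots> = nat \<lceil>fst st b\<rceil> * (4 + cost_bound \<beta> c)" by simp
  also have "\<dots> \<le> \<beta> b * (4 + cost_bound \<beta> c)"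
    using For.prems(2)[of b] by (intro mult_right_mono) (auto simp: ceiling_le_iff nat_le_iff)
  finally show ?case by (simp add: g_def s0_def)
qed (auto intro!: eq_imp_le length_compe simp: length_compe[of tmp _ 0] length_compe[of "Suc tmp" _ 0])

text \<open>The rule itself supplies the counter and the frame of all variables outside the body's
  writes, so \<open>I\<close> need only speak of what the body changes.\<close>

lemma exec_For_invariant:
  assumes b: "fst st b = real n" and wf: "i \<noteq> b" "i \<notin> writes c" "b \<notin> writes c"
    and init: "I 0 ((fst st)(i := 0), snd st)"
    and step: "\<And>k s h. k < n \<Longrightarrow> s i = real k \<Longrightarrow> s b = real n \<Longrightarrow>
      (\<And>x. x \<notin> insert i (writes c) \<Longrightarrow> s x = fst st x) \<Longrightarrow> I k (s, h) \<Longrightarrow>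
      I (Suc k) (next_iter i (exec c (s, h)))"
  shows "I n (exec (For i b c) st)"
proof -
  define g where "g = (\<lambda>st. next_iter i (exec c st))"
  define s0 where "s0 = ((fst st)(i := 0), snd st)"
  have "I k ((g ^^ k) s0) \<and> fst ((g ^^ k) s0) i = real k \<and>
    (\<forall>x. x \<notin> insert i (writes c) \<longrightarrow> fst ((g ^^ k) s0) x = fst st x)" if "k \<le> n" for k
    using that
  proof (induction k)
    case 0
    then show ?case using init by (simp add: s0_def)
  next
    case (Suc k)
    let ?t = "(g ^^ k) s0"
    have "I (Suc k) (next_iter i (exec c (fst ?t, snd ?t)))"
      using Suc wf b by (intro step) auto
    then show ?case using Suc wf by (auto simp: g_def next_iter_def exec_frame)
  qed
  from this[of n] show ?thesis by (simp add: b g_def s0_def)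
qed

section \<open>Geometry of covering by two disks\<close>

text \<open>This is what makes boundary sampling legitimate, and it rests on there being two
  covering disks: two vectors always admit a common direction that is obtuse to neither, so an
  uncovered point can escape to the boundary. Three disks can cover a circle and leave a hole in the
  middle.\<close>

lemma disk_covered_if_sphere_covered:
  fixes c c1 c2 :: point
  assumes "0 \<le> r" and sph: "sphere c R \<subseteq> cball c1 r \<union> cball c2 r"
  shows "cball c R \<subseteq> cball c1 r \<union> cball c2 r"
proof (rule subsetI, rule ccontr)
  fix q assume q: "q \<in> cball c R" and nq: "q \<notin> cball c1 r \<union> cball c2 r"
  define w1 where "w1 = q - c1"
  define w2 where "w2 = q - c2"
  have n1: "norm w1 > r" and n2: "norm w2 > r"
    using nq by (auto simp: w1_def w2_def dist_norm norm_minus_commute)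
  \<comment> \<open>moving perpendicularly to \<open>w1\<close>, to the side of \<open>w2\<close>, increases both distances\<close>
  obtain u where u: "u \<noteq> 0" "u \<bullet> w1 \<ge> 0" "u \<bullet> w2 \<ge> 0"
  proof -
    define p where "p = (- snd w1, fst w1)"
    have "w1 \<noteq> 0" using n1 assms(1) by auto
    then have p: "p \<noteq> 0" "p \<bullet> w1 = 0"
      by (auto simp: p_def inner_prod_def prod_eq_iff)
    show thesis
      by (cases "p \<bullet> w2 \<ge> 0") (use p that[of p] that[of "-p"] in auto)
  qed
  have far: "norm (w + t *\<^sub>R u) \<ge> norm w" if "u \<bullet> w \<ge> 0" "t \<ge> 0" for w t
  proof -
    have "(norm (w + t *\<^sub>R u))\<^sup>2 = (norm w)\<^sup>2 + 2 * t * (u \<bullet> w) + t\<^sup>2 * (u \<bullet> u)"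
      unfolding power2_norm_eq_inner
      by (simp add: inner_add_left inner_add_right inner_commute power2_eq_square algebra_simps)
    then have "(norm w)\<^sup>2 \<le> (norm (w + t *\<^sub>R u))\<^sup>2" using that by simp
    then show ?thesis by (rule power2_le_imp_le) simp
  qed
  define f where "f t = norm (q - c + t *\<^sub>R u)" for t :: real
  \<comment> \<open>At time \<open>T\<close> the displacement has length
    \<open>R + norm (q - c)\<close>, so the moving point is at distance at least \<open>R\<close>
    from \<open>c\<close>; in between it crosses the circle.\<close>
  define T where "T = (R + norm (q - c)) / norm u"
  have qc: "norm (q - c) \<le> R" using q by (simp add: dist_norm norm_minus_commute)
  have T0: "T \<ge> 0" using qc norm_ge_zero[of "q - c"] unfolding T_def
    by (intro divide_nonneg_nonneg norm_ge_zero) linarith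
  have "f 0 \<le> R" using qc by (simp add: f_def)
  moreover have "R \<le> f T"
  proof -
    have "0 \<le> R + norm (q - c)" using qc norm_ge_zero[of "q - c"] by linarith
    then have "norm (T *\<^sub>R u) = R + norm (q - c)" using u(1) by (simp add: T_def)
    moreover have "norm (T *\<^sub>R u) \<le> f T + norm (q - c)"
      unfolding f_def by (metis add_diff_cancel_left' norm_triangle_ineq4)
    ultimately show ?thesis by linarith
  qed
  moreover have "continuous_on {0..T} f" unfolding f_def by (intro continuous_intros)
  ultimately obtain t where t: "0 \<le> t" "f t = R" using IVT'[of f 0 R T] T0 by auto
  then have "q + t *\<^sub>R u \<in> sphere c R"
    by (simp add: f_def dist_norm norm_minus_commute algebra_simps)
  moreover have "norm (q + t *\<^sub>R u - c1) > r" "norm (q + t *\<^sub>R u - c2) > r"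
    using far[OF u(2) t(1)] far[OF u(3) t(1)] n1 n2 by (auto simp: w1_def w2_def algebra_simps)
  ultimately show False using sph by (force simp: dist_norm norm_minus_commute)
qed

section \<open>A finite net of directions\<close>

lemma norm_normalize_diff:
  fixes a b :: "'a::real_inner"
  assumes "a \<noteq> 0" "b \<noteq> 0"
  shows "norm (a /\<^sub>R norm a - b /\<^sub>R norm b) \<le> 2 * norm (a - b) / norm b"
proof -
  \<comment> \<open>The difference splits into \<open>(a - b) /\<^sub>R norm b\<close> and
    \<open>X\<close>, the effect of dividing \<open>a\<close> by the wrong norm. Each part has norm
    at most \<open>norm (a - b) / norm b\<close>.\<close>
  define X where "X = ((norm b - norm a) / norm b) *\<^sub>R (a /\<^sub>R norm a)"
  have nX: "norm X = \<bar>norm b - norm a\<bar> / norm b"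
    using assms by (simp add: X_def abs_mult)
  have e: "inverse (norm a) = inverse (norm b) + (norm b - norm a) / norm b * inverse (norm a)"
    using assms by (simp add: field_simps)
  have "a /\<^sub>R norm a = (inverse (norm b) + (norm b - norm a) / norm b * inverse (norm a)) *\<^sub>R a"
    by (subst e) simp
  also have "\<dots> = a /\<^sub>R norm b + X" by (simp add: X_def scaleR_add_left)
  finally have "a /\<^sub>R norm a - b /\<^sub>R norm b = (a - b) /\<^sub>R norm b + X"
    by (simp only: scaleR_diff_right add_diff_eq diff_add_eq)
  then have "norm (a /\<^sub>R norm a - b /\<^sub>R norm b) \<le> norm (a - b) / norm b + \<bar>norm b - norm a\<bar> / norm b"
    using norm_triangle_ineq[of "(a - b) /\<^sub>R norm b" X] nX by (simp add: divide_inverse_commute)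
  also have "\<bar>norm b - norm a\<bar> \<le> norm (a - b)" by (metis abs_minus_commute norm_triangle_ineq3)
  finally show ?thesis using assms by (simp add: divide_right_mono add_divide_distrib[symmetric])
qed

text \<open>For \<open>k\<close> up to \<open>2 * N\<close> these are the integer points on the
  upper half of the diamond of l1-radius \<open>N\<close>: a net of directions without trigonometric
  functions, which the machine does not offer. The vector is nonzero for larger \<open>k\<close> as
  well, so directions beyond the net, which the search may reach, still give unit vectors.\<close>

definition dir_vec :: "real \<Rightarrow> real \<Rightarrow> point" where
  "dir_vec N k = (k - N, N - \<bar>k - N\<bar>)"

definition dir :: "real \<Rightarrow> real \<Rightarrow> point" where
  "dir N k = dir_vec N k /\<^sub>R norm (dir_vec N k)"

lemma dir_vec_nonzero: "N > 0 \<Longrightarrow> dir_vec N k \<noteq> 0"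
  by (auto simp: dir_vec_def prod_eq_iff)

lemma norm_dir: "N > 0 \<Longrightarrow> norm (dir N k) = 1"
  using dir_vec_nonzero[of N k] by (simp add: dir_def)

lemma dir_net:
  fixes v :: point
  assumes N: "N > 0" and v: "norm v = 1" "snd v \<ge> 0"
  shows "\<exists>k\<le>2 * N. norm (dir (real N) (real k) - v) \<le> 8 / real N"
proof -
  obtain x y where xy: "v = (x, y)" by (cases v)
  define s where "s = \<bar>x\<bar> + y"
  have y0: "y \<ge> 0" using v xy by simp
  have sq: "x\<^sup>2 + y\<^sup>2 = 1" using v xy by (simp add: norm_Pair)
  have "s\<^sup>2 = x\<^sup>2 + y\<^sup>2 + 2 * \<bar>x\<bar> * y" by (simp add: s_def power2_sum)
  then have "s\<^sup>2 \<ge> 1\<^sup>2" using sq y0 by simp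
  then have s1: "s \<ge> 1" using y0 by (intro power2_le_imp_le[of 1 s]) (auto simp: s_def)
  have "\<bar>x\<bar> \<le> 1" "\<bar>y\<bar> \<le> 1" using sq zero_le_power2[of x] zero_le_power2[of y] by (simp_all flip: abs_square_le_1, linarith+)
  then have s2: "s \<le> 2" by (simp add: s_def)
  \<comment> \<open>The point where the ray of \<open>v\<close> meets the diamond. As
    \<open>s\<close> is the l1-norm of \<open>v\<close>, the norm of \<open>w\<close> is
    \<open>N / s\<close>, at least \<open>N / 2\<close>.\<close>
  define w where "w = (real N / s) *\<^sub>R v"
  define x' where "x' = real N * x / s"
  have w: "w = (x', real N - \<bar>x'\<bar>)"
    using s1 by (simp add: w_def xy x'_def s_def abs_mult field_simps)
  have x'N: "\<bar>x'\<bar> \<le> real N"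
  proof -
    have "\<bar>x\<bar> / s \<le> 1" using s1 y0 by (simp add: s_def)
    then show ?thesis using mult_left_le[of "\<bar>x\<bar> / s" "real N"] s1 by (simp add: x'_def abs_mult)
  qed
  \<comment> \<open>Rounding the abscissa down changes each coordinate on the diamond by at most 1,
    hence the 2 in \<open>dw\<close>.\<close>
  define k where "k = nat (\<lfloor>x'\<rfloor> + int N)"
  have "\<lfloor>x'\<rfloor> \<ge> - int N" using x'N by (simp add: le_floor_iff)
  then have kx: "real k - real N = of_int \<lfloor>x'\<rfloor>" by (simp add: k_def)
  have "\<lfloor>x'\<rfloor> \<le> int N" using x'N by linarith
  then have k2: "k \<le> 2 * N" by (simp add: k_def)
  define d where "d = dir_vec (real N) (real k)"
  have "norm (d - w) \<le> norm (fst (d - w)) + norm (snd (d - w))"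
    by (metis norm_Pair sqrt_sum_squares_le_sum norm_ge_zero prod.collapse)
  also have "\<dots> \<le> 1 + 1"
    using kx unfolding d_def w dir_vec_def by simp linarith
  finally have dw: "norm (d - w) \<le> 2" by simp
  have nw: "norm w = real N / s" using s1 v by (simp add: w_def)
  have w0: "w \<noteq> 0" using nw N s1 by auto
  have "w /\<^sub>R norm w = v" using nw N s1 by (simp add: w_def)
  then have "norm (dir (real N) (real k) - v) \<le> 2 * norm (d - w) / norm w"
    using norm_normalize_diff[of d w] w0 dir_vec_nonzero[of N k] N by (simp add: dir_def d_def)
  also have "\<dots> \<le> 4 / norm w" using dw by (intro divide_right_mono) auto
  also have "\<dots> = 4 * s / N" using s1 by (simp add: nw)
  also have "\<dots> \<le> 8 / N" using s2 by (intro divide_right_mono) auto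
  finally show ?thesis using k2 by blast
qed

section \<open>Separation of distant clusters\<close>

lemma far_clusters_separated:
  fixes p1 p2 c1 c2 :: point
  assumes U: "U1 \<subseteq> cball p1 q" "U2 \<subseteq> cball p2 q" "U1 \<noteq> {}" "U2 \<noteq> {}"
    and far: "dist p1 p2 \<ge> 8 * q" "q > 0" and r: "r \<le> 2 * q"
    and cov: "U1 \<union> U2 \<subseteq> cball c1 r \<union> cball c2 r"
  shows "dist c1 p1 < dist c1 p2 \<and> dist c2 p2 < dist c2 p1 \<and> U1 \<subseteq> cball c1 r \<and> U2 \<subseteq> cball c2 r \<or>
         dist c2 p1 < dist c2 p2 \<and> dist c1 p2 < dist c1 p1 \<and> U1 \<subseteq> cball c2 r \<and> U2 \<subseteq> cball c1 r"
proof -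
  \<comment> \<open>A centre no farther from \<open>a\<close> than from \<open>b\<close> is at least
    \<open>4 * q\<close> away from \<open>b\<close>, hence at least \<open>3 * q\<close> away from
    every point of \<open>cball b q\<close>, which exceeds the radius bound
    \<open>2 * q\<close>.\<close>
  have miss: "x \<notin> cball c r" if "dist c a \<le> dist c b" "x \<in> cball b q" "{a, b} = {p1, p2}" for c x a b
  proof
    assume "x \<in> cball c r"
    moreover have "dist a b \<ge> 8 * q" using that(3) far(1) by (auto simp: doubleton_eq_iff dist_commute)
    moreover have "dist c b \<le> dist c x + dist b x" "dist a b \<le> dist c a + dist c b"
      by (rule dist_triangle2, rule dist_triangle3)
    ultimately show False using that(1,2) far(2) r by simp
  qed
  have miss2: "U2 \<inter> cball c r = {}" if "dist c p1 \<le> dist c p2" for c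
    using miss[OF that] U(2) by blast
  have miss1: "U1 \<inter> cball c r = {}" if "dist c p2 \<le> dist c p1" for c
    using miss[OF that] U(1) by blast
  consider "dist c1 p1 < dist c1 p2" "dist c2 p2 < dist c2 p1"
    | "dist c2 p1 < dist c2 p2" "dist c1 p2 < dist c1 p1"
    | "dist c1 p1 \<le> dist c1 p2" "dist c2 p1 \<le> dist c2 p2"
    | "dist c1 p2 \<le> dist c1 p1" "dist c2 p2 \<le> dist c2 p1" by linarith
  then show ?thesis
  proof cases
    case 1
    then show ?thesis using miss2[OF less_imp_le[OF 1(1)]] miss1[OF less_imp_le[OF 1(2)]] cov by blast
  next
    case 2
    then show ?thesis using miss2[OF less_imp_le[OF 2(1)]] miss1[OF less_imp_le[OF 2(2)]] cov by blast
  next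
    case 3
    then show ?thesis using miss2[OF 3(1)] miss2[OF 3(2)] cov U(4) by blast
  next
    case 4
    then show ?thesis using miss1[OF 4(1)] miss1[OF 4(2)] cov U(3) by blast
  qed
qed

text \<open>Two of the three centres \<open>p1\<close>, \<open>p2\<close>, \<open>x\<close> lie in the same covering disk.\<close>
lemma farthest_point_two_approx:
  fixes p1 p2 x :: point
  assumes "{p1, p2, x} \<subseteq> cball c1 r \<union> cball c2 r" "dist x p1 \<le> dist p2 p1"
  shows "min (dist x p1) (dist x p2) \<le> 2 * r"
proof -
  have *: "dist a b \<le> 2 * r" if "a \<in> cball c r" "b \<in> cball c r" for a b c
    using that dist_triangle3[of a b c] by simp
  consider c where "p1 \<in> cball c r" "p2 \<in> cball c r"
    | c where "x \<in> cball c r" "p1 \<in> cball c r"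
    | c where "x \<in> cball c r" "p2 \<in> cball c r"
    using assms(1) by blast
  then show ?thesis
  proof cases
    case 1
    then show ?thesis using *[of p2 _ p1] assms(2) by fastforce
  next
    case 2
    then show ?thesis using *[of x _ p1] by fastforce
  next
    case 3
    then show ?thesis using *[of x _ p2] by fastforce
  qed
qed

section \<open>Rounding and rotated coordinates\<close>

definition snap :: "point \<Rightarrow> point" where
  "snap p = (of_int \<lfloor>fst p\<rfloor>, of_int \<lfloor>snd p\<rfloor>)"

lemma norm_le_abs_sum: "norm (p :: point) \<le> \<bar>fst p\<bar> + \<bar>snd p\<bar>"
  using sqrt_sum_squares_le_sum_abs[of "fst p" "snd p"] by (simp add: norm_prod_def)

lemma dist_snap: "dist p (snap p) \<le> 2"
proof -
  have "\<bar>fst p - of_int \<lfloor>fst p\<rfloor>\<bar> \<le> 1" "\<bar>snd p - of_int \<lfloor>snd p\<rfloor>\<bar> \<le> 1" by linarith+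
  then show ?thesis using norm_le_abs_sum[of "p - snap p"] by (simp add: dist_norm snap_def)
qed

text \<open>For a unit vector \<open>u\<close>, the pair \<open>rot_a\<close>, \<open>rot_b\<close>
  gives coordinates in the orthonormal frame of \<open>u\<close> and its quarter turn;
  \<open>unrot\<close> goes back.\<close>

definition rot_a :: "point \<Rightarrow> point \<Rightarrow> real" where "rot_a u p = fst p * fst u + snd p * snd u"
definition rot_b :: "point \<Rightarrow> point \<Rightarrow> real" where "rot_b u p = snd p * fst u - fst p * snd u"

definition unrot :: "point \<Rightarrow> real \<Rightarrow> real \<Rightarrow> point" where
  "unrot u a b = (a * fst u - b * snd u, a * snd u + b * fst u)"

lemma unit_sq: "norm (u::point) = 1 \<Longrightarrow> (fst u)\<^sup>2 + (snd u)\<^sup>2 = 1"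
  by (simp add: norm_prod_def)

lemma dist_rot:
  assumes "norm u = 1"
  shows "(dist p q)\<^sup>2 = (rot_a u p - rot_a u q)\<^sup>2 + (rot_b u p - rot_b u q)\<^sup>2"
proof -
  obtain x y where u: "u = (x, y)" by (cases u)
  obtain a b where p: "p - q = (a, b)" by (cases "p - q")
  have ab: "fst p - fst q = a" "snd p - snd q = b"
    using p by (simp_all add: prod_eq_iff)
  have "(dist p q)\<^sup>2 = a\<^sup>2 + b\<^sup>2" by (simp add: dist_norm p norm_Pair)
  also have "\<dots> = (a\<^sup>2 + b\<^sup>2) * (x\<^sup>2 + y\<^sup>2)" using unit_sq[OF assms] u by simp
  also have "\<dots> = (a * x + b * y)\<^sup>2 + (b * x - a * y)\<^sup>2" by algebra
  also have "a * x + b * y = rot_a u p - rot_a u q" by (simp add: rot_a_def u flip: ab) (simp add: algebra_simps)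
  also have "b * x - a * y = rot_b u p - rot_b u q" by (simp add: rot_b_def u flip: ab) (simp add: algebra_simps)
  finally show ?thesis .
qed

lemma rot_unrot:
  assumes "norm u = 1"
  shows "rot_a u (unrot u a b) = a" "rot_b u (unrot u a b) = b"
proof -
  have "rot_a u (unrot u a b) = a * ((fst u)\<^sup>2 + (snd u)\<^sup>2)"
    "rot_b u (unrot u a b) = b * ((fst u)\<^sup>2 + (snd u)\<^sup>2)"
    by (simp_all add: rot_a_def rot_b_def unrot_def power2_eq_square algebra_simps)
  then show "rot_a u (unrot u a b) = a" "rot_b u (unrot u a b) = b" using unit_sq[OF assms] by simp_all
qed

lemma rot_abs_le:
  assumes "norm u = 1"
  shows "\<bar>rot_a u p\<bar> \<le> norm p" "\<bar>rot_b u p\<bar> \<le> norm p"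
proof -
  have "(norm p)\<^sup>2 = (rot_a u p)\<^sup>2 + (rot_b u p)\<^sup>2"
    using dist_rot[OF assms, of p 0] by (simp add: rot_a_def rot_b_def)
  then have "\<bar>rot_a u p\<bar>\<^sup>2 \<le> (norm p)\<^sup>2" "\<bar>rot_b u p\<bar>\<^sup>2 \<le> (norm p)\<^sup>2" by simp_all
  then show "\<bar>rot_a u p\<bar> \<le> norm p" "\<bar>rot_b u p\<bar> \<le> norm p"
    by (simp_all only: power2_le_imp_le norm_ge_zero)
qed

lemma rot_line: 
  assumes "norm u = 1"
  shows "rot_a u (p + d *\<^sub>R u) = rot_a u p + d" "rot_b u (p + d *\<^sub>R u) = rot_b u p"
proof -
  have "rot_a u (p + d *\<^sub>R u) = rot_a u p + d * ((fst u)\<^sup>2 + (snd u)\<^sup>2)"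
    by (simp add: rot_a_def power2_eq_square algebra_simps)
  then show "rot_a u (p + d *\<^sub>R u) = rot_a u p + d" using unit_sq[OF assms] by simp
  show "rot_b u (p + d *\<^sub>R u) = rot_b u p" by (simp add: rot_b_def algebra_simps)
qed

text \<open>Shifting one coordinate by \<open>e\<close> costs no more than \<open>e\<close> in the
  radius, even if only its absolute value is controlled. Every rounding of an abscissa is paid for
  in this way.\<close>

lemma sum_squares_perturb:
  fixes x x' y r e :: real
  assumes "x\<^sup>2 + y\<^sup>2 \<le> r\<^sup>2" "0 \<le> r" "\<bar>x'\<bar> \<le> \<bar>x\<bar> + e" "0 \<le> e"
  shows "x'\<^sup>2 + y\<^sup>2 \<le> (r + e)\<^sup>2"
proof -
  have "x\<^sup>2 \<le> r\<^sup>2" using assms(1) zero_le_power2[of y] by linarith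
  then have "\<bar>x\<bar> \<le> r" using assms(2) by (simp add: abs_le_square_iff[symmetric])
  have "x'\<^sup>2 \<le> (\<bar>x\<bar> + e)\<^sup>2" using assms(3) power_mono[of "\<bar>x'\<bar>" "\<bar>x\<bar> + e" 2] by simp
  also have "\<dots> = x\<^sup>2 + 2 * e * \<bar>x\<bar> + e\<^sup>2" by (simp add: power2_sum)
  also have "\<dots> \<le> x\<^sup>2 + 2 * e * r + e\<^sup>2" using \<open>\<bar>x\<bar> \<le> r\<close> assms(4) by (simp add: mult_left_mono)
  finally show ?thesis using assms(1) by (simp add: power2_sum algebra_simps)
qed

section \<open>Strips perpendicular to a direction\<close>

definition bin :: "nat \<Rightarrow> point \<Rightarrow> point \<Rightarrow> nat" where
  "bin N u p = nat (\<lfloor>rot_a u p\<rfloor> + 20 * int N)"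

lemma bin_range:
  assumes "norm u = 1" "norm p \<le> 19 * real N" "N > 0"
  shows "real (bin N u p) = of_int \<lfloor>rot_a u p\<rfloor> + 20 * real N" "bin N u p < 40 * N"
proof -
  have "\<bar>rot_a u p\<bar> \<le> 19 * real N" using rot_abs_le(1)[OF assms(1), of p] assms(2) by linarith
  then have "\<lfloor>rot_a u p\<rfloor> + 20 * int N \<ge> 0" "\<lfloor>rot_a u p\<rfloor> + 20 * int N < 40 * int N" 
    using assms(3) by linarith+
  then show "real (bin N u p) = of_int \<lfloor>rot_a u p\<rfloor> + 20 * real N" "bin N u p < 40 * N"
    by (auto simp: bin_def)
qed

text \<open>Membership in a disk with the abscissas of point and centre replaced by strip indices,
  while the ordinates stay exact: all points of a strip count as lying on one line.\<close>

definition in_col :: "nat \<Rightarrow> point \<Rightarrow> real \<Rightarrow> nat \<Rightarrow> real \<Rightarrow> point \<Rightarrow> bool" where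
  "in_col N u r \<alpha> y p \<longleftrightarrow> (real (bin N u p) - real \<alpha>)\<^sup>2 + (rot_b u p - y)\<^sup>2 \<le> r\<^sup>2"

text \<open>The centres differ by a multiple of \<open>u\<close>, so their bisector is a line of
  constant \<open>rot_a\<close>, and a covered point lies in the disk on its own side. Cutting
  between strips moves the bisector by at most 1, which shifts the comparison of the two abscissa
  distances by at most 2; the floors of point and centre add 1 more. This is the 3.\<close>

lemma split_along_direction:
  fixes S :: "point set"
  assumes N: "N \<ge> 1000" and u: "norm u = 1" and S: "\<And>p. p \<in> S \<Longrightarrow> norm p \<le> 10 * real N"
    and d: "d \<ge> 0" and rho: "0 \<le> \<rho>"
    and cov: "S \<subseteq> cball c \<rho> \<union> cball (c + d *\<^sub>R u) \<rho>"
    and c: "norm c \<le> 18 * real N" "norm (c + d *\<^sub>R u) \<le> 18 * real N" and r: "r \<ge> \<rho> + 3"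
  shows "\<exists>t\<le>40 * N. \<exists>\<alpha><40 * N. \<exists>\<alpha>'<40 * N. \<exists>y. \<bar>y\<bar> \<le> 18 * real N \<and>
    (\<forall>p\<in>S. (bin N u p < t \<longrightarrow> in_col N u r \<alpha> y p) \<and> (t \<le> bin N u p \<longrightarrow> in_col N u r \<alpha>' y p))"
proof -
  define y where "y = rot_b u c"
  define a1 where "a1 = rot_a u c"
  define t0 where "t0 = a1 + d / 2"
  \<comment> \<open>The first strip lying entirely beyond the bisector \<open>t0\<close>; the strip
    that contains the bisector goes to the left part.\<close>
  define t where "t = nat (\<lfloor>t0\<rfloor> + 1 + 20 * int N)"
  let ?c' = "c + d *\<^sub>R u"
  have a2: "rot_a u ?c' = a1 + d" "rot_b u ?c' = y" using rot_line[OF u] by (simp_all add: a1_def y_def)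
  have r1: "\<bar>a1\<bar> \<le> 18 * real N" "\<bar>a1 + d\<bar> \<le> 18 * real N" "\<bar>y\<bar> \<le> 18 * real N"
    using rot_abs_le[OF u, of c] rot_abs_le(1)[OF u, of ?c'] c a2 by (auto simp: a1_def y_def)
  then have "\<bar>t0\<bar> \<le> 18 * real N" using d unfolding t0_def by linarith
  then have "\<lfloor>t0\<rfloor> + 1 + 20 * int N \<ge> 0" "\<lfloor>t0\<rfloor> + 1 + 20 * int N \<le> 40 * int N" using N by linarith+
  then have t: "real t = of_int \<lfloor>t0\<rfloor> + 1 + 20 * real N" "t \<le> 40 * N" by (auto simp: t_def)
  have bc: "real (bin N u c) = of_int \<lfloor>a1\<rfloor> + 20 * real N" "bin N u c < 40 * N"
    "real (bin N u ?c') = of_int \<lfloor>a1 + d\<rfloor> + 20 * real N" "bin N u ?c' < 40 * N"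
    using bin_range[OF u, of c N] bin_range[OF u, of ?c' N] c N a2 by (auto simp: a1_def)
  have r2: "(\<rho> + 3)\<^sup>2 \<le> r\<^sup>2" using r rho by (intro power_mono) auto
  have "(bin N u p < t \<longrightarrow> in_col N u r (bin N u c) y p) \<and> (t \<le> bin N u p \<longrightarrow> in_col N u r (bin N u ?c') y p)"
    if p: "p \<in> S" for p
  proof -
    define a where "a = rot_a u p"
    define b where "b = rot_b u p - y"
    have bp: "real (bin N u p) = of_int \<lfloor>a\<rfloor> + 20 * real N"
      using bin_range(1)[OF u, of p N] S[OF p] N by (simp add: a_def)
    have "p \<in> cball c \<rho> \<or> p \<in> cball ?c' \<rho>" using cov p by blast
    then have alt: "(a - a1)\<^sup>2 + b\<^sup>2 \<le> \<rho>\<^sup>2 \<or> (a - (a1 + d))\<^sup>2 + b\<^sup>2 \<le> \<rho>\<^sup>2"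
      using dist_rot[OF u, of p c] dist_rot[OF u, of p ?c'] rho a2 power_mono[of "dist p c" \<rho> 2]
        power_mono[of "dist p ?c'" \<rho> 2] by (auto simp: a_def b_def a1_def y_def dist_commute)
    have L: "in_col N u r (bin N u c) y p" if "bin N u p < t"
    proof -
      have "real (bin N u p) < real t" using that by simp
      then have "\<lfloor>a\<rfloor> \<le> \<lfloor>t0\<rfloor>" using bp t(1) by linarith
      then have at: "a \<le> t0 + 1" by linarith
      define x where "x = real (bin N u p) - real (bin N u c)"
      have x: "\<bar>x\<bar> \<le> \<bar>a - a1\<bar> + 1" using bp bc unfolding x_def by linarith
      have "\<bar>a - a1\<bar> \<le> \<bar>a - (a1 + d)\<bar> + 2" using at d unfolding t0_def by linarith
      then have "\<bar>x\<bar> \<le> \<bar>a - (a1 + d)\<bar> + 3" "\<bar>x\<bar> \<le> \<bar>a - a1\<bar> + 3" using x by linarith+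
      then have "x\<^sup>2 + b\<^sup>2 \<le> (\<rho> + 3)\<^sup>2" using alt rho sum_squares_perturb[of _ b \<rho> x 3] by auto
      then show ?thesis using r2 by (simp add: in_col_def x_def b_def)
    qed
    have R: "in_col N u r (bin N u ?c') y p" if "t \<le> bin N u p"
    proof -
      have "real t \<le> real (bin N u p)" using that by simp
      then have "\<lfloor>a\<rfloor> \<ge> \<lfloor>t0\<rfloor> + 1" using bp t(1) by linarith
      then have at: "a \<ge> t0" by linarith
      define x where "x = real (bin N u p) - real (bin N u ?c')"
      have x: "\<bar>x\<bar> \<le> \<bar>a - (a1 + d)\<bar> + 1" using bp bc unfolding x_def by linarith
      have "\<bar>a - (a1 + d)\<bar> \<le> \<bar>a - a1\<bar>" using at d unfolding t0_def by linarith
      then have "\<bar>x\<bar> \<le> \<bar>a - (a1 + d)\<bar> + 3" "\<bar>x\<bar> \<le> \<bar>a - a1\<bar> + 3" using x by linarith+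
      then have "x\<^sup>2 + b\<^sup>2 \<le> (\<rho> + 3)\<^sup>2" using alt rho sum_squares_perturb[of _ b \<rho> x 3] by auto
      then show ?thesis using r2 by (simp add: in_col_def x_def b_def)
    qed
    show ?thesis using L R by blast
  qed
  then show ?thesis using t(2) bc r1(3) by blast
qed

text \<open>A disk that meets no point of \<open>S\<close> is replaced by a copy of the other one;
  afterwards both centres are bounded in terms of \<open>S\<close>. Ordering them puts their
  difference into the upper half plane, where the net of directions lives.\<close>

lemma cover_by_touching_balls:
  fixes S :: "point set"
  assumes "S \<noteq> {}" "S \<subseteq> cball c1 \<rho> \<union> cball c2 \<rho>"
  obtains d1 d2 where "S \<subseteq> cball d1 \<rho> \<union> cball d2 \<rho>" "S \<inter> cball d1 \<rho> \<noteq> {}" "S \<inter> cball d2 \<rho> \<noteq> {}"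
    "snd d1 \<le> snd d2"
proof -
  obtain e1 e2 where e: "S \<subseteq> cball e1 \<rho> \<union> cball e2 \<rho>" "S \<inter> cball e1 \<rho> \<noteq> {}" "S \<inter> cball e2 \<rho> \<noteq> {}"
  proof (cases "S \<inter> cball c1 \<rho> = {} \<or> S \<inter> cball c2 \<rho> = {}")
    case True
    then show ?thesis using assms that[of c1 c1] that[of c2 c2] by blast
  next
    case False
    then show ?thesis using assms(2) that by blast
  qed
  show thesis
    using e that[of e1 e2] that[of e2 e1] by (cases "snd e1 \<le> snd e2") (auto simp: Un_commute)
qed

text \<open>The second centre is turned about the first until their line has a net direction. At
  distance at most \<open>24 * N\<close> and with error \<open>8 / N\<close> in the unit vector it
  moves by at most 192; the strips cost 3 more, and 275 leaves room. One \<open>k\<close> has to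
  serve all \<open>r\<close>, since the search meets this direction at a radius not known
  beforehand.\<close>

lemma net_direction_splits:
  fixes S :: "point set"
  assumes N: "N \<ge> 1000" and ne: "S \<noteq> {}" and S: "\<And>p. p \<in> S \<Longrightarrow> norm p \<le> 10 * real N"
    and rho: "0 \<le> \<rho>" "\<rho> \<le> real N + 10" and cov: "S \<subseteq> cball c1 \<rho> \<union> cball c2 \<rho>"
  shows "\<exists>k\<le>2 * N. \<forall>r\<ge>\<rho> + 275. \<exists>t\<le>40 * N. \<exists>\<alpha><40 * N. \<exists>\<alpha>'<40 * N. \<exists>y. \<bar>y\<bar> \<le> 18 * real N \<and>
    (\<forall>p\<in>S. (bin N (dir N k) p < t \<longrightarrow> in_col N (dir N k) r \<alpha> y p) \<and>
           (t \<le> bin N (dir N k) p \<longrightarrow> in_col N (dir N k) r \<alpha>' y p))"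
proof -
  obtain d1 d2 where d: "S \<subseteq> cball d1 \<rho> \<union> cball d2 \<rho>" "S \<inter> cball d1 \<rho> \<noteq> {}" "S \<inter> cball d2 \<rho> \<noteq> {}"
    "snd d1 \<le> snd d2" by (rule cover_by_touching_balls[OF ne cov])
  have nb: "norm e \<le> 12 * real N" if "S \<inter> cball e \<rho> \<noteq> {}" for e
  proof -
    obtain p where p: "p \<in> S" "dist e p \<le> \<rho>" using \<open>S \<inter> cball e \<rho> \<noteq> {}\<close> by auto
    then have "norm e \<le> norm p + \<rho>" using norm_triangle_sub[of e p] by (simp add: dist_norm)
    then show ?thesis using S[OF p(1)] rho N by simp
  qed
  define D where "D = norm (d2 - d1)"
  have D: "D \<le> 24 * real N" using nb[OF d(2)] nb[OF d(3)] norm_triangle_ineq4[of d2 d1] by (simp add: D_def)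
  \<comment> \<open>For coinciding centres any unit vector of the upper half plane will do.\<close>
  define v where "v = (if d1 = d2 then (1, 0) else (d2 - d1) /\<^sub>R D)"
  have v: "norm v = 1" "snd v \<ge> 0" "d2 = d1 + D *\<^sub>R v"
    using d(4) by (auto simp: v_def D_def norm_Pair zero_prod_def[symmetric])
  obtain k where k: "k \<le> 2 * N" "norm (dir N k - v) \<le> 8 / N" using dir_net[of N v] v N by auto
  define u where "u = dir N k"
  have u: "norm u = 1" using N by (simp add: u_def norm_dir)
  have near: "dist d2 (d1 + D *\<^sub>R u) \<le> 192"
  proof -
    have "dist d2 (d1 + D *\<^sub>R u) = D * norm (u - v)"
    proof -
      have "d2 - (d1 + D *\<^sub>R u) = D *\<^sub>R (v - u)" using v(3) by (simp add: scaleR_diff_right)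
      then show ?thesis by (simp add: dist_norm D_def norm_minus_commute)
    qed
    also have "\<dots> \<le> (24 * N) * (8 / N)" using D k(2) by (intro mult_mono) (auto simp: u_def)
    finally show ?thesis using N by simp
  qed
  let ?\<rho> = "\<rho> + 192"
  have cov': "S \<subseteq> cball d1 ?\<rho> \<union> cball (d1 + D *\<^sub>R u) ?\<rho>"
  proof
    fix p assume "p \<in> S"
    then consider "dist d1 p \<le> \<rho>" | "dist d2 p \<le> \<rho>" using d(1) by auto
    then show "p \<in> cball d1 ?\<rho> \<union> cball (d1 + D *\<^sub>R u) ?\<rho>"
    proof cases
      case 2
      then show ?thesis using near dist_triangle3[of "d1 + D *\<^sub>R u" p d2] by simp
    qed simp
  qed
  have c: "norm d1 \<le> 18 * real N" "norm (d1 + D *\<^sub>R u) \<le> 18 * real N"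
  proof -
    show "norm d1 \<le> 18 * real N" using nb[OF d(2)] by simp
    have "norm (d1 + D *\<^sub>R u) \<le> norm d2 + 192"
      using near norm_triangle_sub[of "d1 + D *\<^sub>R u" d2] by (simp add: dist_norm norm_minus_commute)
    then show "norm (d1 + D *\<^sub>R u) \<le> 18 * real N" using nb[OF d(3)] N by simp
  qed
  show ?thesis
  proof (rule exI[of _ k], intro conjI allI impI k(1))
    fix r assume "r \<ge> \<rho> + 275"
    then show "\<exists>t\<le>40 * N. \<exists>\<alpha><40 * N. \<exists>\<alpha>'<40 * N. \<exists>y. \<bar>y\<bar> \<le> 18 * real N \<and>
      (\<forall>p\<in>S. (bin N (dir N k) p < t \<longrightarrow> in_col N (dir N k) r \<alpha> y p) \<and>
           (t \<le> bin N (dir N k) p \<longrightarrow> in_col N (dir N k) r \<alpha>' y p))"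
      using split_along_direction[OF N u S _ _ cov' c, of r] rho unfolding u_def D_def by simp
  qed
qed

section \<open>Initial and final segments of strips\<close>

definition fits :: "(nat \<Rightarrow> real) \<Rightarrow> (nat \<Rightarrow> real) \<Rightarrow> real \<Rightarrow> real \<Rightarrow> real \<Rightarrow> nat \<Rightarrow> bool" where
  "fits lo hi r \<alpha> y k \<longleftrightarrow> hi k - sqrt (r\<^sup>2 - (real k - \<alpha>)\<^sup>2) \<le> y \<and> y \<le> lo k + sqrt (r\<^sup>2 - (real k - \<alpha>)\<^sup>2)"

definition bins_of :: "nat \<Rightarrow> point \<Rightarrow> point set \<Rightarrow> (nat \<Rightarrow> real) \<Rightarrow> (nat \<Rightarrow> real) \<Rightarrow> bool" where
  "bins_of N u S lo hi \<longleftrightarrow>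
    (\<forall>p\<in>S. lo (bin N u p) \<le> rot_b u p \<and> rot_b u p \<le> hi (bin N u p)) \<and>
    (\<forall>k<40 * N. (lo k = 100 * real N \<or> (\<exists>p\<in>S. bin N u p = k \<and> rot_b u p = lo k)) \<and>
                (hi k = - 100 * real N \<or> (\<exists>p\<in>S. bin N u p = k \<and> rot_b u p = hi k)))"

lemma fits_in_col:
  assumes "fits lo hi r \<alpha> y k" "lo k \<le> b" "b \<le> hi k"
  shows "(real k - \<alpha>)\<^sup>2 + (b - y)\<^sup>2 \<le> r\<^sup>2"
proof -
  let ?s = "sqrt (r\<^sup>2 - (real k - \<alpha>)\<^sup>2)"
  have s: "\<bar>b - y\<bar> \<le> ?s" using assms by (auto simp: fits_def)
  then have "0 \<le> ?s" by linarith
  then have "0 \<le> r\<^sup>2 - (real k - \<alpha>)\<^sup>2" by simp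
  then have "?s\<^sup>2 = r\<^sup>2 - (real k - \<alpha>)\<^sup>2" by simp
  moreover have "(b - y)\<^sup>2 \<le> ?s\<^sup>2" using power_mono[OF s, of 2] by simp
  ultimately show ?thesis by simp
qed

text \<open>Empty bins never obstruct: \<open>sqrt\<close> of a negative radicand is negative but at least \<open>-40 N\<close>.\<close>
lemma in_col_fits:
  assumes bins: "bins_of N u S lo hi" and k: "k < 40 * N" and al: "\<alpha> < 40 * N" and y: "\<bar>y\<bar> \<le> 18 * real N"
    and S: "\<And>p. p \<in> S \<Longrightarrow> bin N u p = k \<Longrightarrow> in_col N u r \<alpha> y p"
  shows "fits lo hi r (real \<alpha>) y k"
proof -
  let ?d = "real k - real \<alpha>"
  let ?s = "sqrt (r\<^sup>2 - ?d\<^sup>2)"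
  have pt: "\<bar>b - y\<bar> \<le> ?s" if "p \<in> S" "bin N u p = k" "rot_b u p = b" for p b
  proof -
    have "(b - y)\<^sup>2 \<le> r\<^sup>2 - ?d\<^sup>2" using S[OF that(1,2)] that by (simp add: in_col_def)
    then show ?thesis by (metis real_sqrt_abs real_sqrt_le_mono)
  qed
  have "- (?d\<^sup>2) \<le> r\<^sup>2 - ?d\<^sup>2" by simp
  then have "sqrt (- (?d\<^sup>2)) \<le> ?s" by (rule real_sqrt_le_mono)
  then have "- \<bar>?d\<bar> \<le> ?s" by (simp add: real_sqrt_minus)
  moreover have "\<bar>?d\<bar> \<le> 40 * real N" using k al by linarith
  ultimately have s: "?s \<ge> - 40 * real N" by linarith
  have "hi k - ?s \<le> y"
  proof (cases "hi k = - 100 * real N")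
    case True
    then show ?thesis using s y by linarith
  next
    case False
    then obtain p where "p \<in> S" "bin N u p = k" "rot_b u p = hi k" using bins k by (auto simp: bins_of_def)
    from pt[OF this] show ?thesis by linarith
  qed
  moreover have "y \<le> lo k + ?s"
  proof (cases "lo k = 100 * real N")
    case True
    then show ?thesis using s y by linarith
  next
    case False
    then obtain p where "p \<in> S" "bin N u p = k" "rot_b u p = lo k" using bins k by (auto simp: bins_of_def)
    from pt[OF this] show ?thesis by linarith
  qed
  ultimately show ?thesis by (simp add: fits_def)
qed

text \<open>A longest initial run of strips that one disk can serve, with its centre. The
  competitors have integer abscissas and ordinates up to \<open>100 * N\<close>, the range of a
  scan; the centres provided by a split along the direction are among them.\<close>

definition longest_prefix ::
    "nat \<Rightarrow> (nat \<Rightarrow> real) \<Rightarrow> (nat \<Rightarrow> real) \<Rightarrow> real \<Rightarrow> nat \<Rightarrow> real \<Rightarrow> real \<Rightarrow> bool" where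
  "longest_prefix N lo hi r m \<alpha> y \<longleftrightarrow> (\<forall>k<m. fits lo hi r \<alpha> y k) \<and>
    (\<forall>\<alpha>'<40 * N. \<forall>m'\<le>40 * N. \<forall>y'. \<bar>y'\<bar> \<le> 100 * real N \<longrightarrow>
       (\<forall>k<m'. fits lo hi r (real \<alpha>') y' k) \<longrightarrow> m' \<le> m)"

lemma longest_prefixD:
  assumes "longest_prefix N lo hi r m \<alpha> y" "\<alpha>' < 40 * N" "m' \<le> 40 * N" "\<bar>y'\<bar> \<le> 100 * real N"
    "\<And>k. k < m' \<Longrightarrow> fits lo hi r (real \<alpha>') y' k"
  shows "m' \<le> m"
  using assms unfolding longest_prefix_def by blast

text \<open>Reversal turns final segments into initial ones, so that one scan procedure serves both
  disks; an abscissa \<open>\<alpha>\<close> becomes \<open>40 * N - 1 - \<alpha>\<close>.\<close>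

definition rev_bins :: "nat \<Rightarrow> (nat \<Rightarrow> real) \<Rightarrow> nat \<Rightarrow> real" where
  "rev_bins N f k = f (40 * N - 1 - k)"

lemma fits_rev:
  assumes "k < 40 * N"
  shows "fits (rev_bins N lo) (rev_bins N hi) r \<alpha> y k \<longleftrightarrow> fits lo hi r (40 * real N - 1 - \<alpha>) y (40 * N - 1 - k)"
proof -
  have "real (40 * N - 1 - k) - (40 * real N - 1 - \<alpha>) = - (real k - \<alpha>)" using assms by (simp add: of_nat_diff)
  then have "(real (40 * N - 1 - k) - (40 * real N - 1 - \<alpha>))\<^sup>2 = (real k - \<alpha>)\<^sup>2" by (metis power2_minus)
  then show ?thesis by (simp add: fits_def rev_bins_def)
qed

text \<open>A greedy argument: whether a disk can serve the strips before the cut does not depend on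
  the other disk. Maximising both ends separately therefore reaches all strips as soon as some cut
  works.\<close>

lemma prefix_suffix_complete:
  assumes bins: "bins_of N u S lo hi" and t: "t \<le> 40 * N" "\<alpha> < 40 * N" "\<alpha>' < 40 * N" "\<bar>y\<bar> \<le> 18 * real N"
    and split: "\<forall>p\<in>S. (bin N u p < t \<longrightarrow> in_col N u r \<alpha> y p) \<and> (t \<le> bin N u p \<longrightarrow> in_col N u r \<alpha>' y p)"
    and L: "longest_prefix N lo hi r m1 x1 y1"
    and R: "longest_prefix N (rev_bins N lo) (rev_bins N hi) r m2 x2 y2"
  shows "40 * N \<le> m1 + m2"
proof -
  have y: "\<bar>y\<bar> \<le> 100 * real N" using t(4) by linarith
  have "fits lo hi r (real \<alpha>) y k" if "k < t" for k
    using in_col_fits[OF bins _ t(2,4), of k r] that t split by auto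
  then have "t \<le> m1" using t y by (intro longest_prefixD[OF L, of \<alpha> _ y]) auto
  moreover have "fits (rev_bins N lo) (rev_bins N hi) r (real (40 * N - 1 - \<alpha>')) y k" if "k < 40 * N - t" for k
  proof -
    have "40 * real N - 1 - real (40 * N - 1 - \<alpha>') = real \<alpha>'" using t(3) by (simp add: of_nat_diff)
    moreover have "fits lo hi r (real \<alpha>') y (40 * N - 1 - k)"
      using in_col_fits[OF bins _ t(3,4), of "40 * N - 1 - k" r] that t split by auto
    ultimately show ?thesis using fits_rev[of k N lo hi r "real (40 * N - 1 - \<alpha>')" y] that by simp
  qed
  then have "40 * N - t \<le> m2"
    using t(3) y by (intro longest_prefixD[OF R, of "40 * N - 1 - \<alpha>'" _ y]) auto
  ultimately show ?thesis by linarith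
qed

text \<open>Every strip belongs to the prefix or to the suffix. Passing from strip indices back to
  points costs 1 for the floor; the centres undo the offset \<open>20 * N\<close> of
  \<open>bin\<close>, the second one also the reversal.\<close>

lemma prefix_suffix_sound:
  assumes bins: "bins_of N u S lo hi" and u: "norm u = 1" and N: "N > 0"
    and S: "\<And>p. p \<in> S \<Longrightarrow> norm p \<le> 10 * real N" and r: "0 \<le> r"
    and L: "longest_prefix N lo hi r m1 x1 y1"
    and R: "longest_prefix N (rev_bins N lo) (rev_bins N hi) r m2 x2 y2"
    and m: "40 * N \<le> m1 + m2"
  shows "S \<subseteq> cball (unrot u (x1 - 20 * real N) y1) (r + 1) \<union>
             cball (unrot u (20 * real N - 1 - x2) y2) (r + 1)"
proof
  fix p assume p: "p \<in> S"
  define k where "k = bin N u p"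
  have k: "k < 40 * N" "real k = of_int \<lfloor>rot_a u p\<rfloor> + 20 * real N"
    using bin_range[OF u, of p N] S[OF p] N by (auto simp: k_def)
  have b: "lo k \<le> rot_b u p" "rot_b u p \<le> hi k" using bins p by (auto simp: bins_of_def k_def)
  have *: "p \<in> cball (unrot u (x - 20 * real N) y) (r + 1)" if "fits lo hi r x y k" for x y
  proof -
    have "(real k - x)\<^sup>2 + (rot_b u p - y)\<^sup>2 \<le> r\<^sup>2" by (rule fits_in_col[OF that b])
    moreover have "\<bar>rot_a u p - (x - 20 * real N)\<bar> \<le> \<bar>real k - x\<bar> + 1" using k(2) by linarith
    ultimately have "(rot_a u p - (x - 20 * real N))\<^sup>2 + (rot_b u p - y)\<^sup>2 \<le> (r + 1)\<^sup>2"
      using r by (intro sum_squares_perturb) auto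
    then have "(dist p (unrot u (x - 20 * real N) y))\<^sup>2 \<le> (r + 1)\<^sup>2"
      using dist_rot[OF u] rot_unrot[OF u] by simp
    then show ?thesis using r power2_le_imp_le by (fastforce simp: dist_commute)
  qed
  show "p \<in> cball (unrot u (x1 - 20 * real N) y1) (r + 1) \<union>
             cball (unrot u (20 * real N - 1 - x2) y2) (r + 1)"
  proof (cases "k < m1")
    case True
    then show ?thesis using * L by (auto simp: longest_prefix_def)
  next
    case False
    then have k': "40 * N - 1 - k < m2" "40 * N - 1 - k < 40 * N" using m k(1) by auto
    then have "fits (rev_bins N lo) (rev_bins N hi) r x2 y2 (40 * N - 1 - k)" using R by (auto simp: longest_prefix_def)
    then have "fits lo hi r (40 * real N - 1 - x2) y2 k" using fits_rev[OF k'(2)] k(1) by simp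
    from *[OF this] show ?thesis by (simp add: algebra_simps)
  qed
qed

section \<open>Rounded disks and boundary samples\<close>

definition radius_grid :: "(point \<times> real) set \<Rightarrow> (point \<Rightarrow> real) \<Rightarrow> bool" where
  "radius_grid D G \<longleftrightarrow> (\<forall>d\<in>D. snd d \<le> G (snap (fst d))) \<and>
    (\<forall>g. G g > 0 \<longrightarrow> (\<exists>d\<in>D. snap (fst d) = g \<and> snd d = G g))"

text \<open>The net covers only the upper half plane; the sign \<open>s\<close> supplies the
  opposite directions.\<close>

definition samples :: "nat \<Rightarrow> (point \<Rightarrow> real) \<Rightarrow> point set" where
  "samples N G = {snap (g + (s * G g) *\<^sub>R dir (real N) (real k)) | g s k. G g > 0 \<and> k \<le> 2 * N \<and> (s = 1 \<or> s = -1)}"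

lemma union_cball_enlarge:
  fixes c1 c2 :: "'a::metric_space"
  assumes "dist x y \<le> e" "y \<in> cball c1 r \<union> cball c2 r"
  shows "x \<in> cball c1 (r + e) \<union> cball c2 (r + e)"
  using assms dist_triangle2[of c1 x y] dist_triangle2[of c2 x y] by (auto simp: dist_commute)

text \<open>Two roundings of at most 2 each, one of the disk's centre and one of the boundary
  point.\<close>

lemma sample_near_disk:
  assumes N: "N > 0" and G: "radius_grid D G" and p: "p \<in> samples N G"
  shows "\<exists>d\<in>D. \<exists>x\<in>disk d. dist p x \<le> 4"
proof -
  obtain g s k where g: "p = snap (g + (s * G g) *\<^sub>R dir N k)" "G g > 0" "s = 1 \<or> s = -1"
    using p by (auto simp: samples_def)
  then obtain d where d: "d \<in> D" "snap (fst d) = g" "snd d = G g" using G unfolding radius_grid_def by blast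
  define c where "c = fst d"
  define w where "w = (s * G g) *\<^sub>R dir N k"
  have "norm w = G g" using g N by (auto simp: w_def norm_dir)
  then have "c + w \<in> disk d" using d by (simp add: dist_norm disk_def c_def)
  moreover have "dist p (c + w) \<le> 4"
  proof -
    have "dist p (g + w) \<le> 2" using dist_snap[of "g + w"] by (simp add: g(1) w_def dist_commute)
    moreover have "dist (g + w) (c + w) \<le> 2" using dist_snap[of c] d(2) by (simp add: dist_commute c_def)
    ultimately show ?thesis using dist_triangle[of p "c + w" "g + w"] by linarith
  qed
  ultimately show ?thesis using d(1) by blast
qed

lemma samples_covered:
  assumes "N > 0" "radius_grid D G" and cov: "\<Union> (disk ` D) \<subseteq> cball c1 \<rho> \<union> cball c2 \<rho>"
  shows "samples N G \<subseteq> cball c1 (\<rho> + 4) \<union> cball c2 (\<rho> + 4)"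
proof
  fix p assume "p \<in> samples N G"
  then obtain d x where x: "d \<in> D" "x \<in> disk d" "dist p x \<le> 4"
    using sample_near_disk[OF assms(1,2)] by blast
  then have "x \<in> cball c1 \<rho> \<union> cball c2 \<rho>" using cov by blast
  then show "p \<in> cball c1 (\<rho> + 4) \<union> cball c2 (\<rho> + 4)"
    by (rule union_cball_enlarge[OF x(3)])
qed

lemma norm_samples:
  assumes "N \<ge> 4" "radius_grid D G" and D: "\<And>d. d \<in> D \<Longrightarrow> norm (fst d) + snd d \<le> 9 * real N"
    and p: "p \<in> samples N G"
  shows "norm p \<le> 9 * real N + 4"
proof -
  obtain d x where x: "d \<in> D" "x \<in> disk d" "dist p x \<le> 4"
    using sample_near_disk[OF _ assms(2) p] assms(1) by auto
  have "norm p \<le> norm x + dist p x" "norm x \<le> norm (fst d) + dist (fst d) x"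
    using norm_triangle_sub[of p x] norm_triangle_sub[of x "fst d"] by (auto simp: dist_norm norm_minus_commute)
  then show ?thesis using x D[OF x(1)] by (simp add: disk_def)
qed

lemma samples_nonempty:
  assumes "radius_grid D G" "d \<in> D" "snd d > 0"
  shows "samples N G \<noteq> {}"
proof -
  have "G (snap (fst d)) > 0" using assms by (force simp: radius_grid_def)
  then have "snap (snap (fst d) + (1 * G (snap (fst d))) *\<^sub>R dir (real N) (real 0)) \<in> samples N G" unfolding samples_def by blast
  then show ?thesis by blast
qed

text \<open>Among disks whose centres are rounded to the same grid point only the largest is
  sampled; after moving all of them there it contains the others. The 12 consists of 8 for replacing
  a boundary direction by a net direction at radius at most \<open>N\<close>, 2 for rounding the
  sample and 2 for moving the centre.\<close>

lemma disks_covered_if_samples_covered: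
  assumes N: "N > 0" and G: "radius_grid D G" and D: "\<And>d. d \<in> D \<Longrightarrow> 0 < snd d \<and> snd d \<le> real N"
    and r: "0 \<le> r" and cov: "samples N G \<subseteq> cball c1 r \<union> cball c2 r"
  shows "\<Union> (disk ` D) \<subseteq> cball c1 (r + 12) \<union> cball c2 (r + 12)"
proof
  fix x assume "x \<in> \<Union> (disk ` D)"
  then obtain d where d: "d \<in> D" "x \<in> disk d" by blast
  define c where "c = fst d"
  define g where "g = snap c"
  have "G g \<ge> snd d" using G d(1) unfolding radius_grid_def g_def c_def by blast
  then have Gg: "G g \<ge> snd d" "G g > 0" using D[OF d(1)] by linarith+
  then obtain d' where d': "d' \<in> D" "snd d' = G g" using G unfolding radius_grid_def by blast
  have GN: "G g \<le> real N" using D[OF d'(1)] d'(2) by simp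
  have "sphere g (G g) \<subseteq> cball c1 (r + 10) \<union> cball c2 (r + 10)"
  proof
    fix q assume "q \<in> sphere g (G g)"
    then have nq: "norm (q - g) = G g" by (simp add: dist_norm norm_minus_commute)
    define s :: real where "s = (if snd (q - g) \<ge> 0 then 1 else -1)"
    have s: "s = 1 \<or> s = -1" "s * s = 1" "\<bar>s\<bar> = 1" by (auto simp: s_def)
    define v where "v = (s / G g) *\<^sub>R (q - g)"
    have "norm v = \<bar>s\<bar> / G g * norm (q - g)" using Gg(2) by (simp add: v_def)
    then have "norm v = 1" using s(3) nq Gg(2) by simp
    moreover have "snd v \<ge> 0"
    proof -
      have "s * snd (q - g) \<ge> 0" by (simp add: s_def)
      moreover have "snd v = s * snd (q - g) / G g" by (simp add: v_def)
      ultimately show ?thesis using Gg(2) by simp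
    qed
    ultimately obtain k where k: "k \<le> 2 * N" "norm (dir N k - v) \<le> 8 / N" using dir_net[OF N] by blast
    have "(s * G g) *\<^sub>R v = (s * s) *\<^sub>R (q - g)" using Gg by (simp add: v_def)
    then have q: "q = g + (s * G g) *\<^sub>R v" using s by simp
    define w where "w = g + (s * G g) *\<^sub>R dir N k"
    have "dist q w = \<bar>s * G g\<bar> * norm (dir N k - v)"
    proof -
      have "q - w = (s * G g) *\<^sub>R (v - dir N k)"
        by (subst q) (simp only: w_def scaleR_diff_right add_diff_cancel_left)
      then show ?thesis by (simp add: dist_norm norm_minus_commute)
    qed
    also have "\<dots> \<le> N * (8 / N)" using k(2) GN Gg(2) s(3) by (intro mult_mono) (simp_all add: abs_mult)
    finally have "dist q w \<le> 8" using N by simp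
    then have "dist q (snap w) \<le> 10" using dist_snap[of w] dist_triangle[of q "snap w" w] by linarith
    moreover have "snap w \<in> samples N G" unfolding samples_def w_def using Gg(2) k(1) s(1)
      by (intro CollectI exI[of _ g] exI[of _ s] exI[of _ k] conjI refl)
    ultimately show "q \<in> cball c1 (r + 10) \<union> cball c2 (r + 10)"
      using cov by (intro union_cball_enlarge[of q "snap w" 10 c1 r c2]) (assumption, rule subsetD)
  qed
  then have disk: "cball g (G g) \<subseteq> cball c1 (r + 10) \<union> cball c2 (r + 10)"
    using r by (intro disk_covered_if_sphere_covered) auto
  have "x - c + g \<in> cball g (G g)" using d(2) Gg
    by (simp add: dist_norm norm_minus_commute disk_def c_def)
  moreover have "dist x (x - c + g) \<le> 2" using dist_snap[of c] by (simp add: dist_norm g_def)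
  ultimately have "x \<in> cball c1 (r + 10 + 2) \<union> cball c2 (r + 10 + 2)"
    using disk by (intro union_cball_enlarge[of x "x - c + g" 2 c1 "r + 10" c2]) (assumption, rule subsetD)
  then show "x \<in> cball c1 (r + 12) \<union> cball c2 (r + 12)" by (simp add: add.commute)
qed

section \<open>Normalisation of two clusters\<close>

lemma mem_cball_affine:
  fixes c w y :: "'a::real_normed_vector"
  assumes "h > 0"
  shows "y \<in> cball ((c - w) /\<^sub>R h) (R / h) \<longleftrightarrow> w + h *\<^sub>R y \<in> cball c R"
proof -
  have "c - (w + h *\<^sub>R y) = h *\<^sub>R ((c - w) /\<^sub>R h - y)" using assms by (simp add: algebra_simps)
  then have "dist c (w + h *\<^sub>R y) = h * dist ((c - w) /\<^sub>R h) y" using assms by (simp add: dist_norm)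
  then show ?thesis using assms by (simp add: field_simps)
qed

text \<open>Disks closer to \<open>p2\<close> than to \<open>p1\<close> are translated by \<open>- v\<close>, which brings clusters that are
  too far apart to interact to distance \<open>8 q\<close>; then everything is scaled by \<open>1 / h\<close>. For \<open>p1 = p2\<close>
  the factor in \<open>v\<close> is \<open>1\<close> (division by zero), but \<open>v = 0\<close> all the same.\<close>

locale two_clusters =
  fixes D :: "(point \<times> real) set" and p1 p2 :: point and q :: real and N :: nat
  assumes N: "N > 0" and q: "q > 0"
    and rad: "\<And>d. d \<in> D \<Longrightarrow> 0 < snd d \<and> min (dist (fst d) p1) (dist (fst d) p2) + snd d \<le> q"
    and p1: "p1 \<in> fst ` D" and p2: "p2 \<in> fst ` D"
begin

definition h :: real where "h = q / N"
definition v :: point where "v = max 0 (1 - 8 * q / dist p1 p2) *\<^sub>R (p2 - p1)"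
definition base :: "point \<Rightarrow> point" where "base c = (if dist c p1 \<le> dist c p2 then p1 else p1 + v)"
definition nd :: "point \<times> real \<Rightarrow> point \<times> real" where
  "nd d = ((fst d - base (fst d)) /\<^sub>R h, snd d / h)"
text \<open>The anchor \<open>p2\<close> of the second cluster after translation and scaling; the
  anchor \<open>p1\<close> becomes 0.\<close>

definition p2n :: point where "p2n = (p2 - (p1 + v)) /\<^sub>R h"
text \<open>A centre is moved back together with the cluster whose anchor is closer. If the clusters
  have been translated, this is the only cluster that its disk can serve.\<close>

definition unshift :: "point \<Rightarrow> point" where
  "unshift c = p1 + h *\<^sub>R c + (if dist c p2n < dist c 0 then v else 0)"

lemma h_pos: "h > 0" using N q by (simp add: h_def)

lemma q_div_h: "q / h = N" using q N by (simp add: h_def)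

lemma near_or_far:
  "dist p1 p2 \<le> 8 * q \<and> v = 0 \<or> dist p1 p2 > 8 * q \<and> norm (p2 - (p1 + v)) = 8 * q"
proof (cases "dist p1 p2 > 8 * q")
  case True
  then have d: "dist p1 p2 > 0" using q by linarith
  then have "8 * q / dist p1 p2 \<le> 1" using True by (simp add: field_simps)
  then have "p2 - (p1 + v) = (8 * q / dist p1 p2) *\<^sub>R (p2 - p1)" by (simp add: v_def scaleR_diff_left)
  then have "norm (p2 - (p1 + v)) = 8 * q" using d q by (simp add: dist_norm norm_minus_commute)
  then show ?thesis using True by blast
next
  case False
  have "v = 0"
  proof (cases "p1 = p2")
    case True
    then show ?thesis unfolding v_def by simp
  next
    case neq: False
    then have "8 * q / dist p1 p2 \<ge> 1" using False by (simp add: field_simps)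
    then show ?thesis by (simp add: v_def)
  qed
  then show ?thesis using False by simp
qed

lemma norm_p2n: "norm p2n \<le> 8 * real N"
proof -
  have "norm (p2 - (p1 + v)) \<le> 8 * q"
    using near_or_far by (auto simp: dist_norm norm_minus_commute)
  then have "norm (p2 - (p1 + v)) / h \<le> 8 * q / h" using h_pos by (simp add: divide_right_mono)
  also have "\<dots> = 8 * real N" using q_div_h by simp
  finally show ?thesis using h_pos by (simp add: p2n_def divide_inverse_commute)
qed

lemma disk_in_cluster:
  assumes "d \<in> D"
  shows "dist (fst d) p1 \<le> dist (fst d) p2 \<Longrightarrow> disk d \<subseteq> cball p1 q"
    "\<not> dist (fst d) p1 \<le> dist (fst d) p2 \<Longrightarrow> disk d \<subseteq> cball p2 q"
  using rad[OF assms] by (auto simp: disk_def cball_subset_cball_iff min_def split: if_splits)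

lemma mem_disk_nd: "y \<in> disk (nd d) \<longleftrightarrow> base (fst d) + h *\<^sub>R y \<in> disk d"
  unfolding disk_def nd_def fst_conv snd_conv by (rule mem_cball_affine[OF h_pos])

lemma nd_cluster:
  assumes "d \<in> D"
  shows "dist (fst d) p1 \<le> dist (fst d) p2 \<Longrightarrow> disk (nd d) \<subseteq> cball 0 N"
    "\<not> dist (fst d) p1 \<le> dist (fst d) p2 \<Longrightarrow> disk (nd d) \<subseteq> cball p2n N"
proof -
  assume n: "dist (fst d) p1 \<le> dist (fst d) p2"
  show "disk (nd d) \<subseteq> cball 0 N"
  proof
    fix y assume "y \<in> disk (nd d)"
    then have "p1 + h *\<^sub>R y \<in> cball p1 q"
      using disk_in_cluster(1)[OF assms n] n unfolding mem_disk_nd base_def by auto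
    then have "y \<in> cball ((p1 - p1) /\<^sub>R h) (q / h)" using mem_cball_affine[OF h_pos] by blast
    then show "y \<in> cball 0 N" by (simp add: q_div_h)
  qed
next
  assume n: "\<not> dist (fst d) p1 \<le> dist (fst d) p2"
  show "disk (nd d) \<subseteq> cball p2n N"
  proof
    fix y assume "y \<in> disk (nd d)"
    then have "p1 + v + h *\<^sub>R y \<in> cball p2 q"
      using disk_in_cluster(2)[OF assms n] n unfolding mem_disk_nd base_def by auto
    then have "y \<in> cball ((p2 - (p1 + v)) /\<^sub>R h) (q / h)" using mem_cball_affine[OF h_pos] by blast
    then show "y \<in> cball p2n N" by (simp add: q_div_h p2n_def)
  qed
qed

lemma nd_cover: "\<Union> (disk ` nd ` D) \<subseteq> cball 0 N \<union> cball p2n N"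
  using nd_cluster by blast

lemma nd_range:
  assumes "d \<in> nd ` D"
  shows "0 < snd d" "snd d \<le> real N" "norm (fst d) + snd d \<le> 9 * real N"
proof -
  obtain e where e: "e \<in> D" "d = nd e" using assms by auto
  show R0: "0 < snd d" using rad[OF e(1)] h_pos by (simp add: e nd_def)
  have "disk d \<subseteq> cball 0 N \<or> disk d \<subseteq> cball p2n N" using nd_cluster[OF e(1)] e(2) by blast
  then have "norm (fst d) + snd d \<le> N \<or> dist (fst d) p2n + snd d \<le> N"
    using R0 by (auto simp: cball_subset_cball_iff disk_def)
  moreover have "norm (fst d) \<le> dist (fst d) p2n + 8 * N"
    using norm_p2n norm_triangle_sub[of "fst d" p2n] by (simp add: dist_norm)
  ultimately show "norm (fst d) + snd d \<le> 9 * real N" "snd d \<le> real N"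
    using zero_le_dist[of "fst d" p2n] norm_ge_zero[of "fst d"] by linarith+
qed

definition "U1 = \<Union> (disk ` {d\<in>D. dist (fst d) p1 \<le> dist (fst d) p2})"
definition "U2 = \<Union> (disk ` {d\<in>D. \<not> dist (fst d) p1 \<le> dist (fst d) p2})"

lemma union_split: "\<Union> (disk ` D) = U1 \<union> U2"
  unfolding U1_def U2_def by blast

lemma nd_union: "\<Union> (disk ` nd ` D) = {y. p1 + h *\<^sub>R y \<in> U1} \<union> {y. p1 + v + h *\<^sub>R y \<in> U2}"
proof -
  have e1: "y \<in> \<Union> (disk ` nd ` D) \<longleftrightarrow> (\<exists>d\<in>D. base (fst d) + h *\<^sub>R y \<in> disk d)" for y
    by (simp add: mem_disk_nd)
  have e2: "(\<exists>d\<in>D. base (fst d) + h *\<^sub>R y \<in> disk d) \<longleftrightarrow> p1 + h *\<^sub>R y \<in> U1 \<or> p1 + v + h *\<^sub>R y \<in> U2" for y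
  proof
    assume "\<exists>d\<in>D. base (fst d) + h *\<^sub>R y \<in> disk d"
    then obtain d where d: "d \<in> D" "base (fst d) + h *\<^sub>R y \<in> disk d" by blast
    show "p1 + h *\<^sub>R y \<in> U1 \<or> p1 + v + h *\<^sub>R y \<in> U2"
    proof (cases "dist (fst d) p1 \<le> dist (fst d) p2")
      case True
      then have "p1 + h *\<^sub>R y \<in> disk d" using d(2) by (simp add: base_def)
      then show ?thesis using d(1) True unfolding U1_def by blast
    next
      case False
      then have "p1 + v + h *\<^sub>R y \<in> disk d" using d(2) by (simp add: base_def)
      then show ?thesis using d(1) False unfolding U2_def by blast
    qed
  next
    assume "p1 + h *\<^sub>R y \<in> U1 \<or> p1 + v + h *\<^sub>R y \<in> U2"
    then consider d where "d \<in> D" "dist (fst d) p1 \<le> dist (fst d) p2" "p1 + h *\<^sub>R y \<in> disk d"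
      | d where "d \<in> D" "\<not> dist (fst d) p1 \<le> dist (fst d) p2" "p1 + v + h *\<^sub>R y \<in> disk d"
      unfolding U1_def U2_def by blast
    then show "\<exists>d\<in>D. base (fst d) + h *\<^sub>R y \<in> disk d"
    proof cases
      case (1 d)
      then show ?thesis by (intro bexI[of _ d]) (simp_all add: base_def)
    next
      case (2 d)
      then show ?thesis by (intro bexI[of _ d]) (simp_all add: base_def)
    qed
  qed
  show ?thesis by (rule set_eqI) (simp only: e1 e2 Un_iff mem_Collect_eq)
qed

lemma U_cluster: "U1 \<subseteq> cball p1 q" "U2 \<subseteq> cball p2 q"
  unfolding U1_def U2_def using disk_in_cluster by blast+

lemma U1_ne: "p1 \<in> U1"
proof -
  obtain d where d: "d \<in> D" "fst d = p1" using p1 by blast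
  then have "p1 \<in> disk d" using rad[OF d(1)] by (simp add: disk_def)
  moreover have "dist (fst d) p1 \<le> dist (fst d) p2" using d by simp
  ultimately show ?thesis using d unfolding U1_def by blast
qed

lemma U2_ne: "dist p1 p2 > 8 * q \<Longrightarrow> p2 \<in> U2"
proof -
  assume far: "dist p1 p2 > 8 * q"
  obtain d where d: "d \<in> D" "fst d = p2" using p2 by blast
  then have "p2 \<in> disk d" using rad[OF d(1)] by (simp add: disk_def)
  moreover have "\<not> dist p2 p1 \<le> dist p2 p2" using far q by (auto simp: dist_commute)
  ultimately show ?thesis using d unfolding U2_def by blast
qed

text \<open>If the clusters are far apart, each covering disk of radius at most \<open>q\<close>
  serves one of them, so each disk can be translated with its cluster. Otherwise
  \<open>v = 0\<close> and a common affine map does it.\<close>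

lemma normalized_cover:
  assumes cov: "\<Union> (disk ` D) \<subseteq> cball c1 \<rho> \<union> cball c2 \<rho>" and rho: "\<rho> \<le> q"
  shows "\<exists>e1 e2. \<Union> (disk ` nd ` D) \<subseteq> cball e1 (\<rho> / h) \<union> cball e2 (\<rho> / h)"
proof -
  have m: "w + h *\<^sub>R y \<in> cball c \<rho> \<Longrightarrow> y \<in> cball ((c - w) /\<^sub>R h) (\<rho> / h)" for w y c :: point
    using mem_cball_affine[OF h_pos] by blast
  consider "v = 0" | "dist p1 p2 > 8 * q" using near_or_far by blast
  then show ?thesis
  proof cases
    case 1
    have "\<Union> (disk ` nd ` D) \<subseteq> cball ((c1 - p1) /\<^sub>R h) (\<rho> / h) \<union> cball ((c2 - p1) /\<^sub>R h) (\<rho> / h)"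
      unfolding nd_union 1 add_0_right using cov m unfolding union_split by blast
    then show ?thesis by blast
  next
    case 2
    have "U1 \<subseteq> cball c1 \<rho> \<and> U2 \<subseteq> cball c2 \<rho> \<or> U1 \<subseteq> cball c2 \<rho> \<and> U2 \<subseteq> cball c1 \<rho>"
      using far_clusters_separated[OF U_cluster _ _ less_imp_le[OF 2] q, of \<rho> c1 c2] U1_ne U2_ne[OF 2] q rho
        cov[unfolded union_split] by force
    then obtain a b where ab: "U1 \<subseteq> cball a \<rho>" "U2 \<subseteq> cball b \<rho>" by blast
    have "\<Union> (disk ` nd ` D) \<subseteq> cball ((a - p1) /\<^sub>R h) (\<rho> / h) \<union> cball ((b - (p1 + v)) /\<^sub>R h) (\<rho> / h)"
      unfolding nd_union using ab m by blast
    then show ?thesis by blast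
  qed
qed

text \<open>The bound \<open>r \<le> 2 * real N\<close> is the \<open>2 * q\<close> of the
  separation argument in normalised units. That argument assigns each disk to the cluster with the
  nearer anchor, which is exactly the test made by \<open>unshift\<close>.\<close>

lemma original_cover:
  assumes cov: "\<Union> (disk ` nd ` D) \<subseteq> cball e1 r \<union> cball e2 r" and r: "r \<le> 2 * real N"
  shows "\<Union> (disk ` D) \<subseteq> cball (unshift e1) (r * h) \<union> cball (unshift e2) (r * h)"
proof -
  have m: "x \<in> cball (w + h *\<^sub>R e) (r * h)" if "(x - w) /\<^sub>R h \<in> cball e r" for w x e :: point
    using mem_cball_affine[OF h_pos, of "(x - w) /\<^sub>R h" "w + h *\<^sub>R e" w "r * h"] h_pos that by simp
  define V1 where "V1 = {y. p1 + h *\<^sub>R y \<in> U1}"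
  define V2 where "V2 = {y. p1 + v + h *\<^sub>R y \<in> U2}"
  have V: "x \<in> U1 \<Longrightarrow> (x - p1) /\<^sub>R h \<in> V1" "x \<in> U2 \<Longrightarrow> (x - (p1 + v)) /\<^sub>R h \<in> V2" for x
    using h_pos by (auto simp: V1_def V2_def)
  have cov': "V1 \<union> V2 \<subseteq> cball e1 r \<union> cball e2 r" using cov unfolding nd_union V1_def V2_def .
  consider "v = 0" | "dist p1 p2 > 8 * q" "norm (p2 - (p1 + v)) = 8 * q" using near_or_far by blast
  then show ?thesis
  proof cases
    case 1
    have "unshift e = p1 + h *\<^sub>R e" for e by (simp add: unshift_def 1)
    moreover have "x \<in> U1 \<union> U2 \<Longrightarrow> (x - p1) /\<^sub>R h \<in> cball e1 r \<union> cball e2 r" for x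
      using V cov' unfolding 1 add_0_right by blast
    ultimately have "x \<in> U1 \<union> U2 \<Longrightarrow> x \<in> cball (unshift e1) (r * h) \<union> cball (unshift e2) (r * h)" for x
      using m[of x p1 e1] m[of x p1 e2] unfolding Un_iff by metis
    then show ?thesis unfolding union_split by (rule subsetI)
  next
    case 2
    have V1: "V1 \<subseteq> cball 0 N"
      using U_cluster(1) mem_cball_affine[OF h_pos, of _ p1 p1 q] unfolding V1_def q_div_h by auto
    have V2: "V2 \<subseteq> cball p2n N"
      using U_cluster(2) mem_cball_affine[OF h_pos, of _ p2 "p1 + v" q]
      unfolding V2_def q_div_h p2n_def by blast
    have ne: "V1 \<noteq> {}" "V2 \<noteq> {}" using V(1)[OF U1_ne] V(2)[OF U2_ne[OF 2(1)]] by auto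
    have "dist 0 p2n = 8 * (q / h)" using 2(2) h_pos by (simp add: p2n_def divide_inverse_commute)
    then have "dist 0 p2n \<ge> 8 * real N" by (simp add: q_div_h)
    from far_clusters_separated[OF V1 V2 ne this _ r cov'] N
    consider "dist e1 0 < dist e1 p2n" "dist e2 p2n < dist e2 0" "V1 \<subseteq> cball e1 r" "V2 \<subseteq> cball e2 r"
      | "dist e2 0 < dist e2 p2n" "dist e1 p2n < dist e1 0" "V1 \<subseteq> cball e2 r" "V2 \<subseteq> cball e1 r"
      by auto
    then show ?thesis
    proof cases
      case 1
      then have "unshift e1 = p1 + h *\<^sub>R e1" "unshift e2 = p1 + v + h *\<^sub>R e2" by (auto simp: unshift_def)
      then have "x \<in> U1 \<Longrightarrow> x \<in> cball (unshift e1) (r * h)" "x \<in> U2 \<Longrightarrow> x \<in> cball (unshift e2) (r * h)" for x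
        using m[OF subsetD[OF 1(3) V(1)]] m[OF subsetD[OF 1(4) V(2)]] by simp_all
      then show ?thesis unfolding union_split by blast
    next
      case 2
      then have "unshift e2 = p1 + h *\<^sub>R e2" "unshift e1 = p1 + v + h *\<^sub>R e1" by (auto simp: unshift_def)
      then have "x \<in> U1 \<Longrightarrow> x \<in> cball (unshift e2) (r * h)" "x \<in> U2 \<Longrightarrow> x \<in> cball (unshift e1) (r * h)" for x
        using m[OF subsetD[OF 2(3) V(1)]] m[OF subsetD[OF 2(4) V(2)]] by simp_all
      then show ?thesis unfolding union_split by blast
    qed
  qed
qed

end

section \<open>The program\<close>

notation Seq (infixr ";;" 61)
declare [[coercion Var]]
abbreviation exp_plus (infixl "[+]" 65) where "a [+] b \<equiv> Bin OAdd a b"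
abbreviation exp_minus (infixl "[-]" 65) where "a [-] b \<equiv> Bin OSub a b"
abbreviation exp_times (infixl "[*]" 70) where "a [*] b \<equiv> Bin OMul a b"
abbreviation exp_div (infixl "['/]" 70) where "a [/] b \<equiv> Bin ODiv a b"

abbreviation (input) "v_x1 \<equiv> 0 :: nat"
abbreviation (input) "v_y1 \<equiv> 1 :: nat"
abbreviation (input) "v_x2 \<equiv> 2 :: nat"
abbreviation (input) "v_y2 \<equiv> 3 :: nat"
abbreviation (input) "v_out \<equiv> 4 :: nat"
abbreviation (input) "v_n \<equiv> 5 :: nat"
abbreviation (input) "v_eps \<equiv> 6 :: nat"
abbreviation (input) "v_p1x \<equiv> 7 :: nat"
abbreviation (input) "v_p1y \<equiv> 8 :: nat"
abbreviation (input) "v_p2x \<equiv> 9 :: nat"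
abbreviation (input) "v_p2y \<equiv> 10 :: nat"
abbreviation (input) "v_far \<equiv> 11 :: nat"
abbreviation (input) "v_q \<equiv> 12 :: nat"
abbreviation (input) "v_N \<equiv> 13 :: nat"
abbreviation (input) "v_M \<equiv> 14 :: nat"
abbreviation (input) "v_B \<equiv> 15 :: nat"
abbreviation (input) "v_K \<equiv> 16 :: nat"
abbreviation (input) "v_T \<equiv> 17 :: nat"
abbreviation (input) "v_h \<equiv> 18 :: nat"
abbreviation (input) "v_vx \<equiv> 19 :: nat"
abbreviation (input) "v_vy \<equiv> 20 :: nat"
abbreviation (input) "v_f \<equiv> 21 :: nat"
abbreviation (input) "v_ib \<equiv> 22 :: nat"
abbreviation (input) "v_rb \<equiv> 23 :: nat"
abbreviation (input) "v_mb \<equiv> 24 :: nat"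
abbreviation (input) "v_lb \<equiv> 25 :: nat"
abbreviation (input) "v_hb \<equiv> 26 :: nat"
abbreviation (input) "v_x \<equiv> 27 :: nat"
abbreviation (input) "v_y \<equiv> 28 :: nat"
abbreviation (input) "v_r \<equiv> 29 :: nat"
abbreviation (input) "v_d1 \<equiv> 30 :: nat"
abbreviation (input) "v_d2 \<equiv> 31 :: nat"
abbreviation (input) "v_d \<equiv> 32 :: nat"
abbreviation (input) "v_i \<equiv> 33 :: nat"
abbreviation (input) "v_j \<equiv> 34 :: nat"
abbreviation (input) "v_k \<equiv> 35 :: nat"
abbreviation (input) "v_ux \<equiv> 36 :: nat"
abbreviation (input) "v_uy \<equiv> 37 :: nat"
abbreviation (input) "v_it \<equiv> 38 :: nat"
abbreviation (input) "v_kk \<equiv> 39 :: nat"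
abbreviation (input) "v_jj \<equiv> 40 :: nat"
abbreviation (input) "v_a \<equiv> 41 :: nat"
abbreviation (input) "v_b \<equiv> 42 :: nat"
abbreviation (input) "v_L \<equiv> 43 :: nat"
abbreviation (input) "v_H \<equiv> 44 :: nat"
abbreviation (input) "v_s \<equiv> 45 :: nat"
abbreviation (input) "v_mL \<equiv> 46 :: nat"
abbreviation (input) "v_aL \<equiv> 47 :: nat"
abbreviation (input) "v_bL \<equiv> 48 :: nat"
abbreviation (input) "v_mR \<equiv> 49 :: nat"
abbreviation (input) "v_aR \<equiv> 50 :: nat"
abbreviation (input) "v_bR \<equiv> 51 :: nat"
abbreviation (input) "v_al \<equiv> 52 :: nat"
abbreviation (input) "v_ii \<equiv> 53 :: nat"
abbreviation (input) "v_n3 \<equiv> 54 :: nat"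
abbreviation (input) "v_p2nx \<equiv> 55 :: nat"
abbreviation (input) "v_p2ny \<equiv> 56 :: nat"

text \<open>The language has no empty command, so a scratch register is assigned; this is why 63
  appears among the written registers.\<close>

definition skip :: com where "skip = Asg 63 (Cst 0)"

text \<open>Input number \<open>v_d\<close> started in cell \<open>v_d + 2\<close>. From cell 80 on
  it is still there, at heap address \<open>v_d - 78\<close>; otherwise it was saved in cell
  \<open>128 * n + v_d + 1\<close>, which is heap address \<open>128 * n + v_d - 79\<close>.\<close>

definition copy_cell :: com where "copy_cell =
  Ite (Cst 78) v_d (Asg v_x (Heap (v_d [-] Cst 78)))
    (Asg v_x (Heap (Cst 128 [*] v_n [+] v_d [-] Cst 79))) ;;
  Sto (v_ib [+] v_d) v_x"

definition copy_input :: com where "copy_input =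
  Asg v_n3 (Cst 3 [*] v_n) ;; Asg v_ib (Cst 256 [*] v_n) ;;
  For v_d v_n3 copy_cell"

definition load_disk :: com where "load_disk =
  Asg v_x (Heap (v_ib [+] Cst 3 [*] v_d)) ;;
  Asg v_y (Heap (v_ib [+] Cst 3 [*] v_d [+] Cst 1)) ;;
  Asg v_r (Heap (v_ib [+] Cst 3 [*] v_d [+] Cst 2))"

definition sqdist :: "nat \<Rightarrow> nat \<Rightarrow> nat \<Rightarrow> nat \<Rightarrow> exp" where
  "sqdist x y a b = (x [-] a) [*] (x [-] a) [+] (y [-] b) [*] (y [-] b)"

definition farthest_step :: com where "farthest_step =
  load_disk ;;
  Asg v_d1 (sqdist v_x v_y v_p1x v_p1y) ;;
  Ite v_d1 v_far skip (Asg v_far v_d1 ;; Asg v_p2x v_x ;; Asg v_p2y v_y)"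

definition find_farthest :: com where "find_farthest =
  Asg v_p1x (Heap v_ib) ;; Asg v_p1y (Heap (v_ib [+] Cst 1)) ;;
  Asg v_p2x v_p1x ;; Asg v_p2y v_p1y ;; Asg v_far (Cst 0) ;;
  For v_d v_n farthest_step"

definition radius_step :: com where "radius_step =
  load_disk ;;
  Asg v_d1 (Root (sqdist v_x v_y v_p1x v_p1y)) ;;
  Asg v_d2 (Root (sqdist v_x v_y v_p2x v_p2y)) ;;
  Ite v_d1 v_d2 skip (Asg v_d1 v_d2) ;;
  Asg v_d1 (v_d1 [+] v_r) ;;
  Ite v_d1 v_q skip (Asg v_q v_d1)"

definition find_radius :: com where "find_radius =
  Asg v_q (Cst 0) ;;
  For v_d v_n radius_step"

text \<open>\<open>v_M\<close> is the side of the grid, \<open>v_B\<close> the number of strips and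
  \<open>v_K\<close> the number of net directions. The number \<open>v_T\<close> of tests allows for
  \<open>N + 4\<close> decreases of the radius and \<open>2 * N + 1\<close> failures.\<close>

definition set_params :: com where "set_params =
  Asg v_N (Flr (Cst 1000 [/] v_eps) [+] Cst 1000) ;;
  Asg v_M (Cst 20 [*] v_N) ;; Asg v_B (Cst 40 [*] v_N) ;;
  Asg v_K (Cst 2 [*] v_N [+] Cst 1) ;; Asg v_T (Cst 3 [*] v_N [+] Cst 5)"

definition set_frame :: com where "set_frame =
  Asg v_h (v_q [/] v_N) ;;
  Asg v_f (Cst 1 [-] Cst 8 [*] v_q [/] Root v_far) ;;
  Ite v_f (Cst 0) (Asg v_f (Cst 0)) skip ;;
  Asg v_vx (v_f [*] (v_p2x [-] v_p1x)) ;;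
  Asg v_vy (v_f [*] (v_p2y [-] v_p1y)) ;;
  Asg v_p2nx ((v_p2x [-] (v_p1x [+] v_vx)) [/] v_h) ;;
  Asg v_p2ny ((v_p2y [-] (v_p1y [+] v_vy)) [/] v_h) ;;
  Asg v_rb (Cst 512 [*] v_n) ;;
  Asg v_mb (v_rb [+] v_M [*] v_M) ;;
  Asg v_lb (v_mb [+] v_M [*] v_M) ;;
  Asg v_hb (v_lb [+] v_B)"

text \<open>Row-major address, in the table starting at \<open>b\<close>, of the grid point to which
  \<open>(x, y)\<close> is rounded; the shift by \<open>10 * N\<close> makes row and column
  nonnegative.\<close>

definition cell :: "nat \<Rightarrow> exp \<Rightarrow> exp \<Rightarrow> exp" where
  "cell b x y = b [+] (Flr x [+] Cst 10 [*] v_N) [*] v_M [+] (Flr y [+] Cst 10 [*] v_N)"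

definition snap_disk :: com where "snap_disk =
  load_disk ;;
  Asg v_d1 (sqdist v_x v_y v_p1x v_p1y) ;;
  Asg v_d2 (sqdist v_x v_y v_p2x v_p2y) ;;
  Asg v_x (v_x [-] v_p1x) ;; Asg v_y (v_y [-] v_p1y) ;;
  Ite v_d1 v_d2 skip (Asg v_x (v_x [-] v_vx) ;; Asg v_y (v_y [-] v_vy)) ;;
  Asg v_a (cell v_rb (v_x [/] v_h) (v_y [/] v_h)) ;;
  Asg v_r (v_r [/] v_h) ;;
  Ite v_r (Heap v_a) skip (Sto v_a v_r)"

definition snap_disks :: com where "snap_disks =
  For v_d v_n snap_disk"

text \<open>The root of a square stands in for the absolute value in \<open>dir_vec\<close>.\<close>

definition set_dir :: "nat \<Rightarrow> com" where "set_dir k =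
  Asg v_ux (k [-] v_N) ;;
  Asg v_uy (v_N [-] Root (v_ux [*] v_ux)) ;;
  Asg v_s (Root (v_ux [*] v_ux [+] v_uy [*] v_uy)) ;;
  Asg v_ux (v_ux [/] v_s) ;; Asg v_uy (v_uy [/] v_s)"

definition gx :: exp where "gx = v_i [-] Cst 10 [*] v_N"
definition gy :: exp where "gy = v_j [-] Cst 10 [*] v_N"

definition mark_dir :: com where "mark_dir =
  set_dir v_k ;;
  Sto (cell v_mb (gx [+] v_r [*] v_ux) (gy [+] v_r [*] v_uy)) (Cst 1) ;;
  Sto (cell v_mb (gx [-] v_r [*] v_ux) (gy [-] v_r [*] v_uy)) (Cst 1)"

definition mark_dirs :: com where "mark_dirs =
  For v_k v_K mark_dir"

definition mark_cell :: com where "mark_cell =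
  Asg v_r (Heap (v_rb [+] v_i [*] v_M [+] v_j)) ;;
  Ite v_r (Cst 0) skip mark_dirs"

definition mark_samples :: com where "mark_samples =
  For v_i v_M (For v_j v_M mark_cell)"

definition clear_bin :: com where "clear_bin =
  Sto (v_lb [+] v_ii) (Cst 100 [*] v_N) ;;
  Sto (v_hb [+] v_ii) (Cst (- 100) [*] v_N)"

definition clear_bins :: com where "clear_bins =
  For v_ii v_B clear_bin"

definition bin_cell :: com where "bin_cell =
  Ite (Heap (v_mb [+] v_i [*] v_M [+] v_j)) (Cst 0) skip (
  Asg v_x gx ;; Asg v_y gy ;;
  Asg v_a (Flr (v_x [*] v_ux [+] v_y [*] v_uy) [+] Cst 20 [*] v_N) ;;
  Asg v_b (v_y [*] v_ux [-] v_x [*] v_uy) ;;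
  Ite (Heap (v_lb [+] v_a)) v_b skip (Sto (v_lb [+] v_a) v_b) ;;
  Ite v_b (Heap (v_hb [+] v_a)) skip (Sto (v_hb [+] v_a) v_b))"

definition fill_bins :: com where "fill_bins =
  For v_i v_M (For v_j v_M bin_cell)"

text \<open>\<open>v_L\<close> and \<open>v_H\<close> delimit the ordinates at which a centre of
  abscissa \<open>v_al\<close> serves all strips read so far. The interval only shrinks, so once
  empty it stays empty, and reading on to the last strip does no harm. The expression
  \<open>e\<close> fixes the reading order.\<close>

definition scan_step :: "nat \<Rightarrow> nat \<Rightarrow> nat \<Rightarrow> exp \<Rightarrow> com" where "scan_step m a b e =
  Asg v_s (Root (v_r [*] v_r [-] (v_ii [-] v_al) [*] (v_ii [-] v_al))) ;;
  Asg v_b (Heap (v_hb [+] e) [-] v_s) ;;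
  Ite v_b v_L skip (Asg v_L v_b) ;;
  Asg v_b (Heap (v_lb [+] e) [+] v_s) ;;
  Ite v_H v_b skip (Asg v_H v_b) ;;
  Ite v_L v_H
    (Ite (v_ii [+] Cst 1) m skip
      (Asg m (v_ii [+] Cst 1) ;; Asg a v_al ;; Asg b v_L))
    skip"

definition scan_column :: "nat \<Rightarrow> nat \<Rightarrow> nat \<Rightarrow> exp \<Rightarrow> com" where "scan_column m a b e =
  Asg v_L (Cst (- 100) [*] v_N) ;; Asg v_H (Cst 100 [*] v_N) ;; For v_ii v_B (scan_step m a b e)"

definition scan :: "nat \<Rightarrow> nat \<Rightarrow> nat \<Rightarrow> exp \<Rightarrow> com" where "scan m a b e =
  Asg m (Cst 0) ;; Asg a (Cst 0) ;; Asg b (Cst 0) ;;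
  For v_al v_B (scan_column m a b e)"

text \<open>The two \<open>unrot\<close> terms of \<open>prefix_suffix_sound\<close>, written
  out.\<close>

definition save_centres :: com where "save_centres =
  Asg v_a (v_aL [-] Cst 20 [*] v_N) ;;
  Asg v_x1 (v_a [*] v_ux [-] v_bL [*] v_uy) ;;
  Asg v_y1 (v_a [*] v_uy [+] v_bL [*] v_ux) ;;
  Asg v_a (Cst 20 [*] v_N [-] Cst 1 [-] v_aR) ;;
  Asg v_x2 (v_a [*] v_ux [-] v_bR [*] v_uy) ;;
  Asg v_y2 (v_a [*] v_uy [+] v_bR [*] v_ux)"

text \<open>The guard \<open>1 \<le> jj\<close> keeps the tested radius \<open>jj - 1\<close> nonnegative; the scans only see its square.\<close>
definition try_direction :: com where "try_direction =
  set_dir v_kk ;; clear_bins ;; fill_bins ;;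
  Asg v_r (v_jj [-] Cst 1) ;;
  scan v_mL v_aL v_bL v_ii ;; scan v_mR v_aR v_bR (v_B [-] Cst 1 [-] v_ii) ;;
  Ite v_B (v_mL [+] v_mR)
    (Ite (Cst 1) v_jj (Asg v_jj (v_jj [-] Cst 1) ;; save_centres) (Asg v_kk (v_kk [+] Cst 1)))
    (Asg v_kk (v_kk [+] Cst 1))"

text \<open>The anchors of the clusters already cover all samples with radius \<open>N + 4\<close>,
  so the search starts from a valid pair of centres.\<close>

definition search :: com where "search =
  Asg v_kk (Cst 0) ;; Asg v_jj (v_N [+] Cst 4) ;;
  Asg v_x1 (Cst 0) ;; Asg v_y1 (Cst 0) ;; Asg v_x2 v_p2nx ;; Asg v_y2 v_p2ny ;;
  For v_it v_T try_direction"

definition unshift_centre :: "nat \<Rightarrow> nat \<Rightarrow> com" where "unshift_centre x y =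
  Asg v_d1 (x [*] x [+] y [*] y) ;;
  Asg v_d2 (sqdist x y v_p2nx v_p2ny) ;;
  Asg x (v_p1x [+] v_h [*] x) ;; Asg y (v_p1y [+] v_h [*] y) ;;
  Ite v_d1 v_d2 skip (Asg x (x [+] v_vx) ;; Asg y (y [+] v_vy))"

text \<open>The stored centres cover the samples with radius \<open>v_jj + 1\<close>; 12 more units
  cover the disks.\<close>

definition write_output :: com where "write_output =
  unshift_centre v_x1 v_y1 ;; unshift_centre v_x2 v_y2 ;;
  Asg v_out ((v_jj [+] Cst 13) [*] v_h)"

definition prepare :: com where "prepare = copy_input ;; find_farthest ;; find_radius ;; set_params"
definition solve :: com where "solve = set_frame ;; snap_disks ;; mark_samples ;; search ;; write_output"

lemmas step_defs = skip_def copy_cell_def load_disk_def sqdist_def farthest_step_def radius_step_def cell_def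
  snap_disk_def set_dir_def gx_def gy_def mark_dir_def mark_cell_def clear_bin_def bin_cell_def scan_step_def
  scan_column_def

lemmas prog_defs = step_defs copy_input_def find_farthest_def find_radius_def
  set_params_def set_frame_def snap_disks_def mark_dirs_def
  mark_samples_def clear_bins_def fill_bins_def scan_def save_centres_def try_direction_def
  search_def unshift_centre_def write_output_def prepare_def solve_def

lemma wf_prog: "wfc (prepare ;; solve)"
  unfolding prog_defs by (simp add: wfe_def tmp_def)

lemma addrI: "x = real n \<Longrightarrow> addr x = n" by simp

text \<open>All sources lie below heap address \<open>256 * n\<close>, where the copy begins, so
  nothing is overwritten before it is read. The copy ends below \<open>512 * n\<close>; the tables
  placed from there on start out as zero.\<close>

lemma copy_input_spec:
  assumes n: "fst st v_n = real n" "n \<ge> 1"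
    and src: "\<And>a. a < 3 * n \<Longrightarrow> snd st (if 78 \<le> a then a - 78 else 128 * n + a - 79) = w a"
    and zero: "\<And>a. 128 * n \<le> a \<Longrightarrow> snd st a = 0"
  shows "let t = exec copy_input st in fst t v_ib = 256 * real n \<and>
    (\<forall>a<3 * n. snd t (256 * n + a) = w a) \<and> (\<forall>a\<ge>512 * n. snd t a = 0)"
proof -
  obtain s h where st: "st = (s, h)" by (cases st)
  define s1 where "s1 = s(v_n3 := 3 * real n, v_ib := 256 * real n)"
  define I where "I k t \<longleftrightarrow> (\<forall>a<k. snd t (256 * n + a) = w a) \<and> (\<forall>a. a < 256 * n \<or> 256 * n + k \<le> a \<longrightarrow> snd t a = h a)"
    for k and t :: state
  have "I (3 * n) (exec (For v_d v_n3 copy_cell) (s1, h))"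
  proof (rule exec_For_invariant)
    show "fst (s1, h) v_n3 = real (3 * n)" by (simp add: s1_def)
    show "I 0 ((fst (s1, h))(v_d := 0), snd (s1, h))" by (simp add: I_def)
  next
    fix k s' h'
    assume k: "k < 3 * n" "s' v_d = real k" and fr: "\<And>x. x \<notin> insert v_d (writes copy_cell) \<Longrightarrow> s' x = fst (s1, h) x"
      and I: "I k (s', h')"
    have v: "s' v_n = real n" "s' v_ib = 256 * real n"
      using fr[of v_n] fr[of v_ib] n by (simp_all add: copy_cell_def s1_def st)
    have a1: "addr (256 * real n + real k) = 256 * n + k" by (rule addrI) simp
    have a2: "addr (real k - 78) = k - 78" if "78 \<le> k" using that by (intro addrI) (simp add: of_nat_diff)
    have a3: "addr (128 * real n + real k - 79) = 128 * n + k - 79"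
      using n(2) by (intro addrI) (simp add: of_nat_diff)
    have src': "h' (if 78 \<le> k then k - 78 else 128 * n + k - 79) = w k"
    proof -
      have "(if 78 \<le> k then k - 78 else 128 * n + k - 79) < 256 * n" using k(1) by (simp; linarith)
      then show ?thesis using I src[OF k(1)] by (simp add: I_def st)
    qed
    have "exec copy_cell (s', h') = (s'(v_x := w k), h'(256 * n + k := w k))"
      using src' k by (auto simp: copy_cell_def v a1 a2 a3 split: if_splits)
    then show "I (Suc k) (next_iter v_d (exec copy_cell (s', h')))"
      using I by (auto simp: I_def next_iter_def less_Suc_eq)
  qed (simp_all add: copy_cell_def)
  moreover have "exec copy_input st = exec (For v_d v_n3 copy_cell) (s1, h)"
    using n by (simp add: copy_input_def copy_cell_def s1_def st)
  moreover have "fst (exec (For v_d v_n3 copy_cell) (s1, h)) v_ib = 256 * real n"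
    by (subst exec_frame) (auto simp: copy_cell_def s1_def)
  ultimately show ?thesis using zero n(2) by (auto simp: I_def Let_def st)
qed

section \<open>Correctness of the program\<close>

definition input_at :: "disk_rep list \<Rightarrow> state \<Rightarrow> bool" where
  "input_at ds t \<longleftrightarrow> fst t v_n = real (length ds) \<and> fst t v_ib = 256 * real (length ds) \<and>
    (\<forall>k<length ds. snd t (256 * length ds + 3 * k) = fst (fst (ds ! k)) \<and>
       snd t (256 * length ds + 3 * k + 1) = snd (fst (ds ! k)) \<and>
       snd t (256 * length ds + 3 * k + 2) = snd (ds ! k))"

lemma exec_load_disk:
  assumes "input_at ds (s, h)" "k < length ds" "s v_d = real k"
  shows "exec load_disk (s, h) = (s(v_x := fst (fst (ds ! k)), v_y := snd (fst (ds ! k)), v_r := snd (ds ! k)), h)"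
proof -
  let ?n = "length ds"
  have "addr (256 * real ?n + 3 * real k) = 256 * ?n + 3 * k" by (rule addrI) simp
  moreover have "addr (256 * real ?n + 3 * real k + 1) = 256 * ?n + 3 * k + 1" by (rule addrI) simp
  moreover have "addr (256 * real ?n + 3 * real k + 2) = 256 * ?n + 3 * k + 2" by (rule addrI) simp
  ultimately show ?thesis using assms by (simp add: load_disk_def input_at_def)
qed

lemma input_at_frame:
  assumes "input_at ds (s, h)" "s' v_n = s v_n" "s' v_ib = s v_ib"
    "\<And>a. a < 512 * length ds \<Longrightarrow> h' a = h a"
  shows "input_at ds (s', h')"
  using assms by (auto simp: input_at_def)

lemma writes_load_disk: "writes load_disk = {v_x, v_y, v_r}"
  by (auto simp: load_disk_def)

lemma dist_prod: "dist p q = sqrt ((fst p - fst q) * (fst p - fst q) + (snd p - snd q) * (snd p - (snd q :: real)))"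
  for p q :: point
  by (simp add: dist_prod_def dist_real_def power2_eq_square)

lemma find_farthest_spec:
  assumes inp: "input_at ds st" and ne: "ds \<noteq> []"
  shows "let t = exec find_farthest st; p1 = (fst t v_p1x, fst t v_p1y); p2 = (fst t v_p2x, fst t v_p2y) in
    snd t = snd st \<and> p1 = fst (ds ! 0) \<and> p2 \<in> fst ` set ds \<and> fst t v_far = (dist p1 p2)\<^sup>2 \<and>
    (\<forall>d\<in>set ds. dist (fst d) p1 \<le> dist p2 p1)"
proof -
  obtain s h where st: "st = (s, h)" by (cases st)
  define p1 where "p1 = fst (ds ! 0)"
  have n0: "0 < length ds" using ne by simp
  define s1 where "s1 = s(v_p1x := fst p1, v_p1y := snd p1, v_p2x := fst p1, v_p2y := snd p1, v_far := 0)"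
  have ex: "exec find_farthest st = exec (For v_d v_n farthest_step) (s1, h)"
  proof -
    have a: "addr (256 * real (length ds)) = 256 * length ds + 3 * 0"
      "addr (256 * real (length ds) + 1) = 256 * length ds + 3 * 0 + 1" by (rule addrI, simp)+
    have "h (256 * length ds + 3 * 0) = fst p1" "h (256 * length ds + 3 * 0 + 1) = snd p1"
      "s v_ib = 256 * real (length ds)"
      using inp n0 unfolding input_at_def st p1_def fst_conv snd_conv by blast+
    then show ?thesis unfolding find_farthest_def farthest_step_def s1_def st exec.simps(3)
      by (simp add: a del: exec.simps(5))
  qed
  define I where "I k t \<longleftrightarrow> snd t = h \<and> (\<exists>d\<in>set ds. (fst t v_p2x, fst t v_p2y) = fst d) \<and>
     fst t v_far = (dist p1 (fst t v_p2x, fst t v_p2y))\<^sup>2 \<and>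
     (\<forall>d<k. (dist (fst (ds ! d)) p1)\<^sup>2 \<le> fst t v_far)" for k and t :: state
  have "I (length ds) (exec (For v_d v_n farthest_step) (s1, h))"
  proof (rule exec_For_invariant)
    show "fst (s1, h) v_n = real (length ds)" using inp by (simp add: s1_def input_at_def st)
    show "I 0 ((fst (s1, h))(v_d := 0), snd (s1, h))"
      using n0 by (auto simp: I_def s1_def p1_def intro!: bexI[of _ "ds ! 0"])
  next
    fix k s' h'
    assume k: "k < length ds" "s' v_d = real k" and fr: "\<And>x. x \<notin> insert v_d (writes farthest_step) \<Longrightarrow> s' x = fst (s1, h) x"
      and I: "I k (s', h')"
    have v: "s' v_n = s v_n" "s' v_ib = s v_ib" "s' v_p1x = fst p1" "s' v_p1y = snd p1"
      using fr[of v_n] fr[of v_ib] fr[of v_p1x] fr[of v_p1y]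
      by (simp_all add: farthest_step_def s1_def writes_load_disk skip_def)
    have h': "h' = h" using I by (simp add: I_def)
    have "input_at ds (s', h')" using inp v h' by (simp add: input_at_def st)
    note ld = exec_load_disk[OF this k, unfolded h']
    define e where "e = (dist (fst (ds ! k)) p1)\<^sup>2"
    have e: "(fst (fst (ds ! k)) - fst p1) * (fst (fst (ds ! k)) - fst p1) +
        (snd (fst (ds ! k)) - snd p1) * (snd (fst (ds ! k)) - snd p1) = e"
      by (simp add: e_def dist_prod)
    have e': "e = (dist p1 (fst (ds ! k)))\<^sup>2" by (simp add: e_def dist_commute)
    let ?t = "exec farthest_step (s', h')"
    have t: "snd ?t = h" "fst ?t v_far = (if e \<le> s' v_far then s' v_far else e)"
      "(fst ?t v_p2x, fst ?t v_p2y) = (if e \<le> s' v_far then (s' v_p2x, s' v_p2y) else fst (ds ! k))"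
      by (simp_all add: farthest_step_def h' ld skip_def sqdist_def v e)
    show "I (Suc k) (next_iter v_d ?t)"
    proof (cases "e \<le> s' v_far")
      case True
      then show ?thesis using I t by (auto simp: I_def next_iter_def less_Suc_eq e_def)
    next
      case False
      then have "\<forall>d<Suc k. (dist (fst (ds ! d)) p1)\<^sup>2 \<le> e"
        using I by (auto simp: I_def less_Suc_eq e_def)
      then show ?thesis using False t k(1) nth_mem[of k ds] e' by (auto simp: I_def next_iter_def)
    qed
  qed (simp_all add: farthest_step_def writes_load_disk skip_def)
  note res = this[folded ex]
  have p: "fst (exec find_farthest st) v_p1x = fst p1" "fst (exec find_farthest st) v_p1y = snd p1"
    unfolding ex by (subst exec_frame; simp add: farthest_step_def s1_def writes_load_disk skip_def)+
  have "dist (fst d) p1 \<le> dist (fst (exec find_farthest st) v_p2x, fst (exec find_farthest st) v_p2y) p1"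
    if "d \<in> set ds" for d
  proof -
    obtain k where "k < length ds" "d = ds ! k" using \<open>d \<in> set ds\<close> by (auto simp: in_set_conv_nth)
    then have "(dist (fst d) p1)\<^sup>2 \<le> (dist (fst (exec find_farthest st) v_p2x, fst (exec find_farthest st) v_p2y) p1)\<^sup>2"
      using res by (auto simp: I_def dist_commute)
    then show ?thesis by (rule power2_le_imp_le) simp
  qed
  then show ?thesis using res p by (auto simp: I_def Let_def st p1_def)
qed

lemma find_radius_spec:
  fixes st :: state
  defines "p1 \<equiv> (fst st v_p1x, fst st v_p1y)" and "p2 \<equiv> (fst st v_p2x, fst st v_p2y)"
  assumes inp: "input_at ds st" and ne: "ds \<noteq> []" and pos: "\<forall>d\<in>set ds. snd d > 0"
  shows "let t = exec find_radius st; q = fst t v_q in snd t = snd st \<and>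
    (\<forall>d\<in>set ds. min (dist (fst d) p1) (dist (fst d) p2) + snd d \<le> q) \<and>
    (\<exists>d\<in>set ds. q = min (dist (fst d) p1) (dist (fst d) p2) + snd d)"
proof -
  obtain s h where st: "st = (s, h)" by (cases st)
  define val where "val d = min (dist (fst d) p1) (dist (fst d) p2) + snd d" for d :: disk_rep
  have ex: "exec find_radius st = exec (For v_d v_n radius_step) (s(v_q := 0), h)"
    by (simp add: find_radius_def radius_step_def st)
  define I where "I k t \<longleftrightarrow> snd t = h \<and> (\<forall>d<k. val (ds ! d) \<le> fst t v_q) \<and>
     (fst t v_q = 0 \<or> (\<exists>d\<in>set ds. fst t v_q = val d))" for k and t :: state
  have "I (length ds) (exec (For v_d v_n radius_step) (s(v_q := 0), h))"
  proof (rule exec_For_invariant)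
    show "fst (s(v_q := 0), h) v_n = real (length ds)" using inp by (simp add: input_at_def st)
    show "I 0 ((fst (s(v_q := 0), h))(v_d := 0), snd (s(v_q := 0), h))" by (simp add: I_def)
  next
    fix k s' h'
    assume k: "k < length ds" "s' v_d = real k"
      and fr: "\<And>x. x \<notin> insert v_d (writes radius_step) \<Longrightarrow> s' x = fst (s(v_q := 0), h) x"
      and I: "I k (s', h')"
    have v: "s' v_n = s v_n" "s' v_ib = s v_ib" "s' v_p1x = fst p1" "s' v_p1y = snd p1"
      "s' v_p2x = fst p2" "s' v_p2y = snd p2"
      using fr[of v_n] fr[of v_ib] fr[of v_p1x] fr[of v_p1y] fr[of v_p2x] fr[of v_p2y]
      by (simp_all add: radius_step_def writes_load_disk skip_def p1_def p2_def st)
    have h': "h' = h" using I by (simp add: I_def)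
    have "input_at ds (s', h')" using inp v h' by (simp add: input_at_def st)
    note ld = exec_load_disk[OF this k, unfolded h']
    define e where "e = fst (ds ! k)"
    have vk: "val (ds ! k) = (if dist e p1 \<le> dist e p2 then dist e p1 else dist e p2) + snd (ds ! k)"
      by (simp add: val_def e_def min_def)
    have "fst (exec radius_step (s', h')) v_q = max (s' v_q) (val (ds ! k))" "snd (exec radius_step (s', h')) = h"
      by (simp_all add: radius_step_def ld skip_def sqdist_def v h' dist_prod[symmetric] e_def[symmetric] vk max_def)
    then show "I (Suc k) (next_iter v_d (exec radius_step (s', h')))"
      using I k by (auto simp: I_def next_iter_def less_Suc_eq max_def intro: order_trans)
  qed (simp_all add: radius_step_def writes_load_disk skip_def)
  note res = this[folded ex]
  have all: "val d \<le> fst (exec find_radius st) v_q" if "d \<in> set ds" for d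
  proof -
    obtain k where "k < length ds" "d = ds ! k" using \<open>d \<in> set ds\<close> by (auto simp: in_set_conv_nth)
    then show ?thesis using res by (auto simp: I_def)
  qed
  \<comment> \<open>The running maximum starts at 0, a value no disk has because radii are positive;
    so the final maximum is attained by a disk.\<close>
  have "0 < val (hd ds)" using pos ne by (simp add: val_def min_def add_nonneg_pos)
  then have "fst (exec find_radius st) v_q > 0" using all[of "hd ds"] ne by simp
  then show ?thesis using res all by (auto simp: I_def Let_def st val_def)
qed

section \<open>Tables indexed by grid points\<close>

definition on_grid :: "nat \<Rightarrow> point \<Rightarrow> bool" where
  "on_grid N g \<longleftrightarrow> snap g = g \<and> -10 * real N \<le> fst g \<and> fst g < 10 * real N \<and> -10 * real N \<le> snd g \<and> snd g < 10 * real N"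

definition gaddr :: "nat \<Rightarrow> nat \<Rightarrow> point \<Rightarrow> nat" where
  "gaddr N b g = b + nat (\<lfloor>fst g\<rfloor> + 10 * int N) * (20 * N) + nat (\<lfloor>snd g\<rfloor> + 10 * int N)"

definition gpt :: "nat \<Rightarrow> nat \<Rightarrow> nat \<Rightarrow> point" where
  "gpt N i j = (real i - 10 * real N, real j - 10 * real N)"

text \<open>Extending the table by 0 outside the grid makes it a function on all points, as
  \<open>radius_grid\<close> and \<open>samples\<close> expect.\<close>

definition gridval :: "nat \<Rightarrow> nat \<Rightarrow> (nat \<Rightarrow> real) \<Rightarrow> point \<Rightarrow> real" where
  "gridval N b h g = (if on_grid N g then h (gaddr N b g) else 0)"

lemma snap_idem [simp]: "snap (snap p) = snap p"
  by (simp add: snap_def)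

lemma on_grid_gpt: "i < 20 * N \<Longrightarrow> j < 20 * N \<Longrightarrow> on_grid N (gpt N i j)"
proof -
  have "\<lfloor>real i - 10 * real N\<rfloor> = int i - 10 * int N" for i by linarith
  then show "i < 20 * N \<Longrightarrow> j < 20 * N \<Longrightarrow> on_grid N (gpt N i j)"
    by (auto simp: on_grid_def gpt_def snap_def)
qed

lemma gaddr_gpt: "gaddr N b (gpt N i j) = b + i * (20 * N) + j"
proof -
  have "\<lfloor>real i - 10 * real N\<rfloor> = int i - 10 * int N" for i by linarith
  then show ?thesis by (simp add: gaddr_def gpt_def)
qed

lemma on_grid_obtain:
  assumes "on_grid N g"
  obtains i j where "i < 20 * N" "j < 20 * N" "g = gpt N i j"
proof -
  have fs: "fst g = of_int \<lfloor>fst g\<rfloor>" "snd g = of_int \<lfloor>snd g\<rfloor>"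
    using assms by (metis fst_conv on_grid_def snap_def, metis snd_conv on_grid_def snap_def)
  define i where "i = nat (\<lfloor>fst g\<rfloor> + 10 * int N)"
  define j where "j = nat (\<lfloor>snd g\<rfloor> + 10 * int N)"
  have b: "- 10 * int N \<le> \<lfloor>fst g\<rfloor>" "\<lfloor>fst g\<rfloor> < 10 * int N" "- 10 * int N \<le> \<lfloor>snd g\<rfloor>" "\<lfloor>snd g\<rfloor> < 10 * int N"
    using assms unfolding on_grid_def by linarith+
  have "real i = fst g + 10 * real N" "real j = snd g + 10 * real N"
    using b by (subst fs, simp add: i_def, subst fs, simp add: j_def)
  then have "g = gpt N i j" by (simp add: gpt_def)
  moreover have "i < 20 * N" "j < 20 * N" using b by (auto simp: i_def j_def)
  ultimately show thesis using that by blast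
qed

lemma gaddr_inj:
  assumes "on_grid N g" "on_grid N g'" "gaddr N b g = gaddr N b g'"
  shows "g = g'"
proof -
  obtain i j where g: "i < 20 * N" "j < 20 * N" "g = gpt N i j" using assms(1) by (rule on_grid_obtain)
  obtain i' j' where g': "i' < 20 * N" "j' < 20 * N" "g' = gpt N i' j'" using assms(2) by (rule on_grid_obtain)
  have e: "i * (20 * N) + j = i' * (20 * N) + j'" using assms(3) g g' by (simp add: gaddr_gpt)
  have "(i * (20 * N) + j) div (20 * N) = i" "(i' * (20 * N) + j') div (20 * N) = i'"
    using g g' by (auto simp: div_mult_self3)
  then have "i = i'" using e by simp
  then show ?thesis using e g g' by simp
qed

lemma gaddr_range:
  assumes "on_grid N g"
  shows "b \<le> gaddr N b g" "gaddr N b g < b + 400 * N * N"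
proof -
  obtain i j where g: "i < 20 * N" "j < 20 * N" "g = gpt N i j" using assms(1) by (rule on_grid_obtain)
  have "i * (20 * N) + j < i * (20 * N) + 20 * N" using g by simp
  also have "\<dots> = Suc i * (20 * N)" by simp
  also have "\<dots> \<le> (20 * N) * (20 * N)" using g(1) by (intro mult_le_mono1) simp
  finally show "b \<le> gaddr N b g" "gaddr N b g < b + 400 * N * N" using g by (simp_all add: gaddr_gpt)
qed

lemma gridval_update:
  assumes "on_grid N g"
  shows "gridval N b (h(gaddr N b g := x)) = (gridval N b h)(g := x)"
  using assms gaddr_inj[OF _ assms] by (auto simp: gridval_def fun_eq_iff)

lemma cell_addr:
  assumes "on_grid N (snap (x, y))"
  shows "addr (real b + (of_int \<lfloor>x\<rfloor> + 10 * real N) * (20 * real N) + (of_int \<lfloor>y\<rfloor> + 10 * real N)) = gaddr N b (snap (x, y))"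
proof -
  have "- 10 * int N \<le> \<lfloor>x\<rfloor>" "- 10 * int N \<le> \<lfloor>y\<rfloor>"
    using assms unfolding on_grid_def snap_def fst_conv snd_conv by linarith+
  then show ?thesis by (intro addrI) (simp add: gaddr_def snap_def)
qed

lemma on_grid_snap:
  assumes "norm p \<le> 9 * real N + 4" "N \<ge> 1000"
  shows "on_grid N (snap p)"
proof -
  have "\<bar>fst p\<bar> \<le> norm p" "\<bar>snd p\<bar> \<le> norm p"
    by (metis norm_fst_le prod.collapse real_norm_def, metis norm_snd_le prod.collapse real_norm_def)
  then have "\<bar>fst p\<bar> \<le> 9 * real N + 4" "\<bar>snd p\<bar> \<le> 9 * real N + 4" using assms by linarith+
  then show ?thesis using assms(2) by (simp add: on_grid_def) (simp add: snap_def; linarith)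
qed

lemma radius_grid_insert:
  assumes "radius_grid D G" "snd e > 0"
  shows "radius_grid (insert e D) (G(snap (fst e) := max (G (snap (fst e))) (snd e)))"
  unfolding radius_grid_def
proof (intro conjI ballI allI impI)
  let ?g = "snap (fst e)"
  fix d assume "d \<in> insert e D"
  then consider "d = e" | "snd d \<le> G (snap (fst d))" using assms(1) unfolding radius_grid_def by blast
  then show "snd d \<le> (G(?g := max (G ?g) (snd e))) (snap (fst d))"
    by cases (auto simp: max_def)
next
  let ?g = "snap (fst e)"
  fix g assume pos: "0 < (G(?g := max (G ?g) (snd e))) g"
  show "\<exists>d\<in>insert e D. snap (fst d) = g \<and> snd d = (G(?g := max (G ?g) (snd e))) g"
  proof (cases "g = ?g \<and> G ?g \<le> snd e")
    case True
    then show ?thesis by (intro bexI[of _ e]) (auto simp: max_def)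
  next
    case False
    then have eq: "(G(?g := max (G ?g) (snd e))) g = G g" by (auto simp: max_def)
    then have "0 < G g" using pos by simp
    then show ?thesis unfolding eq using assms(1) unfolding radius_grid_def by blast
  qed
qed

definition RB :: "nat \<Rightarrow> nat" where "RB n = 512 * n"
definition MB :: "nat \<Rightarrow> nat \<Rightarrow> nat" where "MB n N = RB n + 400 * N * N"
definition LB :: "nat \<Rightarrow> nat \<Rightarrow> nat" where "LB n N = MB n N + 400 * N * N"
definition HB :: "nat \<Rightarrow> nat \<Rightarrow> nat" where "HB n N = LB n N + 40 * N"

definition params :: "nat \<Rightarrow> nat \<Rightarrow> (nat \<Rightarrow> real) \<Rightarrow> bool" where
  "params n N s \<longleftrightarrow> s v_N = real N \<and> s v_M = 20 * real N \<and> s v_B = 40 * real N \<and>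
    s v_K = 2 * real N + 1 \<and> s v_T = 3 * real N + 5 \<and> s v_rb = real (RB n) \<and> s v_mb = real (MB n N) \<and>
    s v_lb = real (LB n N) \<and> s v_hb = real (HB n N)"

lemma params_cong:
  "(\<And>x. x \<in> {v_N, v_M, v_B, v_K, v_T, v_rb, v_mb, v_lb, v_hb} \<Longrightarrow> s' x = s x) \<Longrightarrow> params n N s \<Longrightarrow> params n N s'"
  by (simp add: params_def)

lemma snap_disks_spec:
  fixes st :: state
  defines "p1 \<equiv> (fst st v_p1x, fst st v_p1y)" and "p2 \<equiv> (fst st v_p2x, fst st v_p2y)"
  assumes inp: "input_at ds st" and par: "params (length ds) N (fst st)" and N: "N \<ge> 1000"
    and tc: "two_clusters (set ds) p1 p2 q N" and h: "fst st v_h = two_clusters.h q N"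
    and v: "(fst st v_vx, fst st v_vy) = two_clusters.v p1 p2 q"
    and zero: "\<And>a. RB (length ds) \<le> a \<Longrightarrow> snd st a = 0"
  shows "let t = exec snap_disks st in
    radius_grid (two_clusters.nd p1 p2 q N ` set ds) (gridval N (RB (length ds)) (snd t)) \<and>
    (\<forall>a. a < RB (length ds) \<or> MB (length ds) N \<le> a \<longrightarrow> snd t a = snd st a)"
proof -
  interpret C: two_clusters "set ds" p1 p2 q N by (rule tc)
  obtain s hp where st: "st = (s, hp)" by (cases st)
  define n where "n = length ds"
  have v1: "s v_vx = fst C.v" "s v_vy = snd C.v" using v[symmetric] by (simp_all add: st)
  define I where "I k t \<longleftrightarrow> radius_grid (C.nd ` set (take k ds)) (gridval N (RB n) (snd t)) \<and>
     (\<forall>a. a < RB n \<or> MB n N \<le> a \<longrightarrow> snd t a = hp a)" for k and t :: state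
  have "I n (exec (For v_d v_n snap_disk) (s, hp))"
  proof (rule exec_For_invariant)
    show "fst (s, hp) v_n = real n" using inp by (simp add: input_at_def st n_def)
    have "gridval N (RB n) hp g = 0" for g
      using zero gaddr_range(1)[of N g "RB n"] by (auto simp: gridval_def st n_def)
    then show "I 0 ((fst (s, hp))(v_d := 0), snd (s, hp))" by (simp add: I_def radius_grid_def)
  next
    fix k s' h'
    assume k: "k < n" "s' v_d = real k"
      and fr: "\<And>x. x \<notin> insert v_d (writes snap_disk) \<Longrightarrow> s' x = fst (s, hp) x" and I: "I k (s', h')"
    have fr': "s' x = s x" if "x \<notin> {v_x, v_y, v_r, v_d1, v_d2, v_a, v_d, 63}" for x
      using fr[of x] that by (simp add: snap_disk_def writes_load_disk skip_def)
    have vv: "s' v_p1x = fst p1" "s' v_p1y = snd p1" "s' v_p2x = fst p2" "s' v_p2y = snd p2"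
      "s' v_vx = fst C.v" "s' v_vy = snd C.v" "s' v_h = C.h" "s' v_rb = real (RB n)" "s' v_N = real N"
      "s' v_M = 20 * real N"
      using v1 h par by (simp_all add: fr' p1_def p2_def st params_def n_def)
    have "input_at ds (s', h')"
      by (rule input_at_frame[OF inp[unfolded st]]) (use I in \<open>simp_all add: fr' I_def RB_def n_def\<close>)
    note ld = exec_load_disk[OF this, of k]
    define c where "c = fst (ds ! k)"
    define e where "e = C.nd (ds ! k)"
    have dk: "ds ! k \<in> set ds" using k by (simp add: n_def)
    then have e_in: "e \<in> C.nd ` set ds" by (simp add: e_def)
    note rng = C.nd_range[OF e_in]
    \<comment> \<open>Normalised centres have norm below \<open>9 * N\<close>, and the grid reaches
      to \<open>10 * N\<close>.\<close>
    have og: "on_grid N (snap (fst e))" using rng N by (intro on_grid_snap) auto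
    have sq: "(fst c - fst p1) * (fst c - fst p1) + (snd c - snd p1) * (snd c - snd p1) \<le>
        (fst c - fst p2) * (fst c - fst p2) + (snd c - snd p2) * (snd c - snd p2)
        \<longleftrightarrow> dist c p1 \<le> dist c p2" by (simp add: dist_prod)
    have e1: "fst e = (fst (c - C.base c) / C.h, snd (c - C.base c) / C.h)" "snd e = snd (ds ! k) / C.h"
      by (simp_all add: e_def C.nd_def c_def prod_eq_iff divide_inverse_commute)
    have ga: "addr (real (RB n) + (of_int \<lfloor>fst (c - C.base c) / C.h\<rfloor> + 10 * real N) * (20 * real N) +
        (of_int \<lfloor>snd (c - C.base c) / C.h\<rfloor> + 10 * real N)) = gaddr N (RB n) (snap (fst e))"
      using cell_addr[of N "fst (c - C.base c) / C.h" "snd (c - C.base c) / C.h" "RB n"] og e1 by simp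
    let ?A = "gaddr N (RB n) (snap (fst e))"
    have heap: "snd (exec snap_disk (s', h')) = h'(?A := max (h' ?A) (snd e))"
    proof (cases "dist c p1 \<le> dist c p2")
      case True
      then show ?thesis using ga e1(2) k
        by (simp add: snap_disk_def ld n_def skip_def sqdist_def cell_def vv c_def[symmetric] sq C.base_def max_def fun_upd_idem)
    next
      case False
      then show ?thesis using ga e1(2) k
        by (simp add: snap_disk_def ld n_def skip_def sqdist_def cell_def vv c_def[symmetric] sq C.base_def max_def
            fun_upd_idem diff_diff_eq)
    qed
    have "radius_grid (insert e (C.nd ` set (take k ds)))
        ((gridval N (RB n) h')(snap (fst e) := max (gridval N (RB n) h' (snap (fst e))) (snd e)))"
      using I rng(1) by (intro radius_grid_insert) (simp_all add: I_def)
    also have "gridval N (RB n) h' (snap (fst e)) = h' ?A" using og by (simp add: gridval_def)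
    also have "(gridval N (RB n) h')(snap (fst e) := max (h' ?A) (snd e)) =
        gridval N (RB n) (h'(?A := max (h' ?A) (snd e)))" using gridval_update[OF og] by simp
    also have "insert e (C.nd ` set (take k ds)) = C.nd ` set (take (Suc k) ds)"
      using k by (simp add: take_Suc_conv_app_nth n_def e_def)
    finally have "radius_grid (C.nd ` set (take (Suc k) ds)) (gridval N (RB n) (snd (exec snap_disk (s', h'))))"
      unfolding heap .
    moreover have "\<forall>a. a < RB n \<or> MB n N \<le> a \<longrightarrow> snd (exec snap_disk (s', h')) a = hp a"
      using I gaddr_range[OF og, of "RB n"] unfolding heap by (auto simp: I_def MB_def)
    ultimately show "I (Suc k) (next_iter v_d (exec snap_disk (s', h')))" by (simp add: I_def next_iter_def)
  qed (simp_all add: snap_disk_def writes_load_disk skip_def)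
  then show ?thesis by (simp add: I_def Let_def n_def st snap_disks_def snap_disk_def)
qed

text \<open>Presents two nested loops as one traversal of the grid: the invariant sees only the heap
  and the set of grid points visited so far.\<close>

lemma grid_loop:
  assumes M: "fst st v_M = real (20 * N)" and w: "{v_i, v_j, v_M} \<inter> writes body = {}"
    and init: "I {} (snd st)"
    and step: "\<And>i j s h Q. i < 20 * N \<Longrightarrow> j < 20 * N \<Longrightarrow> s v_i = real i \<Longrightarrow> s v_j = real j \<Longrightarrow>
      (\<And>x. x \<notin> {v_i, v_j} \<union> writes body \<Longrightarrow> s x = fst st x) \<Longrightarrow> I Q h \<Longrightarrow>
      I (insert (gpt N i j) Q) (snd (exec body (s, h)))"
  shows "I {g. on_grid N g} (snd (exec (For v_i v_M (For v_j v_M body)) st))"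
proof -
  let ?row = "\<lambda>i m. (\<lambda>j. gpt N i j) ` {..<m}"
  let ?rows = "\<lambda>m. \<Union>i<m. ?row i (20 * N)"
  have "I (?rows (20 * N)) (snd (exec (For v_i v_M (For v_j v_M body)) st))"
  proof (rule exec_For_invariant[OF M, where I = "\<lambda>k t. I (?rows k) (snd t)"])
    fix i s h assume i: "i < 20 * N" "s v_i = real i" "s v_M = real (20 * N)"
      and fr: "\<And>x. x \<notin> insert v_i (writes (For v_j v_M body)) \<Longrightarrow> s x = fst st x"
      and I: "I (?rows i) (snd (s, h))"
    have "I (?rows i \<union> ?row i (20 * N)) (snd (exec (For v_j v_M body) (s, h)))"
    proof (rule exec_For_invariant[where I = "\<lambda>k t. I (?rows i \<union> ?row i k) (snd t)"])
      fix j s' h' assume j: "j < 20 * N" "s' v_j = real j"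
        and fr': "\<And>x. x \<notin> insert v_j (writes body) \<Longrightarrow> s' x = fst (s, h) x"
        and I': "I (?rows i \<union> ?row i j) (snd (s', h'))"
      have "I (insert (gpt N i j) (?rows i \<union> ?row i j)) (snd (exec body (s', h')))"
        using i j w fr fr' I' by (intro step) auto
      then show "I (?rows i \<union> ?row i (Suc j)) (snd (next_iter v_j (exec body (s', h'))))"
        by (simp add: next_iter_def lessThan_Suc)
    qed (use i I w in auto)
    then show "I (?rows (Suc i)) (snd (next_iter v_i (exec (For v_j v_M body) (s, h))))"
      by (simp add: next_iter_def lessThan_Suc Un_commute)
  qed (use init w in auto)
  moreover have "?rows (20 * N) = {g. on_grid N g}"
    using on_grid_gpt by (auto elim!: on_grid_obtain)
  ultimately show ?thesis by simp
qed

lemma exec_set_dir: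
  assumes "s v_N = real N" "N > 0" "k \<notin> {v_ux, v_uy, v_s}"
  shows "exec (set_dir k) (s, h) = (s(v_ux := fst (dir (real N) (s k)), v_uy := snd (dir (real N) (s k)),
    v_s := norm (dir_vec (real N) (s k))), h)"
proof -
  have "sqrt (x * x) = \<bar>x\<bar>" for x :: real by (metis power2_eq_square real_sqrt_abs)
  moreover have "sqrt (x * x + y * y) = norm (x, y)" for x y :: real by (simp add: norm_Pair power2_eq_square)
  ultimately show ?thesis using assms
    by (simp add: set_dir_def dir_def dir_vec_def divide_inverse_commute fun_upd_twist)
qed

lemma writes_set_dir: "writes (set_dir k) = {v_ux, v_uy, v_s}"
  by (auto simp: set_dir_def)

definition marks :: "nat \<Rightarrow> nat \<Rightarrow> (nat \<Rightarrow> real) \<Rightarrow> point set" where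
  "marks n N h = {g. on_grid N g \<and> h (gaddr N (MB n N) g) > 0}"

lemma marks_update:
  assumes "on_grid N g"
  shows "marks n N (h(gaddr N (MB n N) g := 1)) = insert g (marks n N h)"
  using assms gaddr_inj[OF _ assms] by (auto simp: marks_def)

lemma mark_dirs_spec:
  assumes par: "params n N s" and N: "N > 0" and ij: "s v_i = real i" "s v_j = real j"
    and og: "\<And>k e. k \<le> 2 * N \<Longrightarrow> e = 1 \<or> e = -1 \<Longrightarrow>
      on_grid N (snap (gpt N i j + (e * s v_r) *\<^sub>R dir (real N) (real k)))"
  shows "let h' = snd (exec mark_dirs (s, h)) in
    marks n N h' = marks n N h \<union>
      {snap (gpt N i j + (e * s v_r) *\<^sub>R dir (real N) (real k)) | e k. k \<le> 2 * N \<and> (e = 1 \<or> e = -1)} \<and>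
    (\<forall>a. a < MB n N \<or> LB n N \<le> a \<longrightarrow> h' a = h a)"
proof -
  define P where "P e k = snap (gpt N i j + (e * s v_r) *\<^sub>R dir (real N) (real k))" for e :: real and k :: nat
  define I where "I m t \<longleftrightarrow> marks n N (snd t) = marks n N h \<union> {P e k | e k. k < m \<and> (e = 1 \<or> e = -1)} \<and>
    (\<forall>a. a < MB n N \<or> LB n N \<le> a \<longrightarrow> snd t a = h a)" for m and t :: state
  have "I (2 * N + 1) (exec (For v_k v_K mark_dir) (s, h))"
  proof (rule exec_For_invariant)
    show "fst (s, h) v_K = real (2 * N + 1)" using par by (simp add: params_def)
    show "I 0 ((fst (s, h))(v_k := 0), snd (s, h))" by (simp add: I_def)
  next
    fix k s' h'
    assume k: "k < 2 * N + 1" "s' v_k = real k"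
      and fr: "\<And>x. x \<notin> insert v_k (writes mark_dir) \<Longrightarrow> s' x = fst (s, h) x" and I: "I k (s', h')"
    have fr': "s' x = s x" if "x \<notin> {v_ux, v_uy, v_s, v_k}" for x
      using fr[of x] that by (simp add: mark_dir_def writes_set_dir)
    have vv: "s' v_i = real i" "s' v_j = real j" "s' v_r = s v_r" "s' v_N = real N" "s' v_M = 20 * real N"
      "s' v_mb = real (MB n N)"
      using par ij by (simp_all add: fr' params_def)
    define u where "u = dir (real N) (real k)"
    have og1: "on_grid N (P 1 k)" "on_grid N (P (-1) k)"
      using og[of k 1] og[of k "-1"] k(1) by (simp_all add: P_def)
    define xp where "xp = real i - 10 * real N + s v_r * fst u"
    define yp where "yp = real j - 10 * real N + s v_r * snd u"
    define xm where "xm = real i - 10 * real N - s v_r * fst u"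
    define ym where "ym = real j - 10 * real N - s v_r * snd u"
    have P1: "P 1 k = snap (xp, yp)" "P (-1) k = snap (xm, ym)"
      by (simp_all add: P_def gpt_def u_def snap_def xp_def yp_def xm_def ym_def)
    have heap: "snd (exec mark_dir (s', h')) =
        h'(gaddr N (MB n N) (P 1 k) := 1, gaddr N (MB n N) (P (-1) k) := 1)"
      using og1 N k unfolding P1
      by (simp add: mark_dir_def exec_set_dir[where N = N] vv cell_def gx_def gy_def cell_addr u_def[symmetric]
          xp_def[symmetric] yp_def[symmetric] xm_def[symmetric] ym_def[symmetric])
    have "marks n N (snd (exec mark_dir (s', h'))) = insert (P (-1) k) (insert (P 1 k) (marks n N h'))"
      unfolding heap using og1 by (simp only: marks_update)
    also have "\<dots> = marks n N h \<union> {P e k' | e k'. k' < Suc k \<and> (e = 1 \<or> e = -1)}"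
      using I by (auto simp: I_def less_Suc_eq)
    finally show "I (Suc k) (next_iter v_k (exec mark_dir (s', h')))"
      using I gaddr_range[OF og1(1), of "MB n N"] gaddr_range[OF og1(2), of "MB n N"]
      unfolding I_def next_iter_def snd_conv by (auto simp: heap LB_def)
  qed (auto simp: mark_dir_def writes_set_dir)
  then show ?thesis by (simp add: I_def Let_def mark_dirs_def mark_dir_def P_def less_Suc_eq_le)
qed

lemma mark_samples_spec:
  assumes par: "params n N (fst st)" and N: "N \<ge> 1000"
    and zero: "\<And>a. MB n N \<le> a \<Longrightarrow> snd st a = 0"
    and G: "radius_grid D (gridval N (RB n) (snd st))"
    and D: "\<And>d. d \<in> D \<Longrightarrow> norm (fst d) + snd d \<le> 9 * real N"
  shows "marks n N (snd (exec mark_samples st)) = samples N (gridval N (RB n) (snd st))"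
proof -
  define G where "G = gridval N (RB n) (snd st)"
  define S where "S Q = {snap (g + (e * G g) *\<^sub>R dir (real N) (real k)) | g e k.
    g \<in> Q \<and> G g > 0 \<and> k \<le> 2 * N \<and> (e = 1 \<or> e = -1)}" for Q
  have og: "on_grid N p" if "p \<in> samples N G" for p
  proof -
    have "norm p \<le> 9 * real N + 4" using norm_samples[OF _ assms(4) D] that N by (simp add: G_def)
    moreover have "snap p = p" using that by (auto simp: samples_def)
    ultimately show ?thesis using on_grid_snap[of p N] N by simp
  qed
  \<comment> \<open>Marks are written only between \<open>MB\<close> and \<open>LB\<close>. The
    radius table therefore keeps the values that define \<open>G\<close> while its remaining cells
    are still to be read.\<close>
  define I where "I Q h \<longleftrightarrow> marks n N h = S Q \<and> (\<forall>a. a < MB n N \<or> LB n N \<le> a \<longrightarrow> h a = snd st a)" for Q and h :: "nat \<Rightarrow> real"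
  have w: "writes mark_cell = {v_r, 63, v_k, v_ux, v_uy, v_s}"
    by (auto simp: mark_cell_def mark_dirs_def mark_dir_def writes_set_dir skip_def)
  have "I {g. on_grid N g} (snd (exec (For v_i v_M (For v_j v_M mark_cell)) st))"
  proof (rule grid_loop)
    show "fst st v_M = real (20 * N)" using par by (simp add: params_def)
    show "{v_i, v_j, v_M} \<inter> writes mark_cell = {}" by (simp add: w)
    have "marks n N (snd st) = {}"
      using zero gaddr_range(1)[of N _ "MB n N"] by (auto simp: marks_def)
    then show "I {} (snd st)" by (simp add: I_def S_def)
  next
    fix i j s h Q
    assume ij: "i < 20 * N" "j < 20 * N" "s v_i = real i" "s v_j = real j"
      and fr: "\<And>x. x \<notin> {v_i, v_j} \<union> writes mark_cell \<Longrightarrow> s x = fst st x" and I: "I Q h"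
    let ?g = "gpt N i j"
    have ogg: "on_grid N ?g" using ij by (simp add: on_grid_gpt)
    have ps: "params n N s" by (rule params_cong[OF _ par]) (auto intro!: fr simp: w)
    have "gaddr N (RB n) ?g < MB n N" using gaddr_range(2)[OF ogg, of "RB n"] by (simp add: MB_def)
    then have "h (gaddr N (RB n) ?g) = G ?g" using I ogg by (simp add: I_def G_def gridval_def)
    moreover have "addr (real (RB n) + real i * (20 * real N) + real j) = RB n + i * (20 * N) + j"
      by (rule addrI) simp
    ultimately have rd: "exec mark_cell (s, h) = (if G ?g \<le> 0 then exec skip (s(v_r := G ?g), h)
        else exec mark_dirs (s(v_r := G ?g), h))"
      using ps ij by (simp add: mark_cell_def params_def gaddr_gpt del: exec.simps(5))
    show "I (insert ?g Q) (snd (exec mark_cell (s, h)))"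
    proof (cases "G ?g \<le> 0")
      case True
      then have "S (insert ?g Q) = S Q" by (auto simp: S_def)
      then show ?thesis using True I by (simp add: rd skip_def I_def)
    next
      case False
      let ?s = "s(v_r := G ?g)"
      have "params n N ?s" by (rule params_cong[OF _ ps]) auto
      moreover have "on_grid N (snap (?g + (e * ?s v_r) *\<^sub>R dir (real N) (real k)))"
        if "k \<le> 2 * N" "e = 1 \<or> e = -1" for k e
      proof (rule og)
        have "G ?g > 0" using False by simp
        then show "snap (?g + (e * ?s v_r) *\<^sub>R dir (real N) (real k)) \<in> samples N G"
          unfolding samples_def fun_upd_same using that
          by (intro CollectI exI[of _ ?g] exI[of _ e] exI[of _ k] conjI refl)
      qed
      ultimately have "marks n N (snd (exec mark_dirs (?s, h))) = marks n N h \<union>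
          {snap (?g + (e * G ?g) *\<^sub>R dir (real N) (real k)) | e k. k \<le> 2 * N \<and> (e = 1 \<or> e = -1)}"
        "\<forall>a. a < MB n N \<or> LB n N \<le> a \<longrightarrow> snd (exec mark_dirs (?s, h)) a = h a"
        using mark_dirs_spec[of n N ?s i j h] N ij by (simp_all add: Let_def)
      moreover have "S (insert ?g Q) = S Q \<union> S {?g}" unfolding S_def by blast
      moreover have "S {?g} =
          {snap (?g + (e * G ?g) *\<^sub>R dir (real N) (real k)) | e k. k \<le> 2 * N \<and> (e = 1 \<or> e = -1)}"
      proof -
        have "0 < G ?g" using False by simp
        then show ?thesis unfolding S_def by blast
      qed
      ultimately show ?thesis using I False by (simp add: I_def rd)
    qed
  qed
  moreover have "S {g. on_grid N g} = samples N G"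
  proof -
    have "G g > 0 \<Longrightarrow> on_grid N g" for g by (auto simp: G_def gridval_def split: if_splits)
    then show ?thesis unfolding S_def samples_def by blast
  qed
  ultimately show ?thesis by (simp add: I_def mark_samples_def mark_cell_def G_def)
qed

section \<open>Strip extremes and scanning\<close>

lemma clear_bins_spec:
  assumes par: "params n N (fst st)"
  shows "let h = snd (exec clear_bins st) in
    (\<forall>k<40 * N. h (LB n N + k) = 100 * real N \<and> h (HB n N + k) = - 100 * real N) \<and> (\<forall>a<LB n N. h a = snd st a)"
proof -
  define I where "I m t \<longleftrightarrow> (\<forall>k<m. snd t (LB n N + k) = 100 * real N \<and> snd t (HB n N + k) = - 100 * real N) \<and>
    (\<forall>a<LB n N. snd t a = snd st a)" for m and t :: state
  have "I (40 * N) (exec (For v_ii v_B clear_bin) st)"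
  proof (rule exec_For_invariant)
    show "fst st v_B = real (40 * N)" using par by (simp add: params_def)
    show "I 0 ((fst st)(v_ii := 0), snd st)" by (simp add: I_def)
  next
    fix k s h assume k: "k < 40 * N" "s v_ii = real k"
      and fr: "\<And>x. x \<notin> insert v_ii (writes clear_bin) \<Longrightarrow> s x = fst st x" and I: "I k (s, h)"
    have v: "s v_lb = real (LB n N)" "s v_hb = real (HB n N)" "s v_N = real N"
      using par fr[of v_lb] fr[of v_hb] fr[of v_N] by (simp_all add: clear_bin_def params_def)
    have "exec clear_bin (s, h) = (s, h(LB n N + k := 100 * real N, HB n N + k := - 100 * real N))"
      using addr_of_nat[of "LB n N + k"] addr_of_nat[of "HB n N + k"]
      by (simp add: clear_bin_def v k)
    then show "I (Suc k) (next_iter v_ii (exec clear_bin (s, h)))"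
      using I k(1) by (auto simp: I_def next_iter_def less_Suc_eq HB_def)
  qed (auto simp: clear_bin_def)
  then show ?thesis by (simp add: I_def Let_def clear_bins_def clear_bin_def)
qed

lemma bins_of_insert:
  assumes "bins_of N u S lo hi" "k = bin N u p" "b = rot_b u p"
  shows "bins_of N u (insert p S) (lo(k := min (lo k) b)) (hi(k := max (hi k) b))"
  unfolding bins_of_def
proof (intro conjI ballI allI impI)
  fix x assume "x \<in> insert p S"
  then consider "x = p" | "lo (bin N u x) \<le> rot_b u x" "rot_b u x \<le> hi (bin N u x)"
    using assms(1) unfolding bins_of_def by blast
  then show "(lo(k := min (lo k) b)) (bin N u x) \<le> rot_b u x" "rot_b u x \<le> (hi(k := max (hi k) b)) (bin N u x)"
    by (cases; auto simp: assms)+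
next
  fix c assume c: "c < 40 * N"
  show "(lo(k := min (lo k) b)) c = 100 * real N \<or> (\<exists>x\<in>insert p S. bin N u x = c \<and> rot_b u x = (lo(k := min (lo k) b)) c)"
  proof (cases "c = k \<and> b \<le> lo k")
    case True
    then show ?thesis using assms by (auto simp: min_def)
  next
    case False
    then have "(lo(k := min (lo k) b)) c = lo c" by (auto simp: min_def)
    then show ?thesis using assms(1) c unfolding bins_of_def by auto
  qed
  show "(hi(k := max (hi k) b)) c = - 100 * real N \<or> (\<exists>x\<in>insert p S. bin N u x = c \<and> rot_b u x = (hi(k := max (hi k) b)) c)"
  proof (cases "c = k \<and> hi k \<le> b")
    case True
    then show ?thesis using assms by (auto simp: max_def)
  next
    case False
    then have "(hi(k := max (hi k) b)) c = hi c" by (auto simp: max_def)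
    then show ?thesis using assms(1) c unfolding bins_of_def by auto
  qed
qed

lemma gaddr_MB_less_LB: "on_grid N g \<Longrightarrow> gaddr N (MB n N) g < LB n N"
  using gaddr_range(2)[of N g "MB n N"] by (simp add: LB_def)

lemma fill_bins_spec:
  fixes st :: state and n N :: nat
  defines "u \<equiv> (fst st v_ux, fst st v_uy)" and "S \<equiv> marks n N (snd st)"
  assumes par: "params n N (fst st)" and N: "N > 0" and u: "norm u = 1"
    and S: "\<And>p. p \<in> S \<Longrightarrow> norm p \<le> 10 * real N"
    and init: "\<And>k. k < 40 * N \<Longrightarrow> snd st (LB n N + k) = 100 * real N \<and> snd st (HB n N + k) = - 100 * real N"
  shows "let h = snd (exec fill_bins st) in
    bins_of N u S (\<lambda>k. h (LB n N + k)) (\<lambda>k. h (HB n N + k)) \<and> (\<forall>a<LB n N. h a = snd st a)"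
proof -
  define I where "I Q h \<longleftrightarrow> bins_of N u (S \<inter> Q) (\<lambda>k. h (LB n N + k)) (\<lambda>k. h (HB n N + k)) \<and>
    (\<forall>a<LB n N. h a = snd st a)" for Q and h :: "nat \<Rightarrow> real"
  have w: "writes bin_cell = {63, v_x, v_y, v_a, v_b}" by (auto simp: bin_cell_def skip_def)
  have "I {g. on_grid N g} (snd (exec (For v_i v_M (For v_j v_M bin_cell)) st))"
  proof (rule grid_loop)
    show "fst st v_M = real (20 * N)" using par by (simp add: params_def)
    show "{v_i, v_j, v_M} \<inter> writes bin_cell = {}" by (simp add: w)
    show "I {} (snd st)" using init by (simp add: I_def bins_of_def)
  next
    fix i j s h Q
    assume ij: "i < 20 * N" "j < 20 * N" "s v_i = real i" "s v_j = real j"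
      and fr: "\<And>x. x \<notin> {v_i, v_j} \<union> writes bin_cell \<Longrightarrow> s x = fst st x" and I: "I Q h"
    let ?g = "gpt N i j"
    have ogg: "on_grid N ?g" using ij by (simp add: on_grid_gpt)
    have ps: "params n N s" by (rule params_cong[OF _ par]) (auto intro!: fr simp: w)
    have uu: "s v_ux = fst u" "s v_uy = snd u" using fr[of v_ux] fr[of v_uy] by (simp_all add: u_def w)
    have hg: "h (MB n N + i * (20 * N) + j) = snd st (gaddr N (MB n N) ?g)"
      using I gaddr_MB_less_LB[OF ogg, of n] by (simp add: I_def gaddr_gpt)
    have ad: "addr (real (MB n N) + real i * (20 * real N) + real j) = MB n N + i * (20 * N) + j"
      by (rule addrI) simp
    show "I (insert ?g Q) (snd (exec bin_cell (s, h)))"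
    proof (cases "snd st (gaddr N (MB n N) ?g) \<le> 0")
      case True
      then have "?g \<notin> S" by (simp add: S_def marks_def)
      moreover have "exec bin_cell (s, h) = (s(63 := 0), h)"
        using True ps ij by (simp add: bin_cell_def params_def skip_def ad hg)
      ultimately show ?thesis using I by (simp add: I_def)
    next
      case False
      then have gS: "?g \<in> S" using ogg by (simp add: S_def marks_def)
      have r: "norm ?g \<le> 19 * real N" using S[OF gS] by simp
      let ?k = "bin N u ?g" and ?b = "rot_b u ?g"
      have k: "?k < 40 * N" "of_int \<lfloor>rot_a u ?g\<rfloor> + 20 * real N = real ?k"
        using bin_range[OF u r N] by simp_all
      define X where "X = real i - 10 * real N"
      define Y where "Y = real j - 10 * real N"
      have XY: "X * fst u + Y * snd u = rot_a u ?g" "Y * fst u - X * snd u = ?b"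
        by (simp_all add: X_def Y_def rot_a_def rot_b_def gpt_def)
      have ad2: "addr (real (LB n N) + real ?k) = LB n N + ?k" "addr (real (HB n N) + real ?k) = HB n N + ?k"
        by (rule addrI, simp)+
      have heap: "snd (exec bin_cell (s, h)) = h(LB n N + ?k := min (h (LB n N + ?k)) ?b, HB n N + ?k := max (h (HB n N + ?k)) ?b)"
      proof -
        have "HB n N + ?k \<noteq> LB n N + ?k" using N by (simp add: HB_def)
        then show ?thesis using False ps ij
          by (cases "h (LB n N + ?k) \<le> ?b"; cases "?b \<le> h (HB n N + ?k)")
            (simp_all add: bin_cell_def params_def skip_def ad hg uu gx_def gy_def X_def[symmetric] Y_def[symmetric]
              XY k(2) ad2 min_absorb1 min_absorb2 max_absorb1 max_absorb2 fun_upd_idem)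
      qed
      \<comment> \<open>The restriction to \<open>c < 40 * N\<close> matters: beyond it the
        addresses of the lower table run into the one at \<open>HB\<close>.\<close>
      have "(\<lambda>c. snd (exec bin_cell (s, h)) (LB n N + c)) c = ((\<lambda>k. h (LB n N + k))(?k := min (h (LB n N + ?k)) ?b)) c"
        if "c < 40 * N" for c using that k(1) by (auto simp: heap HB_def)
      moreover have "(\<lambda>c. snd (exec bin_cell (s, h)) (HB n N + c)) c = ((\<lambda>k. h (HB n N + k))(?k := max (h (HB n N + ?k)) ?b)) c"
        for c using k(1) by (auto simp: heap HB_def)
      moreover have "bins_of N u (insert ?g (S \<inter> Q)) ((\<lambda>k. h (LB n N + k))(?k := min (h (LB n N + ?k)) ?b))
          ((\<lambda>k. h (HB n N + k))(?k := max (h (HB n N + ?k)) ?b))"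
        using I by (intro bins_of_insert) (simp_all add: I_def)
      moreover have "bin N u p < 40 * N" if "p \<in> S" for p
        using bin_range(2)[OF u _ N] S[OF that] by simp
      ultimately have "bins_of N u (insert ?g (S \<inter> Q)) (\<lambda>c. snd (exec bin_cell (s, h)) (LB n N + c))
          (\<lambda>c. snd (exec bin_cell (s, h)) (HB n N + c))"
        using gS unfolding bins_of_def by simp
      moreover have "S \<inter> insert ?g Q = insert ?g (S \<inter> Q)" using gS by blast
      ultimately show ?thesis using I by (simp add: I_def) (simp add: heap HB_def)
    qed
  qed
  moreover have "S \<inter> {g. on_grid N g} = S" by (auto simp: S_def marks_def)
  ultimately show ?thesis by (simp add: I_def Let_def fill_bins_def bin_cell_def)
qed

lemma exec_max:
  assumes "y \<noteq> 63"
  shows "exec (Ite x y skip (Asg y x)) (s, h) =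
    (s(y := max (s y) (s x), 63 := if s x \<le> s y then 0 else s 63), h)"
  using assms by (auto simp: skip_def fun_eq_iff)

lemma exec_min:
  assumes "y \<noteq> 63"
  shows "exec (Ite y x skip (Asg y x)) (s, h) =
    (s(y := min (s y) (s x), 63 := if s y \<le> s x then 0 else s 63), h)"
  using assms by (auto simp: skip_def fun_eq_iff)

text \<open>The map \<open>ix\<close> abstracts from the reading order, which is the identity for
  the first disk and the reversal for the second.\<close>

lemma scan_spec:
  fixes st :: state and n N :: nat
  defines "r \<equiv> fst st v_r"
  assumes par: "params n N (fst st)"
    and mab: "distinct [m, a, b]" "{m, a, b} \<inter> {v_al, v_ii, v_L, v_H, v_s, v_b, v_r, v_N, v_B, v_lb, v_hb, 63} = {}"
    and e: "\<And>s h i. s v_B = 40 * real N \<Longrightarrow> s v_ii = real i \<Longrightarrow> i < 40 * N \<Longrightarrow> ev e (s, h) = real (ix i)"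
    and lo: "\<And>i. lo i = snd st (LB n N + ix i)" and hi: "\<And>i. hi i = snd st (HB n N + ix i)"
  shows "let t = exec (scan m a b e) st in snd t = snd st \<and>
    (\<exists>mm\<le>40 * N. fst t m = real mm \<and> longest_prefix N lo hi r mm (fst t a) (fst t b))"
proof -
  obtain s0 h0 where st: "st = (s0, h0)" by (cases st)
  define s1 where "s1 = s0(m := 0, a := 0, b := 0)"
  have ne: "m \<noteq> a" "m \<noteq> b" "a \<noteq> b" "a \<noteq> m" "b \<noteq> m" "b \<noteq> a"
    using mab(1) by auto
  have nq: "m \<notin> {v_al, v_ii, v_L, v_H, v_s, v_b, v_r, v_N, v_B, v_lb, v_hb, 63}"
    "a \<notin> {v_al, v_ii, v_L, v_H, v_s, v_b, v_r, v_N, v_B, v_lb, v_hb, 63}"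
    "b \<notin> {v_al, v_ii, v_L, v_H, v_s, v_b, v_r, v_N, v_B, v_lb, v_hb, 63}"
    using mab(2) by auto
  have wi: "writes (scan_step m a b e) = {v_s, v_b, 63, v_L, v_H, m, a, b}" by (auto simp: scan_step_def skip_def)
  have wo: "writes (scan_column m a b e) = {v_s, v_b, 63, v_L, v_H, m, a, b, v_ii}" by (auto simp: scan_column_def wi)
  define ok where "ok x y k \<longleftrightarrow> fits lo hi r x y k" for x y k
  \<comment> \<open>\<open>bm\<close> compares the recorded run with all finished columns and with
    the first \<open>i\<close> strips of the current one. Its companion \<open>lh\<close> says that
    the current interval consists of exactly those ordinates of the search range that fit the first
    \<open>i\<close> strips.\<close>
  define bm where "bm c i s mm \<longleftrightarrow> mm \<le> 40 * N \<and> s m = real mm \<and> (\<forall>k<mm. ok (s a) (s b) k) \<and>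
      (\<forall>x<c. \<forall>m'\<le>40 * N. \<forall>y. \<bar>y\<bar> \<le> 100 * real N \<longrightarrow> (\<forall>k<m'. ok (real x) y k) \<longrightarrow> m' \<le> mm) \<and>
      (\<forall>m'\<le>i. \<forall>y. \<bar>y\<bar> \<le> 100 * real N \<longrightarrow> (\<forall>k<m'. ok (real c) y k) \<longrightarrow> m' \<le> mm)"
    for c i mm and s :: "nat \<Rightarrow> real"
  define best where "best c i s \<longleftrightarrow> (\<exists>mm. bm c i s mm)" for c i and s :: "nat \<Rightarrow> real"
  define lh where "lh c i s \<longleftrightarrow> (\<forall>k<i. \<forall>y. s v_L \<le> y \<longrightarrow> y \<le> s v_H \<longrightarrow> ok (real c) y k) \<and>
      (\<forall>y. \<bar>y\<bar> \<le> 100 * real N \<longrightarrow> (\<forall>k<i. ok (real c) y k) \<longrightarrow> s v_L \<le> y \<and> y \<le> s v_H)" 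
    for c i and s :: "nat \<Rightarrow> real"
  have "(\<lambda>c t. snd t = h0 \<and> best c 0 (fst t)) (40 * N) (exec (For v_al v_B (scan_column m a b e)) (s1, h0))"
  proof (rule exec_For_invariant[where I = "\<lambda>c t. snd t = h0 \<and> best c 0 (fst t)"])
    show "fst (s1, h0) v_B = real (40 * N)" using par nq by (simp add: s1_def st params_def)
    show "snd ((fst (s1, h0))(v_al := 0), snd (s1, h0)) = h0 \<and> best 0 0 (fst ((fst (s1, h0))(v_al := 0), snd (s1, h0)))"
    proof -
      have "bm 0 0 (s1(v_al := 0)) 0" unfolding bm_def using nq ne by (simp add: s1_def)
      then show ?thesis by (auto simp: best_def)
    qed
  next
    fix c s h assume c: "c < 40 * N" "s v_al = real c"
      and fr: "\<And>x. x \<notin> insert v_al (writes (scan_column m a b e)) \<Longrightarrow> s x = fst (s1, h0) x"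
      and I: "snd (s, h) = h0 \<and> best c 0 (fst (s, h))"
    have fr': "s x = s0 x" if "x \<in> {v_r, v_N, v_B, v_lb, v_hb}" for x
      using fr[of x] that nq by (auto simp: wo s1_def)
    have vv: "s v_r = r" "s v_N = real N" "s v_B = 40 * real N" "s v_lb = real (LB n N)" "s v_hb = real (HB n N)"
      using par by (simp_all add: fr' r_def st params_def)
    define s2 where "s2 = s(v_L := - 100 * real N, v_H := 100 * real N)"
    have s2: "exec (scan_column m a b e) (s, h) = exec (For v_ii v_B (scan_step m a b e)) (s2, h0)"
      using I vv by (simp add: scan_column_def s2_def del: exec.simps(5))
    have "(\<lambda>i t. snd t = h0 \<and> best c i (fst t) \<and> lh c i (fst t)) (40 * N) (exec (For v_ii v_B (scan_step m a b e)) (s2, h0))"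
    proof (rule exec_For_invariant[where I = "\<lambda>i t. snd t = h0 \<and> best c i (fst t) \<and> lh c i (fst t)"])
      show "fst (s2, h0) v_B = real (40 * N)" using vv by (simp add: s2_def)
      have "best c 0 (s2(v_ii := 0)) = best c 0 s" unfolding best_def bm_def s2_def using nq by simp
      then have "best c 0 (s2(v_ii := 0))" using I by simp
      moreover have "lh c 0 (s2(v_ii := 0))" by (auto simp: lh_def s2_def)
      ultimately show "snd ((fst (s2, h0))(v_ii := 0), snd (s2, h0)) = h0 \<and>
        best c 0 (fst ((fst (s2, h0))(v_ii := 0), snd (s2, h0))) \<and> lh c 0 (fst ((fst (s2, h0))(v_ii := 0), snd (s2, h0)))" by simp
    next
      fix i s' h' assume i: "i < 40 * N" "s' v_ii = real i" "s' v_B = real (40 * N)"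
        and fr2: "\<And>x. x \<notin> insert v_ii (writes (scan_step m a b e)) \<Longrightarrow> s' x = fst (s2, h0) x"
        and I2: "snd (s', h') = h0 \<and> best c i (fst (s', h')) \<and> lh c i (fst (s', h'))"
      have fr2': "s' x = s x" if "x \<in> {v_r, v_N, v_B, v_lb, v_hb, v_al}" for x
        using fr2[of x] that nq by (auto simp: wi s2_def)
      have v2: "s' v_r = r" "s' v_B = 40 * real N" "s' v_lb = real (LB n N)" "s' v_hb = real (HB n N)" "s' v_al = real c"
        using vv c by (simp_all add: fr2')
      have h': "h' = h0" using I2 by simp
      define sq where "sq = sqrt (r * r - (real i - real c) * (real i - real c))"
      have eve: "ev e (s'', h0) = real (ix i)" if "s'' v_B = 40 * real N" "s'' v_ii = real i" for s''
        using e that i(1) by blast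
      have ad: "addr (real (LB n N) + real (ix i)) = LB n N + ix i" "addr (real (HB n N) + real (ix i)) = HB n N + ix i"
        by (rule addrI, simp)+
      have lo_i: "h0 (LB n N + ix i) = lo i" "h0 (HB n N + ix i) = hi i" by (simp_all add: lo hi st)
      define L where "L = max (s' v_L) (hi i - sq)"
      define H where "H = min (s' v_H) (lo i + sq)"
      define t where "t = fst (exec (scan_step m a b e) (s', h'))"
      have tt: "snd (exec (scan_step m a b e) (s', h')) = h0" "t v_L = L" "t v_H = H"
        "t m = (if L \<le> H \<and> s' m < real i + 1 then real i + 1 else s' m)"
        "t a = (if L \<le> H \<and> s' m < real i + 1 then real c else s' a)"
        "t b = (if L \<le> H \<and> s' m < real i + 1 then L else s' b)"
      proof -
        define z1 where "z1 = (if hi i - sq \<le> s' v_L then 0 else s' 63)"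
        define z2 where "z2 = (if s' v_H \<le> lo i + sq then 0 else z1)"
        have E1: "exec (Asg v_s (Root (v_r [*] v_r [-] (v_ii [-] v_al) [*] (v_ii [-] v_al)))) (s', h0)
            = (s'(v_s := sq), h0)"
          by (simp add: i(2) v2 sq_def)
        have E2: "exec (Asg v_b (Heap (v_hb [+] e) [-] v_s)) (s'(v_s := sq), h0)
            = (s'(v_s := sq, v_b := hi i - sq), h0)"
          by (simp add: i(2) v2 eve ad lo_i)
        have E3: "exec (Ite v_b v_L skip (Asg v_L v_b)) (s'(v_s := sq, v_b := hi i - sq), h0)
            = (s'(v_s := sq, v_b := hi i - sq, v_L := L, 63 := z1), h0)"
          by (subst exec_max) (simp_all add: L_def z1_def)
        have E4: "exec (Asg v_b (Heap (v_lb [+] e) [+] v_s)) (s'(v_s := sq, v_b := hi i - sq, v_L := L, 63 := z1), h0)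
            = (s'(v_s := sq, v_b := hi i - sq, v_L := L, 63 := z1, v_b := lo i + sq), h0)"
          by (simp add: i(2) v2 eve ad lo_i)
        have E5: "exec (Ite v_H v_b skip (Asg v_H v_b)) (s'(v_s := sq, v_b := hi i - sq, v_L := L, 63 := z1, v_b := lo i + sq), h0)
            = (s'(v_s := sq, v_b := hi i - sq, v_L := L, 63 := z1, v_b := lo i + sq, v_H := H, 63 := z2), h0)"
          by (subst exec_min) (simp_all add: H_def z2_def)
        have z: "exec (scan_step m a b e) (s', h') = exec (Ite v_L v_H
            (Ite (v_ii [+] Cst 1) m skip (Asg m (v_ii [+] Cst 1) ;; Asg a v_al ;; Asg b v_L)) skip)
            (s'(v_s := sq, v_b := hi i - sq, v_L := L, 63 := z1, v_b := lo i + sq, v_H := H, 63 := z2), h0)"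
          by (simp only: scan_step_def exec.simps(3) h' E1 E2 E3 E4 E5)
        show "snd (exec (scan_step m a b e) (s', h')) = h0" "t v_L = L" "t v_H = H"
          "t m = (if L \<le> H \<and> s' m < real i + 1 then real i + 1 else s' m)"
          "t a = (if L \<le> H \<and> s' m < real i + 1 then real c else s' a)"
          "t b = (if L \<le> H \<and> s' m < real i + 1 then L else s' b)"
          using nq ne unfolding t_def z by (simp_all add: skip_def i(2) v2)
      qed
      have okd: "ok (real c) y i \<longleftrightarrow> hi i - sq \<le> y \<and> y \<le> lo i + sq" for y
        by (simp add: ok_def fits_def sq_def power2_eq_square)
      have lh': "lh c (Suc i) t"
      proof -
        have old: "s' v_L \<le> y \<Longrightarrow> y \<le> s' v_H \<Longrightarrow> k < i \<Longrightarrow> ok (real c) y k"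
          "\<bar>y\<bar> \<le> 100 * real N \<Longrightarrow> (\<forall>k<i. ok (real c) y k) \<Longrightarrow> s' v_L \<le> y \<and> y \<le> s' v_H" for y k
          using I2 unfolding lh_def fst_conv by blast+
        have LH: "L \<le> y \<longleftrightarrow> s' v_L \<le> y \<and> hi i - sq \<le> y" "y \<le> H \<longleftrightarrow> y \<le> s' v_H \<and> y \<le> lo i + sq" for y
          by (simp_all add: L_def H_def)
        show ?thesis unfolding lh_def tt(2,3) LH
        proof (intro conjI allI impI)
          fix k y assume "k < Suc i" "s' v_L \<le> y \<and> hi i - sq \<le> y" "y \<le> s' v_H \<and> y \<le> lo i + sq"
          then show "ok (real c) y k" using old(1)[of y k] okd[of y] by (cases "k = i") auto
        next
          fix y assume y: "\<bar>y\<bar> \<le> 100 * real N" "\<forall>k<Suc i. ok (real c) y k"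
          then have "s' v_L \<le> y \<and> y \<le> s' v_H" "ok (real c) y i" using old(2)[of y] by auto
          then show "s' v_L \<le> y" "hi i - sq \<le> y" "y \<le> s' v_H" "y \<le> lo i + sq" using okd by auto
        qed
      qed
      obtain mm where mm: "mm \<le> 40 * N" "s' m = real mm" "\<forall>k<mm. ok (s' a) (s' b) k"
        "\<forall>x<c. \<forall>m'\<le>40 * N. \<forall>y. \<bar>y\<bar> \<le> 100 * real N \<longrightarrow> (\<forall>k<m'. ok (real x) y k) \<longrightarrow> m' \<le> mm"
        "\<forall>m'\<le>i. \<forall>y. \<bar>y\<bar> \<le> 100 * real N \<longrightarrow> (\<forall>k<m'. ok (real c) y k) \<longrightarrow> m' \<le> mm"
      proof -
        obtain mm where "bm c i s' mm" using I2 by (auto simp: best_def)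
        then show thesis unfolding bm_def by (elim conjE) (rule that)
      qed
      define m2 where "m2 = (if L \<le> H \<and> mm < i + 1 then i + 1 else mm)"
      have m2: "mm \<le> m2" "m2 \<le> 40 * N" "t m = real m2"
        using mm(1,2) i(1) by (auto simp: m2_def tt(4))
      have "\<forall>k<m2. ok (t a) (t b) k"
      proof (cases "L \<le> H \<and> mm < i + 1")
        case True
        then have "t a = real c" "t b = L" "m2 = Suc i" using mm(2) by (simp_all add: tt m2_def)
        \<comment> \<open>The recorded ordinate is the lower end of a nonempty interval and hence
          admissible itself.\<close>
        moreover have "t v_L \<le> L" "L \<le> t v_H" using True tt by simp_all
        ultimately show ?thesis using lh' unfolding lh_def by auto
      next
        case False
        then have "\<not> (L \<le> H \<and> s' m < real i + 1)" using mm(2) by auto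
        then have "t a = s' a" "t b = s' b" "m2 = mm" using False unfolding tt m2_def by auto
        then show ?thesis using mm(3) by simp
      qed
      moreover have "m' \<le> m2" if "x < c" "m' \<le> 40 * N" "\<bar>y\<bar> \<le> 100 * real N" "\<forall>k<m'. ok (real x) y k" for x m' y
        using mm(4) that m2(1) le_trans by blast
      moreover have "m' \<le> m2" if "m' \<le> Suc i" "\<bar>y\<bar> \<le> 100 * real N" "\<forall>k<m'. ok (real c) y k" for m' y
      proof (cases "m' = Suc i")
        case True
        \<comment> \<open>A run of full length provides an ordinate in the interval; so the interval
          is nonempty and the record has been raised to \<open>Suc i\<close>.\<close>
        then have "L \<le> y \<and> y \<le> H" using lh' that tt unfolding lh_def by metis
        then show ?thesis using True by (simp add: m2_def)
      next
        case False
        then have "m' \<le> i" using that(1) by simp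
        then show ?thesis using mm(5) that m2(1) le_trans by blast
      qed
      ultimately have "best c (Suc i) t" unfolding best_def bm_def using m2 by (intro exI[of _ m2] conjI allI impI) blast+
      show "snd (next_iter v_ii (exec (scan_step m a b e) (s', h'))) = h0 \<and>
        best c (Suc i) (fst (next_iter v_ii (exec (scan_step m a b e) (s', h')))) \<and> lh c (Suc i) (fst (next_iter v_ii (exec (scan_step m a b e) (s', h'))))"
      proof -
        have "best c (Suc i) (t(v_ii := t v_ii + 1)) = best c (Suc i) t" "lh c (Suc i) (t(v_ii := t v_ii + 1)) = lh c (Suc i) t"
          unfolding best_def bm_def lh_def using nq by simp_all
        then show ?thesis using \<open>best c (Suc i) t\<close> lh' tt(1) by (simp add: next_iter_def t_def)
      qed
    qed (use nq in \<open>auto simp: wi\<close>)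
    note res = this[folded s2]
    have "best (Suc c) 0 (fst (exec (scan_column m a b e) (s, h)))"
    proof -
      let ?t = "fst (exec (scan_column m a b e) (s, h))"
      obtain mm where mm: "mm \<le> 40 * N" "?t m = real mm" "\<forall>k<mm. ok (?t a) (?t b) k"
        "\<forall>x<c. \<forall>m'\<le>40 * N. \<forall>y. \<bar>y\<bar> \<le> 100 * real N \<longrightarrow> (\<forall>k<m'. ok (real x) y k) \<longrightarrow> m' \<le> mm"
        "\<forall>m'\<le>40 * N. \<forall>y. \<bar>y\<bar> \<le> 100 * real N \<longrightarrow> (\<forall>k<m'. ok (real c) y k) \<longrightarrow> m' \<le> mm"
      proof -
        obtain mm where "bm c (40 * N) ?t mm" using res by (auto simp: best_def)
        then show thesis unfolding bm_def by (elim conjE) (rule that)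
      qed
      have "m' \<le> mm" if "x < Suc c" "m' \<le> 40 * N" "\<bar>y\<bar> \<le> 100 * real N" "\<forall>k<m'. ok (real x) y k" for x m' y
        using that mm(4,5) by (cases "x = c") (simp, metis less_SucE)
      then show ?thesis unfolding best_def bm_def using mm(1-3) by (intro exI[of _ mm]) auto
    qed
    show "snd (next_iter v_al (exec (scan_column m a b e) (s, h))) = h0 \<and> best (Suc c) 0 (fst (next_iter v_al (exec (scan_column m a b e) (s, h))))"
    proof -
      have "best (Suc c) 0 (f(v_al := x)) = best (Suc c) 0 f" for f x unfolding best_def bm_def using nq by simp
      then show ?thesis using \<open>best (Suc c) 0 (fst (exec (scan_column m a b e) (s, h)))\<close> res by (simp add: next_iter_def)
    qed
  qed (use nq in \<open>auto simp: wo\<close>)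
  moreover have "exec (scan m a b e) st = exec (For v_al v_B (scan_column m a b e)) (s1, h0)"
    using ne by (simp add: scan_def scan_column_def scan_step_def s1_def st del: exec.simps(5))
  ultimately show ?thesis
    unfolding Let_def st best_def bm_def longest_prefix_def ok_def by auto
qed

section \<open>One test and the whole search\<close>

definition splittable :: "nat \<Rightarrow> point set \<Rightarrow> nat \<Rightarrow> real \<Rightarrow> bool" where
  "splittable N S k r \<longleftrightarrow> (\<exists>t\<le>40 * N. \<exists>\<alpha><40 * N. \<exists>\<alpha>'<40 * N. \<exists>y. \<bar>y\<bar> \<le> 18 * real N \<and>
    (\<forall>p\<in>S. (bin N (dir (real N) (real k)) p < t \<longrightarrow> in_col N (dir (real N) (real k)) r \<alpha> y p) \<and>
           (t \<le> bin N (dir (real N) (real k)) p \<longrightarrow> in_col N (dir (real N) (real k)) r \<alpha>' y p)))"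

lemma writes_scan: "writes (scan m a b e) = {m, a, b, v_al, v_ii, v_L, v_H, v_s, v_b, 63}"
  by (auto simp: scan_def scan_column_def scan_step_def skip_def)

lemma writes_clear_bins: "writes clear_bins = {v_ii}"
  by (auto simp: clear_bins_def clear_bin_def)

lemma writes_fill_bins: "writes fill_bins = {v_i, v_j, 63, v_x, v_y, v_a, v_b}"
  by (auto simp: fill_bins_def bin_cell_def skip_def)

lemma scan_phase:
  assumes par: "params n N (fst st)" and N: "N > 0" and kk: "fst st v_kk = real k"
    and S: "\<And>p. p \<in> marks n N (snd st) \<Longrightarrow> norm p \<le> 10 * real N"
  defines "u \<equiv> dir (real N) (real k)" and "r \<equiv> fst st v_jj - 1"
  defines "t \<equiv> exec (scan v_mR v_aR v_bR (v_B [-] Cst 1 [-] v_ii)) (exec (scan v_mL v_aL v_bL v_ii)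
    (exec (Asg v_r (v_jj [-] Cst 1)) (exec fill_bins (exec clear_bins (exec (set_dir v_kk) st)))))"
  shows "\<exists>lo hi m1 m2. fst t v_mL = real m1 \<and> fst t v_mR = real m2 \<and>
    bins_of N u (marks n N (snd st)) lo hi \<and>
    longest_prefix N lo hi r m1 (fst t v_aL) (fst t v_bL) \<and>
    longest_prefix N (rev_bins N lo) (rev_bins N hi) r m2 (fst t v_aR) (fst t v_bR) \<and>
    (fst t v_ux, fst t v_uy) = u \<and> (\<forall>a<LB n N. snd t a = snd st a)"
proof -
  have u: "norm u = 1" using N by (simp add: u_def norm_dir)
  define s1 where "s1 = exec (set_dir v_kk) st"
  define s2 where "s2 = exec clear_bins s1"
  define s3 where "s3 = exec fill_bins s2"
  define s4 where "s4 = exec (Asg v_r (v_jj [-] Cst 1)) s3"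
  define s5 where "s5 = exec (scan v_mL v_aL v_bL v_ii) s4"
  have t: "t = exec (scan v_mR v_aR v_bR (v_B [-] Cst 1 [-] v_ii)) s5"
    by (simp add: t_def s5_def s4_def s3_def s2_def s1_def del: exec.simps)
  have N': "fst st v_N = real N" using par by (simp add: params_def)
  have sd: "s1 = ((fst st)(v_ux := fst u, v_uy := snd u, v_s := norm (dir_vec (real N) (real k))), snd st)"
    using exec_set_dir[of "fst st" N v_kk "snd st"] N N' kk by (simp add: s1_def u_def)
  have p1: "params n N (fst s1)" by (rule params_cong[OF _ par]) (auto simp: sd)
  have f2: "fst s2 x = fst s1 x" if "x \<noteq> v_ii" for x
    unfolding s2_def by (rule exec_frame) (simp add: writes_clear_bins that)
  have p2: "params n N (fst s2)" by (rule params_cong[OF _ p1]) (auto simp: f2)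
  have h2: "\<forall>k<40 * N. snd s2 (LB n N + k) = 100 * real N \<and> snd s2 (HB n N + k) = - 100 * real N"
    "\<forall>a<LB n N. snd s2 a = snd st a"
    using clear_bins_spec[OF p1] by (simp_all add: Let_def s2_def sd)
  have m2: "marks n N (snd s2) = marks n N (snd st)"
    using h2(2) gaddr_MB_less_LB by (auto simp: marks_def)
  have u2: "(fst s2 v_ux, fst s2 v_uy) = u" by (simp add: f2 sd)
  define lo where "lo = (\<lambda>k. snd s3 (LB n N + k))"
  define hi where "hi = (\<lambda>k. snd s3 (HB n N + k))"
  have bins: "bins_of N u (marks n N (snd st)) lo hi" and h3: "\<forall>a<LB n N. snd s3 a = snd st a"
    using fill_bins_spec[OF p2 N, unfolded u2 m2, OF u S] h2
    by (simp_all add: Let_def s3_def lo_def hi_def)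
  have f3: "fst s3 x = fst s2 x" if "x \<notin> {v_i, v_j, 63, v_x, v_y, v_a, v_b}" for x
    unfolding s3_def by (rule exec_frame) (use that in \<open>simp add: writes_fill_bins\<close>)
  have s4: "s4 = ((fst s3)(v_r := r), snd s3)" by (simp add: s4_def r_def f3 f2 sd)
  have p4: "params n N (fst s4)" by (rule params_cong[OF _ p2]) (auto simp: s4 f3)
  have A: "snd s5 = snd s4 \<and> (\<exists>mm\<le>40 * N. fst s5 v_mL = real mm \<and> longest_prefix N lo hi r mm (fst s5 v_aL) (fst s5 v_bL))"
    using scan_spec[OF p4, of v_mL v_aL v_bL "v_ii" "\<lambda>i. i" lo hi]
    by (simp add: Let_def s5_def lo_def hi_def s4)
  then obtain m1 where m1: "fst s5 v_mL = real m1" "longest_prefix N lo hi r m1 (fst s5 v_aL) (fst s5 v_bL)" by blast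
  have f5: "fst s5 x = fst s4 x" if "x \<notin> {v_mL, v_aL, v_bL, v_al, v_ii, v_L, v_H, v_s, v_b, 63}" for x
    unfolding s5_def by (rule exec_frame) (use that in \<open>simp add: writes_scan\<close>)
  have p5: "params n N (fst s5)" by (rule params_cong[OF _ p4]) (auto simp: f5)
  have r5: "fst s5 v_r = r" by (simp add: f5 s4)
  have ix: "ev (v_B [-] Cst 1 [-] v_ii) (s, h) = real (40 * N - 1 - i)"
    if "s v_B = 40 * real N" "s v_ii = real i" "i < 40 * N" for s h i
    using that by (simp add: of_nat_diff)
  have B: "snd t = snd s5 \<and> (\<exists>mm\<le>40 * N. fst t v_mR = real mm \<and>
      longest_prefix N (rev_bins N lo) (rev_bins N hi) r mm (fst t v_aR) (fst t v_bR))"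
    using scan_spec[OF p5, of v_mR v_aR v_bR "v_B [-] Cst 1 [-] v_ii" "\<lambda>i. 40 * N - 1 - i" "rev_bins N lo" "rev_bins N hi"] ix A
    unfolding t[symmetric] Let_def r5 by (simp add: rev_bins_def lo_def hi_def s4)
  then obtain m2 where m2': "fst t v_mR = real m2"
    "longest_prefix N (rev_bins N lo) (rev_bins N hi) r m2 (fst t v_aR) (fst t v_bR)" by blast
  have ft: "fst t x = fst s5 x" if "x \<notin> {v_mR, v_aR, v_bR, v_al, v_ii, v_L, v_H, v_s, v_b, 63}" for x
    unfolding t by (rule exec_frame) (use that in \<open>simp add: writes_scan\<close>)
  have "(fst t v_ux, fst t v_uy) = u" using u2 by (simp add: ft f5 s4 f3)
  moreover have "\<forall>a<LB n N. snd t a = snd st a" using A B h3 by (simp add: s4)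
  ultimately show ?thesis using bins m1 m2' by (intro exI[of _ lo] exI[of _ hi] exI[of _ m1] exI[of _ m2]) (simp add: ft)
qed

lemma writes_try_direction: "writes try_direction \<subseteq> {v_ux, v_uy, v_s, v_ii, v_i, v_j, 63, v_x, v_y, v_a, v_b, v_r,
    v_mL, v_aL, v_bL, v_mR, v_aR, v_bR, v_al, v_L, v_H, v_jj, v_kk, v_x1, v_y1, v_x2, v_y2}"
  by (auto simp: try_direction_def writes_set_dir writes_clear_bins writes_fill_bins writes_scan save_centres_def)

text \<open>On success, soundness of the scans gives a cover of radius \<open>(j - 1) + 1\<close>.
  On failure, completeness shows that the direction admits no cut at the tested radius, and the old
  centres remain in place.\<close>

lemma try_direction_spec:
  assumes par: "params n N (fst st)" and N: "N > 0" and kk: "fst st v_kk = real k" and jj: "fst st v_jj = real j"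
    and S: "\<And>p. p \<in> marks n N (snd st) \<Longrightarrow> norm p \<le> 10 * real N"
    and cov: "marks n N (snd st) \<subseteq> cball (fst st v_x1, fst st v_y1) (real j + 1) \<union> cball (fst st v_x2, fst st v_y2) (real j + 1)"
  shows "let t = exec try_direction st; S = marks n N (snd st) in (\<forall>a<LB n N. snd t a = snd st a) \<and>
    (fst t v_kk = real k \<and> j \<ge> 1 \<and> fst t v_jj = real (j - 1) \<and>
        S \<subseteq> cball (fst t v_x1, fst t v_y1) (real j) \<union> cball (fst t v_x2, fst t v_y2) (real j)
     \<or> fst t v_kk = real (Suc k) \<and> fst t v_jj = real j \<and> (j = 0 \<or> \<not> splittable N S k (real j - 1)) \<and>
        S \<subseteq> cball (fst t v_x1, fst t v_y1) (real j + 1) \<union> cball (fst t v_x2, fst t v_y2) (real j + 1))"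
proof -
  let ?S = "marks n N (snd st)"
  define u where "u = dir (real N) (real k)"
  have u: "norm u = 1" using N by (simp add: u_def norm_dir)
  define r where "r = real j - 1"
  define t where "t = exec (scan v_mR v_aR v_bR (v_B [-] Cst 1 [-] v_ii)) (exec (scan v_mL v_aL v_bL v_ii)
    (exec (Asg v_r (v_jj [-] Cst 1)) (exec fill_bins (exec clear_bins (exec (set_dir v_kk) st)))))"
  obtain lo hi m1 m2 where *: "fst t v_mL = real m1" "fst t v_mR = real m2"
    "bins_of N u ?S lo hi" "longest_prefix N lo hi r m1 (fst t v_aL) (fst t v_bL)"
    "longest_prefix N (rev_bins N lo) (rev_bins N hi) r m2 (fst t v_aR) (fst t v_bR)"
    "(fst t v_ux, fst t v_uy) = u" "\<forall>a<LB n N. snd t a = snd st a"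
    using scan_phase[OF par N kk S] unfolding t_def[symmetric] jj r_def[symmetric] u_def[symmetric] by blast
  have ft: "fst t x = fst st x" if "x \<in> {v_kk, v_jj, v_B, v_N, v_x1, v_x2, v_y1, v_y2}" for x
    using that unfolding t_def
    by (auto simp: exec_frame writes_scan writes_fill_bins writes_clear_bins writes_set_dir simp del: exec.simps)
  have BN: "fst t v_B = real (40 * N)" "fst t v_N = real N" using par ft by (simp_all add: params_def)
  have ex: "exec try_direction st = (if 40 * N \<le> m1 + m2 then if 1 \<le> j
      then exec (Asg v_jj (v_jj [-] Cst 1) ;; save_centres) t else exec (Asg v_kk (v_kk [+] Cst 1)) t
      else exec (Asg v_kk (v_kk [+] Cst 1)) t)"
  proof -
    have "exec try_direction st = exec (Ite v_B (v_mL [+] v_mR)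
      (Ite (Cst 1) v_jj (Asg v_jj (v_jj [-] Cst 1) ;; save_centres) (Asg v_kk (v_kk [+] Cst 1)))
      (Asg v_kk (v_kk [+] Cst 1))) t" unfolding try_direction_def exec.simps(3) t_def ..
    moreover have "real (40 * N) \<le> real m1 + real m2 \<longleftrightarrow> 40 * N \<le> m1 + m2" by linarith
    moreover have "fst t v_jj = real j" using ft jj by simp
    ultimately show ?thesis unfolding exec.simps(4) ev.simps BN *(1,2) by simp
  qed
  have next_k: "fst (exec (Asg v_kk (v_kk [+] Cst 1)) t) v_kk = real (Suc k)" 
    "x \<noteq> v_kk \<Longrightarrow> fst (exec (Asg v_kk (v_kk [+] Cst 1)) t) x = fst t x"
    "snd (exec (Asg v_kk (v_kk [+] Cst 1)) t) = snd t" for x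
    using ft kk by simp_all
  consider (ok) "40 * N \<le> m1 + m2" "1 \<le> j" | (zero) "j = 0" | (fail) "\<not> 40 * N \<le> m1 + m2" "1 \<le> j" by linarith
  then show ?thesis
  proof cases
    case ok
    let ?t = "exec (Asg v_jj (v_jj [-] Cst 1) ;; save_centres) t"
    have c: "(fst ?t v_x1, fst ?t v_y1) = unrot u (fst t v_aL - 20 * real N) (fst t v_bL)"
      "(fst ?t v_x2, fst ?t v_y2) = unrot u (20 * real N - 1 - fst t v_aR) (fst t v_bR)"
      using *(6)[symmetric] BN by (simp_all add: save_centres_def unrot_def)
    have "?S \<subseteq> cball (fst ?t v_x1, fst ?t v_y1) (r + 1) \<union> cball (fst ?t v_x2, fst ?t v_y2) (r + 1)"
      unfolding c using prefix_suffix_sound[OF *(3) u N S _ *(4,5) ok(1)] ok(2) by (simp add: r_def)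
    moreover have "fst ?t v_jj = real (j - 1)" "fst ?t v_kk = real k" "snd ?t = snd t"
      using ft jj kk ok by (simp_all add: save_centres_def of_nat_diff)
    ultimately show ?thesis using ok *(7) unfolding Let_def ex by (simp add: r_def)
  next
    case zero
    then show ?thesis using *(7) next_k ft jj cov unfolding Let_def ex by simp
  next
    case fail
    have "\<not> splittable N ?S k r"
    proof
      assume "splittable N ?S k r"
      then obtain tt \<alpha> \<alpha>' y where "tt \<le> 40 * N" "\<alpha> < 40 * N" "\<alpha>' < 40 * N" "\<bar>y\<bar> \<le> 18 * real N"
        "\<forall>p\<in>?S. (bin N u p < tt \<longrightarrow> in_col N u r \<alpha> y p) \<and> (tt \<le> bin N u p \<longrightarrow> in_col N u r \<alpha>' y p)"
        unfolding splittable_def u_def by blast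
      from prefix_suffix_complete[OF *(3) this *(4,5)] show False using fail by simp
    qed
    then show ?thesis using fail *(7) next_k ft jj cov unfolding Let_def ex by (simp add: r_def)
  qed
qed

text \<open>Every test lowers \<open>j\<close> or raises \<open>k\<close>, so
  \<open>it + j = k + (N + 4)\<close> is invariant, and after \<open>3 * N + 5\<close> tests
  \<open>k\<close> exceeds \<open>2 * N\<close>. The failure of a direction is remembered together
  with the radius \<open>j'\<close> current at that time; only \<open>j' \<ge> j\<close> is kept,
  which survives later decreases.\<close>

lemma search_spec:
  assumes par: "params n N (fst st)" and N: "N > 0"
    and S: "\<And>p. p \<in> marks n N (snd st) \<Longrightarrow> norm p \<le> 10 * real N"
    and cov: "marks n N (snd st) \<subseteq> cball 0 (real N + 4) \<union> cball (fst st v_p2nx, fst st v_p2ny) (real N + 4)"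
  shows "let t = exec search st in \<exists>j\<le>N + 4. fst t v_jj = real j \<and>
    marks n N (snd st) \<subseteq> cball (fst t v_x1, fst t v_y1) (real j + 1) \<union> cball (fst t v_x2, fst t v_y2) (real j + 1) \<and>
    (\<forall>k\<le>2 * N. \<exists>j'\<ge>j. j' = 0 \<or> \<not> splittable N (marks n N (snd st)) k (real j' - 1))"
proof -
  define S where "S = marks n N (snd st)"
  define s1 where "s1 = (fst st)(v_kk := 0, v_jj := real N + 4, v_x1 := 0, v_y1 := 0,
    v_x2 := fst st v_p2nx, v_y2 := fst st v_p2ny)"
  have ex: "exec search st = exec (For v_it v_T try_direction) (s1, snd st)"
    using par by (simp add: search_def s1_def params_def del: exec.simps(5))
  define I where "I it t \<longleftrightarrow> (\<forall>a<LB n N. snd t a = snd st a) \<and> (\<exists>k j. fst t v_kk = real k \<and> fst t v_jj = real j \<and> j \<le> N + 4 \<and>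
      it + j = k + (N + 4) \<and>
      S \<subseteq> cball (fst t v_x1, fst t v_y1) (real j + 1) \<union> cball (fst t v_x2, fst t v_y2) (real j + 1) \<and>
      (\<forall>k'<k. \<exists>j'\<ge>j. j' = 0 \<or> \<not> splittable N S k' (real j' - 1)))" for it and t :: state
  have "I (3 * N + 5) (exec (For v_it v_T try_direction) (s1, snd st))"
  proof (rule exec_For_invariant)
    show "fst (s1, snd st) v_T = real (3 * N + 5)" using par by (simp add: s1_def params_def)
    have "S \<subseteq> cball (0, 0) (real N + 5) \<union> cball (fst st v_p2nx, fst st v_p2ny) (real N + 5)"
      using cov unfolding S_def zero_prod_def by (force simp: subset_iff)
    then show "I 0 ((fst (s1, snd st))(v_it := 0), snd (s1, snd st))"
      unfolding I_def by (intro conjI exI[of _ 0] exI[of _ "N + 4"]) (simp_all add: s1_def add.commute)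
  next
    fix it s h assume it: "it < 3 * N + 5" "s v_it = real it"
      and fr: "\<And>x. x \<notin> insert v_it (writes try_direction) \<Longrightarrow> s x = fst (s1, snd st) x" and I: "I it (s, h)"
    have p: "params n N s"
      by (rule params_cong[OF _ par]) (use writes_try_direction in \<open>auto intro!: fr[THEN trans] simp: s1_def\<close>)
    have h: "\<forall>a<LB n N. h a = snd st a" using I by (simp add: I_def)
    then have mS: "marks n N h = S" using gaddr_MB_less_LB by (auto simp: marks_def S_def)
    obtain k j where kj: "s v_kk = real k" "s v_jj = real j" "j \<le> N + 4" "it + j = k + (N + 4)"
      "S \<subseteq> cball (s v_x1, s v_y1) (real j + 1) \<union> cball (s v_x2, s v_y2) (real j + 1)"
      "\<forall>k'<k. \<exists>j'\<ge>j. j' = 0 \<or> \<not> splittable N S k' (real j' - 1)"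
      using I unfolding I_def fst_conv by blast
    let ?t = "exec try_direction (s, h)"
    have ts: "\<forall>a<LB n N. snd ?t a = h a"
      "fst ?t v_kk = real k \<and> j \<ge> 1 \<and> fst ?t v_jj = real (j - 1) \<and>
        S \<subseteq> cball (fst ?t v_x1, fst ?t v_y1) (real j) \<union> cball (fst ?t v_x2, fst ?t v_y2) (real j)
     \<or> fst ?t v_kk = real (Suc k) \<and> fst ?t v_jj = real j \<and> (j = 0 \<or> \<not> splittable N S k (real j - 1)) \<and>
        S \<subseteq> cball (fst ?t v_x1, fst ?t v_y1) (real j + 1) \<union> cball (fst ?t v_x2, fst ?t v_y2) (real j + 1)"
      using try_direction_spec[of n N "(s, h)" k j, unfolded fst_conv snd_conv mS, OF p N kj(1,2) _ kj(5)] S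
      unfolding S_def[symmetric] Let_def by blast+
    have h': "\<forall>a<LB n N. snd ?t a = snd st a" using ts(1) h by simp
    consider (dec) "fst ?t v_kk = real k" "1 \<le> j" "fst ?t v_jj = real (j - 1)"
        "S \<subseteq> cball (fst ?t v_x1, fst ?t v_y1) (real j) \<union> cball (fst ?t v_x2, fst ?t v_y2) (real j)"
      | (inc) "fst ?t v_kk = real (Suc k)" "fst ?t v_jj = real j" "j = 0 \<or> \<not> splittable N S k (real j - 1)"
        "S \<subseteq> cball (fst ?t v_x1, fst ?t v_y1) (real j + 1) \<union> cball (fst ?t v_x2, fst ?t v_y2) (real j + 1)"
      using ts(2) by blast
    then have "\<exists>k j. fst ?t v_kk = real k \<and> fst ?t v_jj = real j \<and> j \<le> N + 4 \<and> Suc it + j = k + (N + 4) \<and>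
      S \<subseteq> cball (fst ?t v_x1, fst ?t v_y1) (real j + 1) \<union> cball (fst ?t v_x2, fst ?t v_y2) (real j + 1) \<and>
      (\<forall>k'<k. \<exists>j'\<ge>j. j' = 0 \<or> \<not> splittable N S k' (real j' - 1))"

    proof cases
      case a: dec
      have "real (j - 1) + 1 = real j" using a(2) by (simp add: of_nat_diff)
      moreover have "\<forall>k'<k. \<exists>j'\<ge>j - 1. j' = 0 \<or> \<not> splittable N S k' (real j' - 1)"
        using kj(6) by (meson diff_le_self le_trans)
      moreover have "Suc it + (j - 1) = k + (N + 4)" using kj(4) a(2) by simp
      ultimately show ?thesis using a kj(3) by (intro exI[of _ k] exI[of _ "j - 1"]) simp
    next
      case a: inc
      have "\<forall>k'<Suc k. \<exists>j'\<ge>j. j' = 0 \<or> \<not> splittable N S k' (real j' - 1)"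
        using kj(6) a(3) by (metis less_Suc_eq order_refl)
      then show ?thesis using a kj(3,4) by (intro exI[of _ "Suc k"] exI[of _ j]) simp
    qed
    then show "I (Suc it) (next_iter v_it ?t)" using h' unfolding I_def next_iter_def by simp
  qed (use writes_try_direction in auto)
  then obtain k j where kj: "fst (exec search st) v_jj = real j" "j \<le> N + 4" "3 * N + 5 + j = k + (N + 4)"
      "S \<subseteq> cball (fst (exec search st) v_x1, fst (exec search st) v_y1) (real j + 1) \<union>
        cball (fst (exec search st) v_x2, fst (exec search st) v_y2) (real j + 1)"
      "\<forall>k'<k. \<exists>j'\<ge>j. j' = 0 \<or> \<not> splittable N S k' (real j' - 1)"
    unfolding ex I_def by blast
  have "2 * N < k" using kj(3) by simp
  then show ?thesis using kj unfolding Let_def S_def by (intro exI[of _ j]) auto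
qed

section \<open>The approximation guarantee\<close>

lemma disk_radius_le:
  fixes c c1 c2 :: point
  assumes cov: "cball c R \<subseteq> cball c1 r \<union> cball c2 r" and R: "0 \<le> R"
  shows "R \<le> r"
proof -
  \<comment> \<open>project onto the normal of the line of centres, where both covering disks have the same image\<close>
  define w where "w = c2 - c1"
  define u where "u = (if w = 0 then (1, 0) else (- snd w, fst w) /\<^sub>R norm w)"
  have "norm (- snd w, fst w) = norm w" by (simp add: norm_prod_def add.commute)
  then have u: "norm u = 1" by (cases "w = 0") (simp_all add: u_def norm_Pair del: scaleR_Pair)
  have "u \<bullet> w = 0" by (auto simp: u_def inner_prod_def)
  then have c12: "u \<bullet> c1 = u \<bullet> c2" by (simp add: w_def inner_diff_right)
  have p: "\<bar>u \<bullet> x - u \<bullet> c1\<bar> \<le> r" if "x \<in> cball c R" for x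
  proof -
    have "\<bar>u \<bullet> (x - e)\<bar> \<le> norm (x - e)" for e using Cauchy_Schwarz_ineq2[of u "x - e"] u by simp
    moreover have "norm (x - c1) \<le> r \<or> norm (x - c2) \<le> r"
      using cov that by (force simp: dist_norm norm_minus_commute)
    ultimately show ?thesis using c12 by (metis inner_diff_right order_trans)
  qed
  have "c + R *\<^sub>R u \<in> cball c R" "c - R *\<^sub>R u \<in> cball c R" using u R by (simp_all add: dist_norm)
  from p[OF this(1)] p[OF this(2)] have "\<bar>u \<bullet> c + R - u \<bullet> c1\<bar> \<le> r" "\<bar>u \<bullet> c - R - u \<bullet> c1\<bar> \<le> r"
    using u by (simp_all add: inner_add_right inner_diff_right norm_eq_1)
  then show ?thesis by linarith
qed

lemma set_params_spec:
  assumes "fst st v_eps = eps" "eps > 0" "N = nat \<lfloor>1000 / eps\<rfloor> + 1000"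
  shows "exec set_params st = ((fst st)(v_N := real N, v_M := 20 * real N, v_B := 40 * real N,
    v_K := 2 * real N + 1, v_T := 3 * real N + 5), snd st)"
proof -
  have "real_of_int \<lfloor>1000 / eps\<rfloor> + 1000 = real N" using assms by simp
  then show ?thesis using assms(1) by (simp add: set_params_def)
qed

lemma set_frame_spec:
  fixes st :: state
  defines "p1 \<equiv> (fst st v_p1x, fst st v_p1y)" and "p2 \<equiv> (fst st v_p2x, fst st v_p2y)"
  assumes tc: "two_clusters D p1 p2 q N" and q: "fst st v_q = q" and far: "fst st v_far = (dist p1 p2)\<^sup>2"
    and n: "fst st v_n = real n"
    and par: "fst st v_N = real N" "fst st v_M = 20 * real N" "fst st v_B = 40 * real N"
      "fst st v_K = 2 * real N + 1" "fst st v_T = 3 * real N + 5"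
  shows "let t = exec set_frame st in snd t = snd st \<and> params n N (fst t) \<and> fst t v_h = two_clusters.h q N \<and>
    (fst t v_vx, fst t v_vy) = two_clusters.v p1 p2 q \<and> (fst t v_p2nx, fst t v_p2ny) = two_clusters.p2n p1 p2 q N"
proof -
  interpret C: two_clusters D p1 p2 q N by (rule tc)
  define f where "f = max 0 (1 - 8 * q / dist p1 p2)"
  define s1 where "s1 = (fst st)(v_h := C.h, v_f := 1 - 8 * q / dist p1 p2)"
  obtain z where z: "exec (Ite v_f (Cst 0) (Asg v_f (Cst 0)) skip) (s1, snd st) = (s1(v_f := f, 63 := z), snd st)"
  proof
    show "exec (Ite v_f (Cst 0) (Asg v_f (Cst 0)) skip) (s1, snd st) =
      (s1(v_f := f, 63 := if f = 0 then if 1 - 8 * q / dist p1 p2 = 0 then s1 63 else s1 63 else 0), snd st)"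
      by (auto simp: f_def s1_def skip_def fun_eq_iff max_def)
  qed
  have p: "fst st v_p1x = fst p1" "fst st v_p1y = snd p1" "fst st v_p2x = fst p2" "fst st v_p2y = snd p2"
    by (simp_all add: p1_def p2_def)
  have v: "C.v = (f * (fst p2 - fst p1), f * (snd p2 - snd p1))"
    by (simp add: C.v_def f_def prod_eq_iff)
  have p2n: "C.p2n = ((fst p2 - (fst p1 + fst C.v)) / C.h, (snd p2 - (snd p1 + snd C.v)) / C.h)"
    by (simp add: C.p2n_def prod_eq_iff divide_inverse_commute)
  have e1: "exec (Asg v_f (Cst 1 [-] Cst 8 [*] v_q [/] Root v_far)) (exec (Asg v_h (v_q [/] v_N)) st) = (s1, snd st)"
    using q far par by (simp add: s1_def C.h_def)
  show ?thesis unfolding set_frame_def exec.simps(3) e1 z Let_def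
    using par n p v p2n by (simp add: s1_def params_def RB_def MB_def LB_def HB_def)
qed

lemma unshift_centre_spec:
  assumes tc: "two_clusters D p1 p2 q N" and xy: "distinct [x, y]" "{x, y} \<subseteq> {0, 1, 2, 3}"
    and s: "p1 = (fst st v_p1x, fst st v_p1y)" "fst st v_h = two_clusters.h q N"
    "(fst st v_vx, fst st v_vy) = two_clusters.v p1 p2 q" "(fst st v_p2nx, fst st v_p2ny) = two_clusters.p2n p1 p2 q N"
  shows "(fst (exec (unshift_centre x y) st) x, fst (exec (unshift_centre x y) st) y) =
    two_clusters.unshift p1 p2 q N (fst st x, fst st y)"
proof -
  interpret C: two_clusters D p1 p2 q N by (rule tc)
  let ?c = "(fst st x, fst st y)"
  have ne: "x \<noteq> y" "y \<noteq> x" "x < 4" "y < 4" using xy by auto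
  have e: "fst C.v = fst st v_vx" "snd C.v = fst st v_vy" "fst C.p2n = fst st v_p2nx" "snd C.p2n = fst st v_p2ny"
    using s(3,4)[symmetric] by simp_all
  have "fst st x * fst st x + fst st y * fst st y \<le>
      (fst st x - fst st v_p2nx) * (fst st x - fst st v_p2nx) + (fst st y - fst st v_p2ny) * (fst st y - fst st v_p2ny)
      \<longleftrightarrow> dist ?c 0 \<le> dist ?c C.p2n" by (simp add: dist_prod e)
  moreover have "fst st v_p1x = fst p1" "fst st v_p1y = snd p1" using s(1) by simp_all
  ultimately show ?thesis using ne s(2)
    by (cases "dist ?c 0 \<le> dist ?c C.p2n") (simp_all add: unshift_centre_def C.unshift_def skip_def sqdist_def e prod_eq_iff)
qed

lemma prog_writes:
  "writes copy_input = {v_n3, v_ib, v_d, v_x}"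
  "writes find_farthest = {v_p1x, v_p1y, v_p2x, v_p2y, v_far, v_d, v_x, v_y, v_r, v_d1, 63}"
  "writes find_radius = {v_q, v_d, v_x, v_y, v_r, v_d1, v_d2, 63}"
  "writes set_params = {v_N, v_M, v_B, v_K, v_T}"
  "writes set_frame = {v_h, v_f, 63, v_vx, v_vy, v_p2nx, v_p2ny, v_rb, v_mb, v_lb, v_hb}"
  "writes snap_disks = {v_d, v_x, v_y, v_r, v_d1, v_d2, 63, v_a}"
  "writes mark_samples = {v_i, v_j, v_r, 63, v_k, v_ux, v_uy, v_s}"
  "writes search \<subseteq> {v_kk, v_jj, v_x1, v_y1, v_x2, v_y2, v_it, v_ux, v_uy, v_s, v_ii, v_i, v_j, 63, v_x, v_y, v_a, v_b, v_r,
    v_mL, v_aL, v_bL, v_mR, v_aR, v_bR, v_al, v_L, v_H}"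
  "writes (unshift_centre x y) = {v_d1, v_d2, 63, x, y}"
  using writes_try_direction by (auto simp: prog_defs(1-25) search_def unshift_centre_def)

text \<open>With \<open>q \<le> 3 * \<rho>\<close>, an excess of 293 units of \<open>q / N\<close>
  is at most \<open>879 * \<rho> / N\<close>, and \<open>N \<ge> 1000 / eps\<close> brings this
  below \<open>eps * \<rho>\<close>.\<close>

lemma approx_arith:
  fixes \<rho> q eps :: real
  assumes eps: "eps > 0" and N: "N = nat \<lfloor>1000 / eps\<rfloor> + 1000" and q: "q \<le> 3 * \<rho>" and rho: "0 \<le> \<rho>"
    and j: "x \<le> \<rho> / (q / real N) + 293" and q0: "q > 0"
  shows "x * (q / real N) \<le> (1 + eps) * \<rho>"
proof -
  have Np: "real N > 0" using N by simp
  have "1000 / eps \<le> real N" using N eps by (simp; linarith)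
  then have "1000 \<le> eps * real N" using eps by (simp add: field_simps)
  then have "879 * \<rho> \<le> eps * real N * \<rho>" using rho by (intro mult_right_mono) auto
  then have "293 * q \<le> eps * \<rho> * real N" using q by (simp add: mult.commute mult.left_commute)
  then have "293 * (q / real N) \<le> eps * \<rho>" using Np by (simp add: field_simps)
  moreover have "x * (q / real N) \<le> (\<rho> / (q / real N) + 293) * (q / real N)"
    using j q0 Np by (intro mult_right_mono) auto
  moreover have "(\<rho> / (q / real N) + 293) * (q / real N) = \<rho> + 293 * (q / real N)"
    using q0 Np by (simp add: field_simps)
  ultimately show ?thesis by (simp add: algebra_simps)
qed

lemma program_correct:
  assumes n: "fst st v_n = real (length ds)" "ds \<noteq> []" and eps: "fst st v_eps = eps" "eps > 0"
    and src: "\<And>a. a < 3 * length ds \<Longrightarrow> snd st (if 78 \<le> a then a - 78 else 128 * length ds + a - 79) =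
      (let d = ds ! (a div 3) in if a mod 3 = 0 then fst (fst d) else if a mod 3 = 1 then snd (fst d) else snd d)"
    and zero: "\<And>a. 128 * length ds \<le> a \<Longrightarrow> snd st a = 0"
    and pos: "\<forall>d\<in>set ds. snd d > 0"
  shows "let m = fst (exec (prepare ;; solve) st) in 0 \<le> m v_out \<and>
    union_disks ds \<subseteq> cball (m v_x1, m v_y1) (m v_out) \<union> cball (m v_x2, m v_y2) (m v_out) \<and>
    m v_out \<le> (1 + eps) * two_center_radius ds"
proof -
  let ?n = "length ds"
  define N where "N = nat \<lfloor>1000 / eps\<rfloor> + 1000"
  have N: "N \<ge> 1000" by (simp add: N_def)
  define t1 where "t1 = exec copy_input st"
  define t2 where "t2 = exec find_farthest t1"
  define t3 where "t3 = exec find_radius t2"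
  define t4 where "t4 = exec set_params t3"
  define t5 where "t5 = exec set_frame t4"
  define t6 where "t6 = exec snap_disks t5"
  define t7 where "t7 = exec mark_samples t6"
  define t8 where "t8 = exec search t7"
  define t9 where "t9 = exec (unshift_centre v_x1 v_y1) t8"
  define t10 where "t10 = exec (unshift_centre v_x2 v_y2) t9"
  define t where "t = exec (prepare ;; solve) st"
  have t: "t = exec (Asg v_out ((v_jj [+] Cst 13) [*] v_h)) t10"
    unfolding t_def prepare_def solve_def write_output_def exec.simps(3) t10_def t9_def t8_def t7_def t6_def t5_def
      t4_def t3_def t2_def t1_def ..
  note frames = exec_frame prog_writes
  have f1: "fst t1 x = fst st x" if "x \<notin> {v_n3, v_ib, v_d, v_x}" for x
    unfolding t1_def using that by (simp add: frames)
  have f2: "fst t2 x = fst t1 x" if "x \<notin> {v_p1x, v_p1y, v_p2x, v_p2y, v_far, v_d, v_x, v_y, v_r, v_d1, 63}" for x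
    unfolding t2_def using that by (simp add: frames)
  have f3: "fst t3 x = fst t2 x" if "x \<notin> {v_q, v_d, v_x, v_y, v_r, v_d1, v_d2, 63}" for x
    unfolding t3_def using that by (simp add: frames)
  have f4: "fst t4 x = fst t3 x" if "x \<notin> {v_N, v_M, v_B, v_K, v_T}" for x
    unfolding t4_def using that by (simp add: frames)
  have f5: "fst t5 x = fst t4 x" if "x \<notin> {v_h, v_f, 63, v_vx, v_vy, v_p2nx, v_p2ny, v_rb, v_mb, v_lb, v_hb}" for x
    unfolding t5_def using that by (simp add: frames)
  have f6: "fst t6 x = fst t5 x" if "x \<notin> {v_d, v_x, v_y, v_r, v_d1, v_d2, 63, v_a}" for x
    unfolding t6_def using that by (simp add: frames)
  have f7: "fst t7 x = fst t6 x" if "x \<notin> {v_i, v_j, v_r, 63, v_k, v_ux, v_uy, v_s}" for x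
    unfolding t7_def using that by (simp add: frames)
  have f8: "fst t8 x = fst t7 x" if "x \<in> {v_p1x, v_p1y, v_h, v_vx, v_vy, v_p2nx, v_p2ny}" for x
    unfolding t8_def using that prog_writes(8) by (intro exec_frame) auto
  have f9: "fst t9 x = fst t8 x" if "x \<notin> {v_d1, v_d2, 63, v_x1, v_y1}" for x
    unfolding t9_def using that by (simp add: frames)
  have f10: "fst t10 x = fst t9 x" if "x \<notin> {v_d1, v_d2, 63, v_x2, v_y2}" for x
    unfolding t10_def using that by (simp add: frames)

  define w where "w a = (let d = ds ! (a div 3) in if a mod 3 = 0 then fst (fst d) else if a mod 3 = 1 then snd (fst d) else snd d)" for a
  have "?n \<ge> 1" using n(2) by (simp add: Suc_le_eq)
  have c1: "fst t1 v_ib = 256 * real ?n" "\<forall>a<3 * ?n. snd t1 (256 * ?n + a) = w a" "\<forall>a\<ge>512 * ?n. snd t1 a = 0"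
    using copy_input_spec[OF n(1) \<open>?n \<ge> 1\<close>, of w] src zero unfolding w_def[symmetric] by (simp_all add: Let_def t1_def)
  have inp1: "input_at ds t1"
  proof -
    have "snd t1 (256 * ?n + 3 * k) = fst (fst (ds ! k)) \<and> snd t1 (256 * ?n + 3 * k + 1) = snd (fst (ds ! k)) \<and>
        snd t1 (256 * ?n + 3 * k + 2) = snd (ds ! k)" if "k < ?n" for k
    proof -
      have "(3 * k) div 3 = k" "(3 * k) mod 3 = 0" "(3 * k + 1) div 3 = k" "(3 * k + 1) mod 3 = 1"
        "(3 * k + 2) div 3 = k" "(3 * k + 2) mod 3 = 2" by presburger+
      then have "w (3 * k) = fst (fst (ds ! k))" "w (3 * k + 1) = snd (fst (ds ! k))" "w (3 * k + 2) = snd (ds ! k)"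
        by (simp_all add: w_def Let_def)
      moreover have "snd t1 (256 * ?n + 3 * k) = w (3 * k)" "snd t1 (256 * ?n + (3 * k + 1)) = w (3 * k + 1)"
        "snd t1 (256 * ?n + (3 * k + 2)) = w (3 * k + 2)"
        using that by (intro c1(2)[rule_format], linarith)+
      ultimately show ?thesis unfolding add.assoc by simp
    qed
    then show ?thesis using c1(1) n(1) by (simp add: input_at_def f1)
  qed
  define p1 where "p1 = (fst t2 v_p1x, fst t2 v_p1y)"
  define p2 where "p2 = (fst t2 v_p2x, fst t2 v_p2y)"
  define q where "q = fst t3 v_q"
  have c2: "snd t2 = snd t1" "p1 = fst (ds ! 0)" "p2 \<in> fst ` set ds" "fst t2 v_far = (dist p1 p2)\<^sup>2"
    "\<forall>d\<in>set ds. dist (fst d) p1 \<le> dist p2 p1"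
    using find_farthest_spec[OF inp1 n(2)]
    unfolding Let_def t2_def[symmetric] p1_def[symmetric] p2_def[symmetric] by blast+
  have p1in: "p1 \<in> fst ` set ds" using c2(2) n(2) by simp
  have inp2: "input_at ds t2" using inp1 c2(1) by (simp add: input_at_def f2)
  have c3: "snd t3 = snd t2" "\<forall>d\<in>set ds. min (dist (fst d) p1) (dist (fst d) p2) + snd d \<le> q"
    "\<exists>d\<in>set ds. q = min (dist (fst d) p1) (dist (fst d) p2) + snd d"
    using find_radius_spec[OF inp2 n(2) pos]
    unfolding Let_def t3_def[symmetric] p1_def[symmetric] p2_def[symmetric] q_def[symmetric] by blast+
  have q: "q > 0" using c3(3) pos by (auto intro!: add_nonneg_pos)
  interpret C: two_clusters "set ds" p1 p2 q N
    using N q pos c3(2) p1in c2(3) by unfold_locales auto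
  have c4: "t4 = ((fst t3)(v_N := real N, v_M := 20 * real N, v_B := 40 * real N,
    v_K := 2 * real N + 1, v_T := 3 * real N + 5), snd t3)"
    unfolding t4_def by (rule set_params_spec[OF _ eps(2) N_def]) (simp add: f3 f2 f1 eps)
  have p4: "(fst t4 v_p1x, fst t4 v_p1y) = p1" "(fst t4 v_p2x, fst t4 v_p2y) = p2"
    by (simp_all add: f4 f3 p1_def p2_def)
  have c5: "snd t5 = snd t4" "params ?n N (fst t5)" "fst t5 v_h = C.h" "(fst t5 v_vx, fst t5 v_vy) = C.v"
    "(fst t5 v_p2nx, fst t5 v_p2ny) = C.p2n"
  proof -
    have q4: "fst t4 v_q = q" "fst t4 v_far = (dist p1 p2)\<^sup>2" "fst t4 v_n = real ?n"
      "fst t4 v_N = real N" "fst t4 v_M = 20 * real N" "fst t4 v_B = 40 * real N"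
      "fst t4 v_K = 2 * real N + 1" "fst t4 v_T = 3 * real N + 5"
      using c2(4) n(1) by (simp_all add: f4 f3 f2 f1 q_def) (simp_all add: c4)
    note spec = set_frame_spec[where st = t4 and D = "set ds" and q = q and N = N and n = ?n, unfolded p4,
        OF C.two_clusters_axioms q4]
    from spec show "snd t5 = snd t4" "params ?n N (fst t5)" "fst t5 v_h = C.h" "(fst t5 v_vx, fst t5 v_vy) = C.v"
      "(fst t5 v_p2nx, fst t5 v_p2ny) = C.p2n"
      unfolding Let_def t5_def[symmetric] by blast+
  qed
  have p5: "(fst t5 v_p1x, fst t5 v_p1y) = p1" "(fst t5 v_p2x, fst t5 v_p2y) = p2"
    using p4 by (simp_all add: f5)
  have h5: "snd t5 = snd t1" using c5(1) c4 c3(1) c2(1) by simp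
  have inp5: "input_at ds t5" using inp1 h5 by (simp add: input_at_def f5 f4 f3 f2)
  define G where "G = gridval N (RB ?n) (snd t6)"
  have c6: "radius_grid (C.nd ` set ds) G" "\<forall>a. a < RB ?n \<or> MB ?n N \<le> a \<longrightarrow> snd t6 a = snd t5 a"
  proof -
    have "snd t5 a = 0" if "RB ?n \<le> a" for a using c1(3) h5 that by (simp add: RB_def)
    note spec = snap_disks_spec[OF inp5 c5(2) N, unfolded p5, OF C.two_clusters_axioms c5(3,4) this]
    from spec show "radius_grid (C.nd ` set ds) G" "\<forall>a. a < RB ?n \<or> MB ?n N \<le> a \<longrightarrow> snd t6 a = snd t5 a"
      unfolding Let_def t6_def[symmetric] G_def[symmetric] by blast+
  qed
  have par6: "params ?n N (fst t6)" by (rule params_cong[OF _ c5(2)]) (auto simp: f6)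
  have zero6: "snd t6 a = 0" if "MB ?n N \<le> a" for a
    using c6(2) that c1(3) h5 by (auto simp: MB_def RB_def)
  define S where "S = marks ?n N (snd t7)"
  have S: "S = samples N G"
    unfolding S_def t7_def G_def
    by (rule mark_samples_spec[OF par6 N zero6 c6(1)[unfolded G_def] C.nd_range(3)])
  have par7: "params ?n N (fst t7)" by (rule params_cong[OF _ par6]) (auto simp: f7)
  have Sn: "norm p \<le> 10 * real N" if "p \<in> S" for p
    using norm_samples[OF _ c6(1) C.nd_range(3)] that N by (fastforce simp: S)
  have p27: "(fst t7 v_p2nx, fst t7 v_p2ny) = C.p2n" using c5(5) by (simp add: f7 f6)
  have "S \<subseteq> cball 0 (real N + 4) \<union> cball C.p2n (real N + 4)"
    unfolding S by (rule samples_covered[OF C.N c6(1) C.nd_cover])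
  then obtain j where j: "j \<le> N + 4" "fst t8 v_jj = real j"
    "S \<subseteq> cball (fst t8 v_x1, fst t8 v_y1) (real j + 1) \<union> cball (fst t8 v_x2, fst t8 v_y2) (real j + 1)"
    "\<forall>k\<le>2 * N. \<exists>j'\<ge>j. j' = 0 \<or> \<not> splittable N S k (real j' - 1)"
    using search_spec[OF par7 C.N, unfolded p27, folded S_def, OF Sn] unfolding t8_def[symmetric] Let_def by blast
  let ?e1 = "(fst t8 v_x1, fst t8 v_y1)" and ?e2 = "(fst t8 v_x2, fst t8 v_y2)"
  have "\<Union> (disk ` C.nd ` set ds) \<subseteq> cball ?e1 (real j + 1 + 12) \<union> cball ?e2 (real j + 1 + 12)"
    using disks_covered_if_samples_covered[OF C.N c6(1) _ _ j(3)[unfolded S]] C.nd_range by auto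
  then have cov: "\<Union> (disk ` set ds) \<subseteq> cball (C.unshift ?e1) ((real j + 13) * C.h) \<union> cball (C.unshift ?e2) ((real j + 13) * C.h)"
    using C.original_cover[of ?e1 "real j + 13" ?e2] j(1) N by (simp add: add.assoc)
  have s8: "p1 = (fst t8 v_p1x, fst t8 v_p1y)" "fst t8 v_h = C.h" "(fst t8 v_vx, fst t8 v_vy) = C.v"
    "(fst t8 v_p2nx, fst t8 v_p2ny) = C.p2n"
    using p5 c5 by (simp_all add: f8 f7 f6)
  have s9: "p1 = (fst t9 v_p1x, fst t9 v_p1y)" "fst t9 v_h = C.h" "(fst t9 v_vx, fst t9 v_vy) = C.v"
    "(fst t9 v_p2nx, fst t9 v_p2ny) = C.p2n"
    using s8 by (simp_all add: f9)
  have u1: "(fst t9 v_x1, fst t9 v_y1) = C.unshift ?e1"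
    unfolding t9_def by (rule unshift_centre_spec[OF C.two_clusters_axioms _ _ s8]) auto
  have u2: "(fst t10 v_x2, fst t10 v_y2) = C.unshift (fst t9 v_x2, fst t9 v_y2)"
    unfolding t10_def by (rule unshift_centre_spec[OF C.two_clusters_axioms _ _ s9]) auto
  have out: "(fst t v_x1, fst t v_y1) = C.unshift ?e1" "(fst t v_x2, fst t v_y2) = C.unshift ?e2"
    "fst t v_out = (real j + 13) * C.h"
    using u1 u2 s9(2) j(2) by (simp_all add: t f10 f9)
  have out0: "fst t v_out \<ge> 0" using C.h_pos by (simp add: out)
  \<comment> \<open>The restriction to \<open>\<rho> \<le> q\<close> comes from
    \<open>normalized_cover\<close>; it is removed below in \<open>le\<close>.\<close>
  have key: "fst t v_out \<le> (1 + eps) * \<rho>" if rho: "0 \<le> \<rho>" "\<rho> \<le> q"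
    and cv: "\<Union> (disk ` set ds) \<subseteq> cball c1 \<rho> \<union> cball c2 \<rho>" for \<rho> c1 c2
  proof -
    have cin: "fst d \<in> cball c1 \<rho> \<union> cball c2 \<rho>" if "d \<in> set ds" for d
    proof -
      have "fst d \<in> disk d" using pos that by (force simp: disk_def)
      then show ?thesis using cv that by blast
    qed
    obtain d where d: "d \<in> set ds" "q = min (dist (fst d) p1) (dist (fst d) p2) + snd d" using c3(3) by blast
    have "{p1, p2, fst d} \<subseteq> cball c1 \<rho> \<union> cball c2 \<rho>" using cin p1in c2(3) d(1) by blast
    then have "min (dist (fst d) p1) (dist (fst d) p2) \<le> 2 * \<rho>"
      using c2(5) d(1) by (intro farthest_point_two_approx[of _ _ _ c1 _ c2]) auto
    moreover have "snd d \<le> \<rho>"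
      using disk_radius_le[of "fst d" "snd d" c1 \<rho> c2] cv d(1) pos by (force simp: disk_def)
    \<comment> \<open>In \<open>q\<close>, the distance to the nearer anchor contributes at most
      \<open>2 * \<rho>\<close> and the radius of the disk at most \<open>\<rho>\<close>.\<close>
    ultimately have q3: "q \<le> 3 * \<rho>" using d(2) by linarith
    obtain e1 e2 where "\<Union> (disk ` C.nd ` set ds) \<subseteq> cball e1 (\<rho> / C.h) \<union> cball e2 (\<rho> / C.h)"
      using C.normalized_cover[OF cv rho(2)] by blast
    then have Sc: "S \<subseteq> cball e1 (\<rho> / C.h + 4) \<union> cball e2 (\<rho> / C.h + 4)"
      unfolding S by (rule samples_covered[OF C.N c6(1)])
    have rh: "0 \<le> \<rho> / C.h" "\<rho> / C.h \<le> real N"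
      using rho C.h_pos C.q_div_h divide_right_mono[of \<rho> q C.h] by auto
    have Sne: "S \<noteq> {}"
    proof -
      have "C.nd (hd ds) \<in> C.nd ` set ds" using n(2) by simp
      then show ?thesis unfolding S using samples_nonempty[OF c6(1)] C.nd_range(1) by blast
    qed
    obtain k where k: "k \<le> 2 * N" "\<forall>r\<ge>\<rho> / C.h + 4 + 275. splittable N S k r"
      using net_direction_splits[OF N Sne Sn _ _ Sc] rh unfolding splittable_def by auto
    \<comment> \<open>Direction \<open>k\<close> can be cut at every radius from the threshold on,
      so its recorded failure happened below the threshold, and the final \<open>j\<close> is no
      larger than the \<open>j'\<close> of that failure.\<close>
    then obtain j' where j': "j' \<ge> j" "j' = 0 \<or> \<not> splittable N S k (real j' - 1)" using j(4) by blast
    have "real j' \<le> \<rho> / C.h + 280"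
    proof (cases "j' = 0")
      case True
      then show ?thesis using rh by simp
    next
      case False
      then have "\<not> real j' - 1 \<ge> \<rho> / C.h + 4 + 275" using k(2) j'(2) by blast
      then show ?thesis by linarith
    qed
    then have "real j + 13 \<le> \<rho> / (q / real N) + 293" using j'(1) by (simp add: C.h_def)
    then show ?thesis unfolding out(3) C.h_def by (rule approx_arith[OF eps(2) N_def q3 rho(1) _ q])
  qed
  \<comment> \<open>The disks of radius \<open>q\<close> around the anchors form an admissible pair
    themselves; comparing with them settles every \<open>\<rho> > q\<close>.\<close>
  have fq: "\<Union> (disk ` set ds) \<subseteq> cball p1 q \<union> cball p2 q"
    using C.union_split C.U_cluster by blast
  have le: "fst t v_out \<le> (1 + eps) * \<rho>"
    if rho: "0 \<le> \<rho>" and cv: "\<Union> (disk ` set ds) \<subseteq> cball c1 \<rho> \<union> cball c2 \<rho>" for \<rho> c1 c2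
  proof (cases "\<rho> \<le> q")
    case True
    then show ?thesis using key[OF rho True cv] by simp
  next
    case False
    have "fst t v_out \<le> (1 + eps) * q" using key[OF _ _ fq] q by simp
    also have "\<dots> \<le> (1 + eps) * \<rho>" using False eps by (intro mult_left_mono) auto
    finally show ?thesis .
  qed
  have ud: "union_disks ds = \<Union> (disk ` set ds)" by (simp add: union_disks_def)
  \<comment> \<open>The output is compared with every admissible radius, so it does not matter here
    whether the infimum is attained.\<close>
  have "fst t v_out / (1 + eps) \<le> two_center_radius ds"
    unfolding two_center_radius_def
  proof (rule cInf_greatest)
    show "{\<rho>. 0 \<le> \<rho> \<and> (\<exists>c1 c2. union_disks ds \<subseteq> cball c1 \<rho> \<union> cball c2 \<rho>)} \<noteq> {}"
      using fq q less_imp_le unfolding ud by blast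
  next
    fix \<rho> assume "\<rho> \<in> {\<rho>. 0 \<le> \<rho> \<and> (\<exists>c1 c2. union_disks ds \<subseteq> cball c1 \<rho> \<union> cball c2 \<rho>)}"
    then obtain c1 c2 where "0 \<le> \<rho>" "\<Union> (disk ` set ds) \<subseteq> cball c1 \<rho> \<union> cball c2 \<rho>" unfolding ud by blast
    from le[OF this] show "fst t v_out / (1 + eps) \<le> \<rho>" using eps(2) by (simp add: field_simps)
  qed
  then have "fst t v_out \<le> (1 + eps) * two_center_radius ds" using eps(2) by (simp add: field_simps)
  then show ?thesis using cov out0 unfolding Let_def t_def[symmetric] ud out[symmetric] by blast
qed

section \<open>Running time and machine code\<close>

definition loop_limits :: "nat \<Rightarrow> nat \<Rightarrow> nat \<Rightarrow> nat" where
  "loop_limits n N = (\<lambda>_. 0)(v_n3 := 3 * n, v_n := n, v_M := 20 * N, v_B := 40 * N, v_K := 2 * N + 1, v_T := 3 * N + 5)"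

text \<open>The cubic terms are the marking, with \<open>2 * N + 1\<close> directions for each of
  \<open>400 * N * N\<close> cells, and \<open>3 * N + 5\<close> tests of quadratic cost. The
  numeral generously sums up all constants.\<close>

lemma cost_bound_le:
  assumes "N \<ge> 1"
  shows "cost_bound (loop_limits n N) (prepare ;; solve) \<le> 10 ^ 8 * (n + N ^ 3 + 1)"
proof -
  have *: "1 \<le> N * N" "N \<le> N * (N * N)" "N * N \<le> N * (N * N)" "1 \<le> N * (N * N)"
    using assms by (auto simp: Suc_le_eq)
  show ?thesis
    unfolding power3_eq_cube
    by (simp add: prog_defs loop_limits_def algebra_simps) (use * in linarith)
qed

text \<open>The static bound does not apply to the program as a whole, because \<open>v_n3\<close>
  and the limits in \<open>set_params\<close> are computed on the way. The program is therefore cut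
  behind these assignments and bounded piecewise.\<close>

lemma cost_prepare_solve:
  assumes n: "fst st v_n = real n" and eps: "fst st v_eps = eps" "eps > 0" and N: "N = nat \<lfloor>1000 / eps\<rfloor> + 1000"
  shows "cost (prepare ;; solve) st \<le> cost_bound (loop_limits n N) (prepare ;; solve)"
proof -
  let ?\<beta> = "loop_limits n N"
  define t0 where "t0 = exec (Asg v_ib (Cst 256 [*] v_n)) (exec (Asg v_n3 (Cst 3 [*] v_n)) st)"
  define t1 where "t1 = exec copy_input st"
  define t2 where "t2 = exec find_farthest t1"
  define t3 where "t3 = exec find_radius t2"
  define t4 where "t4 = exec set_params t3"
  note frames = exec_frame prog_writes
  have f: "fst t1 v_n = real n" "fst t2 v_n = real n" "fst t3 v_n = real n" "fst t3 v_eps = eps"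
    using n eps by (simp_all add: t1_def t2_def t3_def frames)
  have "cost copy_input st \<le> cost_bound ?\<beta> copy_input"
  proof -
    define L where "L = For v_d v_n3 copy_cell"
    have "cost L t0 \<le> cost_bound ?\<beta> L"
      by (rule cost_le_cost_bound) (use n in \<open>auto simp: L_def copy_cell_def loop_limits_def t0_def\<close>)
    moreover have "cost copy_input st = cost (Asg v_n3 (Cst 3 [*] v_n)) st +
        (cost (Asg v_ib (Cst 256 [*] v_n)) st + cost L t0)"
      unfolding copy_input_def L_def cost.simps(3) t0_def by simp
    moreover have "cost_bound ?\<beta> copy_input = cost_bound ?\<beta> (Asg v_n3 (Cst 3 [*] v_n)) +
        (cost_bound ?\<beta> (Asg v_ib (Cst 256 [*] v_n)) + cost_bound ?\<beta> L)"
      unfolding copy_input_def L_def cost_bound.simps(3) ..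
    ultimately show ?thesis by simp
  qed
  moreover have "cost find_farthest t1 \<le> cost_bound ?\<beta> find_farthest"
    by (rule cost_le_cost_bound) (use f in \<open>auto simp: prog_defs(1-25) loop_limits_def\<close>)
  moreover have "cost find_radius t2 \<le> cost_bound ?\<beta> find_radius"
    by (rule cost_le_cost_bound) (use f in \<open>auto simp: prog_defs(1-25) loop_limits_def\<close>)
  moreover have "cost set_params t3 \<le> cost_bound ?\<beta> set_params"
    by (rule cost_le_cost_bound) (auto simp: set_params_def)
  moreover have "cost solve t4 \<le> cost_bound ?\<beta> solve"
  proof (rule cost_le_cost_bound)
    have lb: "loop_bounds solve = {v_n, v_M, v_K, v_T, v_B}" by (auto simp: prog_defs)
    have "writes solve \<inter> {v_n, v_M, v_K, v_T, v_B} = {}"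
      using writes_try_direction prog_writes(8)
      by (auto simp: solve_def write_output_def prog_writes(5-7,9))
    then show "writes solve \<inter> loop_bounds solve = {}" by (simp add: lb)
    have "t4 = ((fst t3)(v_N := real N, v_M := 20 * real N, v_B := 40 * real N,
      v_K := 2 * real N + 1, v_T := 3 * real N + 5), snd t3)"
      unfolding t4_def by (rule set_params_spec[OF f(4) eps(2) N])
    then show "fst t4 b \<le> real (?\<beta> b)" if "b \<in> loop_bounds solve" for b
      using that f by (auto simp: lb loop_limits_def)
  qed
  moreover have "cost (prepare ;; solve) st = cost copy_input st + (cost find_farthest t1 + (cost find_radius t2 +
      cost set_params t3)) + cost solve t4"
    unfolding prepare_def cost.simps(3) exec.simps(3) t1_def t2_def t3_def t4_def ..
  moreover have "cost_bound ?\<beta> (prepare ;; solve) = cost_bound ?\<beta> copy_input + (cost_bound ?\<beta> find_farthest +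
      (cost_bound ?\<beta> find_radius + cost_bound ?\<beta> set_params)) + cost_bound ?\<beta> solve"
    unfolding prepare_def cost_bound.simps(3) ..
  ultimately show ?thesis by linarith
qed

section \<open>Freeing the registers\<close>

text \<open>The input occupies every cell that a fixed address could name, so registers have to be freed
  first. For \<open>n > 0\<close> the cell \<open>128 n\<close> lies beyond the input and beyond the registers; \<open>eps\<close> and then
  the contents of cells \<open>2\<close> to \<open>79\<close> are moved there, using only cells \<open>0\<close> and \<open>1\<close>. The case
  \<open>n = 0\<close> is detected beforehand without any spare cell, by comparing \<open>n\<close> with \<open>n - eps / n\<close>
  (division by zero yields zero), an invertible change of cell \<open>1\<close>.\<close>
definition test_empty :: "nat \<Rightarrow> instr list" where
  "test_empty l = [Div 1 1 0, Sub 1 0 1, JLe 0 1 l, Sub 1 0 1, Mul 1 1 0]"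

text \<open>Seven doublings turn \<open>n\<close> into \<open>128 * n\<close>; from then on cell 0
  is the write pointer and cell 1 holds its increment.\<close>

definition save_eps :: "instr list" where
  "save_eps = replicate 7 (Add 0 0 0) @ [StoreI 0 1, Const 1 1]"

definition save_cells :: "nat \<Rightarrow> instr list" where
  "save_cells k = concat (map (\<lambda>j. [Add 0 0 1, StoreI 0 j]) [2..<2 + k])"

text \<open>After 78 saved cells the pointer is \<open>128 * n + 78\<close>. Going back by 78 finds
  \<open>eps\<close>, and dividing the address by 128 recovers \<open>n\<close>; the targets 5 and 6
  are \<open>v_n\<close> and \<open>v_eps\<close>.\<close>

definition restore :: "instr list" where
  "restore = [Const 1 78, Sub 0 0 1, LoadI 6 0, Const 1 128, Div 5 0 1]"

definition two_center_prog :: "instr list" where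
  "two_center_prog = test_empty (175 + length (compc 175 (prepare ;; solve))) @ save_eps @ save_cells 78 @
    restore @ compc 175 (prepare ;; solve)"

lemma length_save_cells: "length (save_cells k) = 2 * k"
  by (induction k) (simp_all add: save_cells_def)

lemma save_cells_Suc: "save_cells (Suc k) = save_cells k @ [Add 0 0 1, StoreI 0 (2 + k)]"
  by (simp add: save_cells_def)

lemma length_two_center_prog: "length two_center_prog = 175 + length (compc 175 (prepare ;; solve))"
  by (simp add: two_center_prog_def test_empty_def save_eps_def length_save_cells restore_def)

lemma code_two_center_prog:
  "code_at two_center_prog 0 (test_empty (length two_center_prog))"
  "code_at two_center_prog 5 save_eps" "code_at two_center_prog 14 (save_cells 78)"
  "code_at two_center_prog 170 restore" "code_at two_center_prog 175 (compc 175 (prepare ;; solve))"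
proof -
  have l: "length (test_empty x) = 5" "length save_eps = 9" "length (save_cells 78) = 156" "length restore = 5" for x
    by (simp_all add: test_empty_def save_eps_def length_save_cells restore_def)
  have "code_at two_center_prog 0 (two_center_prog)" by (simp add: code_at_def)
  then have "code_at two_center_prog 0 (test_empty (length two_center_prog) @ save_eps @ save_cells 78 @
    restore @ compc 175 (prepare ;; solve))"
    unfolding length_two_center_prog by (subst (asm) (2) two_center_prog_def)
  then show "code_at two_center_prog 0 (test_empty (length two_center_prog))"
    "code_at two_center_prog 5 save_eps" "code_at two_center_prog 14 (save_cells 78)"
    "code_at two_center_prog 170 restore" "code_at two_center_prog 175 (compc 175 (prepare ;; solve))"
    by (simp_all add: l del: compc.simps)
qed

text \<open>The memory after \<open>k\<close> cells have been moved: cell \<open>128 * n + i\<close>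
  holds the former content of cell \<open>i + 1\<close>, for
  \<open>1 \<le> i \<le> k\<close>.\<close>

definition saved_mem :: "nat \<Rightarrow> real \<Rightarrow> (nat \<Rightarrow> real) \<Rightarrow> nat \<Rightarrow> nat \<Rightarrow> real" where
  "saved_mem n eps m k a = (if a = 0 then 128 * real n + real k else if a = 1 then 1 else if a = 128 * n then eps
     else if 128 * n < a \<and> a \<le> 128 * n + k then m (a - 128 * n + 1) else m a)"

lemma run_save_cells:
  assumes "code_at P pc (save_cells k)" "k \<le> 78" "n \<ge> 1"
  shows "run P (2 * k) (pc, saved_mem n eps m 0) = (pc + 2 * k, saved_mem n eps m k)"
  using assms(1,2)
proof (induction k)
  case (Suc k)
  have c: "pc + 2 * k < length P" "P ! (pc + 2 * k) = Add 0 0 1" "Suc (pc + 2 * k) < length P"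
    "P ! Suc (pc + 2 * k) = StoreI 0 (2 + k)" and IH: "run P (2 * k) (pc, saved_mem n eps m 0) = (pc + 2 * k, saved_mem n eps m k)"
    using Suc by (simp_all add: save_cells_Suc length_save_cells)
  have fl: "nat \<lfloor>128 * real n + real k + 1\<rfloor> = 128 * n + k + 1"
  proof -
    have "128 * real n + real k + 1 = real (128 * n + k + 1)" by simp
    then show ?thesis by (simp only: floor_of_nat nat_int)
  qed
  have "saved_mem n eps m k (2 + k) = m (2 + k)" using Suc.prems(2) assms(3) by (simp add: saved_mem_def)
  moreover have "step P (pc + 2 * k, saved_mem n eps m k) =
      (Suc (pc + 2 * k), (saved_mem n eps m k)(0 := 128 * real n + real k + 1))"
    using c(1,2) by (simp add: step_at saved_mem_def)
  moreover have "step P (Suc (pc + 2 * k), (saved_mem n eps m k)(0 := 128 * real n + real k + 1)) =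
      (Suc (Suc (pc + 2 * k)), (saved_mem n eps m k)(0 := 128 * real n + real k + 1,
         128 * n + k + 1 := saved_mem n eps m k (2 + k)))"
    unfolding step_at[OF c(3)] c(4) exec_instr.simps fun_upd_same fl by simp
  ultimately have "run P (Suc (Suc (2 * k))) (pc, saved_mem n eps m 0) =
      (Suc (Suc (pc + 2 * k)), (saved_mem n eps m k)(0 := 128 * real n + real k + 1, 128 * n + k + 1 := m (2 + k)))"
    using IH by simp
  moreover have "(saved_mem n eps m k)(0 := 128 * real n + real k + 1, 128 * n + k + 1 := m (2 + k)) = saved_mem n eps m (Suc k)"
    using assms(3) by (auto simp: fun_eq_iff saved_mem_def)
  ultimately show ?case by simp
qed simp

lemma run_prologue:
  assumes m: "m 0 = real n" "m 1 = eps" and n: "n \<ge> 1" and eps: "eps > 0"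
  shows "run two_center_prog 175 (0, m) =
    (175, (saved_mem n eps m 78)(0 := 128 * real n, 1 := 128, 6 := eps, 5 := real n))"
proof -
  let ?P = "two_center_prog"
  have n0: "real n > 0" using n by simp
  have "\<not> eps / real n \<le> 0" using eps n0 by (simp add: not_le)
  then have "run ?P 5 (0, m) = (5, m(1 := eps))"
    using code_two_center_prog(1) n0 m eps
    by (simp add: test_empty_def eval_nat_numeral step_at)
  then have r1: "run ?P 5 (0, m) = (5, m)" using m by (simp add: fun_upd_idem)
  have fl: "nat \<lfloor>128 * real n\<rfloor> = 128 * n"
  proof -
    have "128 * real n = real (128 * n)" by simp
    then show ?thesis by (simp only: floor_of_nat nat_int)
  qed
  have "run ?P 7 (5, m) = (12, m(0 := 128 * real n))"
    using code_two_center_prog(2) m by (simp add: save_eps_def eval_nat_numeral step_at)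
  then have "run ?P 9 (5, m) = (14, m(0 := 128 * real n, 128 * n := eps, 1 := 1))"
    using code_two_center_prog(2) m fl by (simp add: save_eps_def eval_nat_numeral step_at)
  moreover have "m(0 := 128 * real n, 128 * n := eps, 1 := 1) = saved_mem n eps m 0"
    using n by (auto simp: fun_eq_iff saved_mem_def)
  ultimately have r2: "run ?P 9 (5, m) = (14, saved_mem n eps m 0)" by simp
  have r3: "run ?P 156 (14, saved_mem n eps m 0) = (170, saved_mem n eps m 78)"
    using run_save_cells[OF code_two_center_prog(3) _ n, of eps m] by simp
  define z where "z = saved_mem n eps m 78"
  have z: "z 0 = 128 * real n + 78" "z (128 * n) = eps" using n by (simp_all add: z_def saved_mem_def)
  have "run ?P 5 (170, z) = (175, z(0 := 128 * real n, 1 := 128, 6 := eps, 5 := real n))"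
    using code_two_center_prog(4) z fl n
    by (simp add: restore_def eval_nat_numeral step_at fun_upd_twist)
  then have "run ?P (5 + 9 + 156 + 5) (0, m) = (175, z(0 := 128 * real n, 1 := 128, 6 := eps, 5 := real n))"
    using r1 r2 r3 by (simp only: run_add z_def)
  then show ?thesis by (simp add: z_def)
qed

lemma cube_sum_le: "(x + y) ^ 3 \<le> 4 * (x ^ 3 + y ^ 3)" if "0 \<le> x" "0 \<le> y" for x y :: real
proof -
  have "4 * (x ^ 3 + y ^ 3) - (x + y) ^ 3 = 3 * (x + y) * (x - y)\<^sup>2" by (simp add: power3_eq_cube power2_eq_square algebra_simps)
  moreover have "0 \<le> 3 * (x + y) * (x - y)\<^sup>2" using that by simp
  ultimately show ?thesis by linarith
qed

theorem theorem4:
  "\<exists>(P :: instr list) (c :: real). c > 0 \<and>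
     (\<forall>(ds :: disk_rep list) (eps :: real).
        eps > 0 \<longrightarrow> distinct ds \<longrightarrow> (\<forall>d\<in>set ds. snd d > 0) \<longrightarrow>
        (\<forall>d\<in>set ds. \<forall>d'\<in>set ds. d \<noteq> d' \<longrightarrow> \<not> disk d \<subseteq> disk d') \<longrightarrow>
        (\<exists>k. real k \<le> c * (real (length ds) + 1 / eps ^ 3 + 1) \<and>
             halted P (run P k (init_config ds eps)) \<and>
             (let m = snd (run P k (init_config ds eps)) in
                m 4 \<ge> 0 \<and>
                union_disks ds \<subseteq> cball (m 0, m 1) (m 4) \<union> cball (m 2, m 3) (m 4) \<and>
                m 4 \<le> (1 + eps) * two_center_radius ds)))"
proof (rule exI[of _ two_center_prog], rule exI[of _ "10 ^ 19"], intro conjI allI impI)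
  show "(10 ^ 19 :: real) > 0" by simp
next
  fix ds :: "disk_rep list" and eps :: real
  assume eps: "eps > 0" and pos: "\<forall>d\<in>set ds. snd d > 0"
  let ?P = two_center_prog and ?n = "length ds"
  define m where "m = snd (init_config ds eps)"
  have ini: "init_config ds eps = (0, m)" by (simp add: m_def init_config_def)
  have m0: "m 0 = real ?n" "m 1 = eps" by (simp_all add: m_def init_config_def)
  show "\<exists>k. real k \<le> 10 ^ 19 * (real ?n + 1 / eps ^ 3 + 1) \<and>
     halted ?P (run ?P k (init_config ds eps)) \<and>
     (let m = snd (run ?P k (init_config ds eps)) in
        m 4 \<ge> 0 \<and>
        union_disks ds \<subseteq> cball (m 0, m 1) (m 4) \<union> cball (m 2, m 3) (m 4) \<and>
        m 4 \<le> (1 + eps) * two_center_radius ds)"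
  proof (cases "ds = []")
    case True
    \<comment> \<open>With \<open>n = 0\<close> the quotient \<open>eps / n\<close> is 0 and the
      jump to the end is taken; the radius in cell 4 is 0 from the start.\<close>
    have "run ?P 3 (0, m) = (length ?P, m(1 := 0))"
      using code_two_center_prog(1) m0 True by (simp add: test_empty_def eval_nat_numeral step_at)
    moreover have "m 4 = 0" using True by (simp add: m_def init_config_def)
    moreover have "two_center_radius ds \<ge> 0" unfolding two_center_radius_def
      by (rule cInf_greatest) (use True in \<open>auto simp: union_disks_def intro!: exI[of _ 0]\<close>)
    moreover have "real 3 \<le> 10 ^ 19 * (real ?n + 1 / eps ^ 3 + 1)"
    proof -
      have "1 \<le> real ?n + 1 / eps ^ 3 + 1" using eps by simp
      then show ?thesis by (simp; linarith)
    qed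
    moreover have "union_disks ds = {}" using True by (simp add: union_disks_def)
    ultimately show ?thesis unfolding ini using eps
      by (intro exI[of _ 3]) (simp add: halted_def)
  next
    case False
    then have n: "?n \<ge> 1" by (simp add: Suc_le_eq)
    define z where "z = (saved_mem ?n eps m 78)(0 := 128 * real ?n, 1 := 128, 6 := eps, 5 := real ?n)"
    define st :: state where "st = (z, \<lambda>a. z (heap0 + a))"
    have rep: "mem_rep z st" by (simp add: mem_rep_def st_def)
    have s: "fst st v_n = real ?n" "fst st v_eps = eps" by (simp_all add: st_def z_def)
    have src: "snd st (if 78 \<le> a then a - 78 else 128 * ?n + a - 79) =
      (let d = ds ! (a div 3) in if a mod 3 = 0 then fst (fst d) else if a mod 3 = 1 then snd (fst d) else snd d)"
      if a: "a < 3 * ?n" for a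
    proof -
      have "heap0 + (if 78 \<le> a then a - 78 else 128 * ?n + a - 79) = (if 78 \<le> a then a + 2 else 128 * ?n + a + 1)"
        using n by (simp add: heap0_def)
      then have "snd st (if 78 \<le> a then a - 78 else 128 * ?n + a - 79) = m (a + 2)"
        using n a False by (simp add: st_def z_def saved_mem_def)
      also have "\<dots> = (let d = ds ! (a div 3) in if a mod 3 = 0 then fst (fst d) else if a mod 3 = 1 then snd (fst d) else snd d)"
        using a by (simp add: m_def init_config_def Let_def)
      finally show ?thesis .
    qed
    \<comment> \<open>The saved cells end at \<open>128 * n + 78\<close>, just before cell
      \<open>128 * n + 80\<close>, which is heap address \<open>128 * n\<close>.\<close>
    have zero: "snd st a = 0" if "128 * ?n \<le> a" for a
      using that n by (simp add: st_def z_def saved_mem_def heap0_def m_def init_config_def)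
    obtain m' where m': "run ?P (cost (prepare ;; solve) st) (175, z) = (175 + length (compc 175 (prepare ;; solve)), m')"
      "mem_rep m' (exec (prepare ;; solve) st)"
      using compc_correct[OF code_two_center_prog(5) wf_prog rep] by blast
    define k where "k = 175 + cost (prepare ;; solve) st"
    have run: "run ?P k (init_config ds eps) = (length ?P, m')"
      using run_prologue[OF m0 n eps] m'(1) unfolding k_def ini length_two_center_prog run_add z_def by simp
    have "m' i = fst (exec (prepare ;; solve) st) i" if "i < 5" for i
      using m'(2) that by (simp add: mem_rep_def tmp_def)
    then have out: "m' 0 = fst (exec (prepare ;; solve) st) v_x1" "m' 1 = fst (exec (prepare ;; solve) st) v_y1"
      "m' 2 = fst (exec (prepare ;; solve) st) v_x2" "m' 3 = fst (exec (prepare ;; solve) st) v_y2"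
      "m' 4 = fst (exec (prepare ;; solve) st) v_out" by simp_all
    have corr: "0 \<le> m' 4 \<and> union_disks ds \<subseteq> cball (m' 0, m' 1) (m' 4) \<union> cball (m' 2, m' 3) (m' 4) \<and>
        m' 4 \<le> (1 + eps) * two_center_radius ds"
      using program_correct[OF s(1) False s(2) eps src zero pos] unfolding Let_def out .
    define N where "N = nat \<lfloor>1000 / eps\<rfloor> + 1000"
    have "cost (prepare ;; solve) st \<le> 10 ^ 8 * (?n + N ^ 3 + 1)"
      using cost_prepare_solve[OF s eps N_def] cost_bound_le[of N ?n] by (simp add: N_def)
    then have "k \<le> 175 + 10 ^ 8 * (?n + N ^ 3 + 1)" by (simp add: k_def)
    then have "real k \<le> real (175 + 10 ^ 8 * (?n + N ^ 3 + 1))" by (rule of_nat_mono)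
    also have "\<dots> = 175 + 10 ^ 8 * (real ?n + real N ^ 3 + 1)" by simp
    also have "\<dots> \<le> 175 + 10 ^ 8 * (real ?n + 4 * (10 ^ 9 * (1 / eps ^ 3) + 10 ^ 9) + 1)"
    proof -
      have "0 \<le> 1000 / eps" using eps by simp
      then have "real N \<le> 1000 / eps + 1000" unfolding N_def by (simp; linarith)
      then have "real N ^ 3 \<le> (1000 / eps + 1000) ^ 3" by (rule power_mono) simp
      also have "\<dots> \<le> 4 * ((1000 / eps) ^ 3 + 1000 ^ 3)" using eps by (intro cube_sum_le) auto
      also have "(1000 / eps) ^ 3 = 10 ^ 9 * (1 / eps ^ 3)" by (simp add: power_divide)
      finally show ?thesis by simp
    qed
    also have "\<dots> \<le> 10 ^ 19 * (real ?n + 1 / eps ^ 3 + 1)"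
    proof -
      have le: "175 + 10 ^ 8 * (x + 4 * (10 ^ 9 * y + 10 ^ 9) + 1) \<le> 10 ^ 19 * (x + y + 1)"
        if "0 \<le> x" "0 \<le> y" for x y :: real
        using that by simp
      show ?thesis by (rule le) (use eps in simp_all)
    qed
    finally show ?thesis using corr run by (intro exI[of _ k]) (simp add: halted_def Let_def)
  qed
qed

end
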